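(* Consider the excited random walk with Markovian cookie stacks described in the context, and assume $\bar{p}=\mu\cdot\mathbf{p}\neq 1/2$. Then: (Transience) If $\bar p>1/2$ then $P_\eta(\lim_{n\to\infty}X_n=\infty)=1$ for every initial distribution $\eta$ on $\mathcal R$; if $\bar p<1/2$ then $P_\eta(\lim_{n\to\infty}X_n=-\infty)=1$ for every $\eta$. (Ballisticity) For every initial distribution $\eta$, the deterministic constant $v_0$ with $X_n/n\to v_0$ $P_\eta$-a.s. is non-zero: $v_0>0$ if $\bar p>1/2$ and $v_0<0$ if $\bar p<1/2$. (Gaussian limit) For every distribution $\eta$ on $\mathcal R$ there is a constant $b=b(K,\mathbf p,\eta)>0$ such that for all $x\in\mathbb R$, $$\lim_{n\to\infty}P_\eta\Big(\frac{X_n-nv_0}{b\sqrt n}\le x\Big)=\Phi(x):=\int_{-\infty}^x\frac{1}{\sqrt{2\pi}}e^{-z^2/2}\,dz.$$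
   Context: Let $\mathcal R=\{1,\dots,N\}$ and let $K$ be a stochastic matrix on $\mathcal R$ such that the Markov chain with transition matrix $K$ has a unique closed irreducible subset $\mathcal R_0\subseteq\mathcal R$; let $\mu$ (a row vector) be its unique stationary distribution. Fix $p:\mathcal R\to(0,1)$ and write $\mathbf p=(p(1),\dots,p(N))^t$, $\bar p=\mu\cdot\mathbf p$. For a probability distribution $\eta$ on $\mathcal R$, $\mathbb P_\eta$ denotes the law of an i.i.d. family $\{(R^x_j)_{j\ge1}\}_{x\in\mathbb Z}$ of Markov chains with transition matrix $K$ and $R^x_1\sim\eta$; the cookie environment is $\omega_x(j)=p(R^x_j)$. Given $\omega$, the excited random walk $(X_n)_{n\ge0}$ has quenched law $P_\omega$ with $X_0=0$ and $P_\omega(X_{n+1}=X_n+1\mid X_0,\dots,X_n)=1-P_\omega(X_{n+1}=X_n-1\mid X_0,\dots,X_n)=\omega_{X_n}(\#\{k\le n:X_k=X_n\})$. The averaged law is $P_\eta(\cdot)=\mathbb E_\eta[P_\omega(\cdot)]$. It is known that for each $\eta$ there is a deterministic $v_0\in[-1,1]$ with $X_n/n\to v_0$ $P_\eta$-a.s. *)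

theory Defs
  imports "HOL-Probability.Probability"
begin

section \<open>Markov chain on R = {1..N}\<close>

definition stochastic :: "nat \<Rightarrow> (nat \<Rightarrow> nat \<Rightarrow> real) \<Rightarrow> bool" where
  "stochastic N K \<longleftrightarrow> (\<forall>i\<in>{1..N}. (\<forall>j\<in>{1..N}. K i j \<ge> 0) \<and> (\<Sum>j=1..N. K i j) = 1)"

definition prob_vector :: "nat \<Rightarrow> (nat \<Rightarrow> real) \<Rightarrow> bool" where
  "prob_vector N q \<longleftrightarrow> (\<forall>i\<in>{1..N}. q i \<ge> 0) \<and> (\<Sum>i=1..N. q i) = 1"

text \<open>One-step transition graph of the chain.\<close>
definition trans_edges :: "nat \<Rightarrow> (nat \<Rightarrow> nat \<Rightarrow> real) \<Rightarrow> (nat \<times> nat) set" where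
  "trans_edges N K = {(i, j). i \<in> {1..N} \<and> j \<in> {1..N} \<and> K i j > 0}"

definition closed_set :: "nat \<Rightarrow> (nat \<Rightarrow> nat \<Rightarrow> real) \<Rightarrow> nat set \<Rightarrow> bool" where
  "closed_set N K C \<longleftrightarrow> C \<subseteq> {1..N} \<and> (\<forall>i\<in>C. \<forall>j\<in>{1..N}. K i j > 0 \<longrightarrow> j \<in> C)"

definition closed_irreducible :: "nat \<Rightarrow> (nat \<Rightarrow> nat \<Rightarrow> real) \<Rightarrow> nat set \<Rightarrow> bool" where
  "closed_irreducible N K C \<longleftrightarrow> closed_set N K C \<and> C \<noteq> {} \<and>
     (\<forall>i\<in>C. \<forall>j\<in>C. (i, j) \<in> (trans_edges N K)\<^sup>*)"

definition stationary :: "nat \<Rightarrow> (nat \<Rightarrow> nat \<Rightarrow> real) \<Rightarrow> (nat \<Rightarrow> real) \<Rightarrow> bool" where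
  "stationary N K \<mu> \<longleftrightarrow> prob_vector N \<mu> \<and> (\<forall>j\<in>{1..N}. (\<Sum>i=1..N. \<mu> i * K i j) = \<mu> j)"

section \<open>Construction of the probability space (coupling with i.i.d. uniforms)\<close>

text \<open>Inverse-CDF sampling from a distribution q on {1..N} using u \<in> [0,1].\<close>
definition sample :: "nat \<Rightarrow> (nat \<Rightarrow> real) \<Rightarrow> real \<Rightarrow> nat" where
  "sample N q u = (if \<exists>r\<in>{1..N}. u < (\<Sum>s=1..r. q s)
                   then (LEAST r. 1 \<le> r \<and> r \<le> N \<and> u < (\<Sum>s=1..r. q s)) else N)"

text \<open>Markov chain with initial law eta and transition K driven by uniforms U;
  index j = 0,1,2,... corresponds to R_1, R_2, R_3, ...\<close>
primrec chain :: "nat \<Rightarrow> (nat \<Rightarrow> nat \<Rightarrow> real) \<Rightarrow> (nat \<Rightarrow> real) \<Rightarrow> (nat \<Rightarrow> real) \<Rightarrow> nat \<Rightarrow> nat" where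
  "chain N K \<eta> U 0 = sample N \<eta> (U 0)"
| "chain N K \<eta> U (Suc j) = sample N (K (chain N K \<eta> U j)) (U (Suc j))"

text \<open>Underlying probability space: i.i.d. uniform [0,1] variables indexed by
  Inl (x, j) (used for the cookie stack at site x) and Inr n (walk coin at time n).\<close>
definition unif :: "real measure" where
  "unif = uniform_measure lborel {0..1}"

definition erw_space :: "((int \<times> nat) + nat \<Rightarrow> real) measure" where
  "erw_space = PiM UNIV (\<lambda>_. unif)"

text \<open>R^x_j (paper indexing, j \<ge> 1).\<close>
definition cookie_state :: "nat \<Rightarrow> (nat \<Rightarrow> nat \<Rightarrow> real) \<Rightarrow> (nat \<Rightarrow> real)
    \<Rightarrow> ((int \<times> nat) + nat \<Rightarrow> real) \<Rightarrow> int \<Rightarrow> nat \<Rightarrow> nat" where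
  "cookie_state N K \<eta> w x j = chain N K \<eta> (\<lambda>i. w (Inl (x, i))) (j - 1)"

text \<open>Cookie environment omega_x(j) = p(R^x_j).\<close>
definition cookie_env :: "nat \<Rightarrow> (nat \<Rightarrow> nat \<Rightarrow> real) \<Rightarrow> (nat \<Rightarrow> real) \<Rightarrow> (nat \<Rightarrow> real)
    \<Rightarrow> ((int \<times> nat) + nat \<Rightarrow> real) \<Rightarrow> int \<Rightarrow> nat \<Rightarrow> real" where
  "cookie_env N K p \<eta> w x j = p (cookie_state N K \<eta> w x j)"

text \<open>The path [X_0, ..., X_n]: from X_n = x, with c = #{k \<le> n. X_k = x},
  step right iff the coin at time n is below omega_x(c).\<close>
primrec erw_path :: "(int \<Rightarrow> nat \<Rightarrow> real) \<Rightarrow> (nat \<Rightarrow> real) \<Rightarrow> nat \<Rightarrow> int list" where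
  "erw_path \<omega> V 0 = [0]"
| "erw_path \<omega> V (Suc n) =
     (let xs = erw_path \<omega> V n; x = last xs; c = count_list xs x
      in xs @ [if V n < \<omega> x c then x + 1 else x - 1])"

definition erw :: "nat \<Rightarrow> (nat \<Rightarrow> nat \<Rightarrow> real) \<Rightarrow> (nat \<Rightarrow> real) \<Rightarrow> (nat \<Rightarrow> real)
    \<Rightarrow> ((int \<times> nat) + nat \<Rightarrow> real) \<Rightarrow> nat \<Rightarrow> int" where
  "erw N K p \<eta> w n = last (erw_path (cookie_env N K p \<eta> w) (\<lambda>m. w (Inr m)) n)"

text \<open>Standard normal distribution function.\<close>
definition Phi :: "real \<Rightarrow> real" where
  "Phi x = (LBINT z:{..x}. 1 / sqrt (2 * pi) * exp (- (z\<^sup>2) / 2))"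

end

theory Submission
  imports Defs "HOL-Real_Asymp.Real_Asymp"
begin

text \<open>
  Moving the coins from times to visits turns the walk into a walk driven by independent stacks of arrows.
  By reflection let \<open>p\<close> average to more than \<open>1/2\<close>. The numbers of left steps from the sites below \<open>n\<close> before the
  hitting time \<open>T n\<close> form, read from right to left, a Markov chain \<open>Z\<close> with \<open>Z' = F (Z + 1)\<close>, where \<open>F k\<close> is the
  number of left arrows before the \<open>k\<close>-th right arrow of a fresh stack, and \<open>T n\<close> is \<open>n\<close> plus twice the sum of
  this chain, up to a bounded contribution of the negative sites. An exponential supermartingale for the cookie
  chain gives \<open>E [F (k + 1)\<^sup>2] \<le> \<rho> k\<^sup>2 + C\<close> with \<open>\<rho> < 1\<close>, so \<open>Z\<close> killed at zero decays geometrically in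
  mean square. As \<open>F\<close> is monotone, chains started at different levels coalesce when the larger one
  vanishes; hence covariances decay geometrically, backtracking has geometric tails, and restarting the chain at
  the ends of blocks of length \<open>L\<close> costs a variance of order \<open>n / L\<close>. The classical central limit theorem for the
  independent blocks thus passes to \<open>T n\<close> as \<open>L\<close> tends to infinity. The limit variance is positive because
  flipping the first arrow of a stack, a change of law with bounded density, increases \<open>T n\<close> by at least two.
\<close>

section \<open>Walks driven by stacks of arrows\<close>

text \<open>The level from which the left-step chain is read moves with \<open>n\<close>, so the
  counts for different \<open>n\<close> are not partial sums of one stationary sequence.
  Monotonicity replaces stationarity: raising the level only increases the count at a fixed site, by
  at most a chain killed at zero. The errors are therefore nonnegative and upper bounds on
  covariances suffice.

  The cookie chain may be periodic and may have transient states, so no mixing rate is at hand.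
  Uniqueness of the closed class makes the stationary vector unique; hence Cesaro averages exceed
  some \<open>c > 1/2\<close> from every starting state, and hence a corrector \<open>h\<close>
  makes the drift positive in each state. This is what the exponential supermartingale uses. At
  density \<open>c > 1/2\<close> of right arrows fewer than one left arrow falls on each right
  arrow, whence \<open>\<rho> < 1\<close>.

  The limit variance arises only as a limit along \<open>n\<close>, so its positivity needs its own
  argument: Cauchy-Schwarz against the sum of the density differences of the two flips, in the
  manner of the Cramer-Rao bound.\<close>

definition ones :: "(nat \<Rightarrow> bool) \<Rightarrow> nat \<Rightarrow> nat" where
  "ones a n = card {j. j < n \<and> a j}"

definition good :: "(nat \<Rightarrow> bool) \<Rightarrow> bool" where
  "good a \<longleftrightarrow> (\<forall>k. \<exists>n. k \<le> ones a n)"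

text \<open>\<open>True\<close> stands for a right arrow. The dummy value for stacks with finitely many right arrows
  keeps \<open>zeros_before a\<close> monotone.\<close>

definition zeros_before :: "(nat \<Rightarrow> bool) \<Rightarrow> nat \<Rightarrow> nat" where
  "zeros_before a k = (if good a then (LEAST n. k \<le> ones a n) - k else 0)"

lemma ones_0 [simp]: "ones a 0 = 0"
  by (simp add: ones_def)

lemma ones_Suc: "ones a (Suc n) = ones a n + (if a n then 1 else 0)"
proof -
  have "{j. j < Suc n \<and> a j} = {j. j < n \<and> a j} \<union> (if a n then {n} else {})"
    by (auto simp: less_Suc_eq)
  then show ?thesis
    by (auto simp: ones_def card_insert_if)
qed

lemma ones_le: "ones a n \<le> n"
  by (induction n) (auto simp: ones_Suc)

lemma ones_mono: "m \<le> n \<Longrightarrow> ones a m \<le> ones a n"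
  unfolding ones_def by (intro card_mono) auto

lemma Least_ones_ge: "good a \<Longrightarrow> k \<le> (LEAST n. k \<le> ones a n)"
  by (metis (mono_tags, lifting) LeastI_ex good_def le_trans ones_le)

lemma ones_Least:
  assumes "good a" shows "ones a (LEAST n. k \<le> ones a n) = k"
proof -
  let ?n = "LEAST n. k \<le> ones a n"
  have ge: "k \<le> ones a ?n"
    using assms by (metis (mono_tags, lifting) LeastI_ex good_def)
  show ?thesis
  proof (cases ?n)
    case 0
    then show ?thesis using ge by simp
  next
    case (Suc m)
    then have "ones a m < k"
      by (metis lessI not_le not_less_Least)
    then have "ones a ?n \<le> k"
      unfolding Suc by (simp add: ones_Suc)
    then show ?thesis using ge by simp
  qed
qed

lemma zeros_before_0 [simp]: "zeros_before a 0 = 0"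
  by (auto simp: zeros_before_def)

lemma zeros_before_mono: "k \<le> l \<Longrightarrow> zeros_before a k \<le> zeros_before a l"
proof (induction l rule: dec_induct)
  case base
  then show ?case by simp
next
  case (step l)
  have "zeros_before a l \<le> zeros_before a (Suc l)" if g: "good a"
  proof -
    have "(LEAST n. l \<le> ones a n) < (LEAST n. Suc l \<le> ones a n)"
      using ones_Least[OF g, of l] ones_Least[OF g, of "Suc l"]
      by (metis Suc_n_not_le_n not_less ones_mono)
    then show ?thesis
      using g by (simp add: zeros_before_def)
  qed
  then have "zeros_before a l \<le> zeros_before a (Suc l)"
    by (auto simp: zeros_before_def)
  then show ?case using step by simp
qed

text \<open>The inequality is strict because the arrow at index \<open>n\<close> is itself a left
  arrow preceding the \<open>k\<close>-th right one, while \<open>n - ones a n\<close> counts only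
  the left arrows before it.\<close>

lemma zeros_before_less:
  assumes g: "good a" and "\<not> a n" "ones a n < k"
  shows "n - ones a n < zeros_before a k"
proof -
  let ?r = "ones a n"
  let ?m = "LEAST i. Suc ?r \<le> ones a i"
  have "ones a ?m = Suc ?r" by (rule ones_Least[OF g])
  moreover have "ones a (Suc n) = ?r" using assms by (simp add: ones_Suc)
  ultimately have "Suc n < ?m"
    by (metis Suc_n_not_le_n not_less ones_mono)
  then have "n - ?r < zeros_before a (Suc ?r)"
    using g ones_le[of a n] by (simp add: zeros_before_def)
  also have "\<dots> \<le> zeros_before a k"
    using assms by (intro zeros_before_mono) simp
  finally show ?thesis .
qed

lemma zeros_before_at:
  assumes g: "good a" and "a n"
  shows "zeros_before a (Suc (ones a n)) = n - ones a n"
proof -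
  have "(LEAST i. Suc (ones a n) \<le> ones a i) = Suc n"
  proof (rule Least_equality)
    show "Suc (ones a n) \<le> ones a (Suc n)" using assms by (simp add: ones_Suc)
    show "Suc n \<le> i" if "Suc (ones a n) \<le> ones a i" for i
      using that ones_mono[of i n a] by (meson Suc_n_not_le_n le_trans not_less_eq_eq)
  qed
  then show ?thesis using g by (simp add: zeros_before_def)
qed

text \<open>The \<open>k\<close>-th right arrow completes a prefix of length
  \<open>k + zeros_before a k\<close>. Tails of this waiting time thus become lower tails of a
  count, the form in which the exponential bound \<open>ones_tail\<close> applies.\<close>

lemma zeros_before_gt_iff:
  assumes g: "good a" and k: "0 < k"
  shows "m < zeros_before a k \<longleftrightarrow> ones a (k + m) < k"
proof
  assume "m < zeros_before a k"
  then have "k + m < (LEAST n. k \<le> ones a n)"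
    using g by (simp add: zeros_before_def)
  then show "ones a (k + m) < k" by (meson not_le not_less_Least)
next
  assume "ones a (k + m) < k"
  then have "k + m < (LEAST n. k \<le> ones a n)"
    using ones_Least[OF g, of k] by (metis not_le ones_mono)
  then show "m < zeros_before a k"
    using g by (simp add: zeros_before_def)
qed

lemma zeros_before_all_ones:
  assumes "\<And>j. j < k \<Longrightarrow> a j" shows "zeros_before a k = 0"
proof (cases "good a")
  case True
  have "ones a k = k"
  proof -
    have "{j. j < k \<and> a j} = {..<k}" using assms by auto
    then show ?thesis by (simp add: ones_def)
  qed
  then have "(LEAST n. k \<le> ones a n) \<le> k" by (intro Least_le) simp
  then show ?thesis by (simp add: zeros_before_def)
qed (simp add: zeros_before_def)

section \<open>Changing the first arrow of a stack\<close>

lemma ones_Cons: "ones (case_nat b a) (Suc n) = (if b then 1 else 0) + ones a n"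
  by (induction n) (auto simp: ones_Suc)

lemma good_Cons: "good (case_nat b a) \<longleftrightarrow> good a"
proof
  assume L: "good (case_nat b a)"
  show "good a"
    unfolding good_def
  proof
    fix k
    obtain n where n: "Suc k \<le> ones (case_nat b a) n" using L unfolding good_def by blast
    then obtain m where "n = Suc m" by (cases n) auto
    with n show "\<exists>n. k \<le> ones a n"
      by (intro exI[of _ m]) (auto simp: ones_Cons split: if_splits)
  qed
next
  assume L: "good a"
  show "good (case_nat b a)"
    unfolding good_def
  proof
    fix k
    obtain n where n: "k \<le> ones a n" using L unfolding good_def by blast
    then show "\<exists>n. k \<le> ones (case_nat b a) n"
      by (intro exI[of _ "Suc n"]) (auto simp: ones_Cons)
  qed
qed

text \<open>Turning the first arrow to the left removes one right arrow from every nonempty prefix,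
  so the \<open>k\<close>-th right arrow is delayed strictly. All strictness in the variance lower
  bound comes from here.\<close>

lemma zeros_before_flip:
  assumes g: "good a" and k: "0 < k"
  shows "zeros_before (case_nat True a) k < zeros_before (case_nat False a) k"
proof -
  let ?m = "zeros_before (case_nat True a) k"
  have gT: "good (case_nat True a)" and gF: "good (case_nat False a)" using g by (auto simp: good_Cons)
  have "ones (case_nat False a) (k + ?m) < k"
  proof -
    obtain l where l: "k + ?m = Suc l" using k by (cases "k + ?m") auto
    have "(LEAST n. k \<le> ones (case_nat True a) n) = k + ?m"
      using gT Least_ones_ge[OF gT, of k] by (simp add: zeros_before_def)
    then have "ones (case_nat True a) (k + ?m) = k"
      using ones_Least[OF gT, of k] by simp
    then show ?thesis unfolding l by (simp add: ones_Cons)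
  qed
  then show ?thesis
    using zeros_before_gt_iff[OF gF k] by blast
qed

text \<open>A state of the walk consists of the position and of the number of arrows used at each site.\<close>

primrec awalk :: "(int \<Rightarrow> nat \<Rightarrow> bool) \<Rightarrow> nat \<Rightarrow> int \<times> (int \<Rightarrow> nat)" where
  "awalk a 0 = (0, \<lambda>_. 0)"
| "awalk a (Suc n) = (let (x, v) = awalk a n in
     (if a x (v x) then x + 1 else x - 1, v(x := Suc (v x))))"

definition pos :: "(int \<Rightarrow> nat \<Rightarrow> bool) \<Rightarrow> nat \<Rightarrow> int" where
  "pos a n = fst (awalk a n)"

definition used :: "(int \<Rightarrow> nat \<Rightarrow> bool) \<Rightarrow> nat \<Rightarrow> int \<Rightarrow> nat" where
  "used a n = snd (awalk a n)"

definition lefts :: "(int \<Rightarrow> nat \<Rightarrow> bool) \<Rightarrow> nat \<Rightarrow> int \<Rightarrow> nat" where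
  "lefts a n x = used a n x - ones (a x) (used a n x)"

definition rights :: "(int \<Rightarrow> nat \<Rightarrow> bool) \<Rightarrow> nat \<Rightarrow> int \<Rightarrow> nat" where
  "rights a n x = ones (a x) (used a n x)"

lemma pos_0 [simp]: "pos a 0 = 0" and used_0 [simp]: "used a 0 x = 0"
  by (auto simp: pos_def used_def)

lemma pos_Suc: "pos a (Suc n) = (if a (pos a n) (used a n (pos a n)) then pos a n + 1 else pos a n - 1)"
  by (auto simp: pos_def used_def Let_def split: prod.splits)

lemma used_Suc: "used a (Suc n) = (used a n)(pos a n := Suc (used a n (pos a n)))"
  by (auto simp: pos_def used_def Let_def split: prod.splits)

lemma lefts_0 [simp]: "lefts a 0 x = 0" and rights_0 [simp]: "rights a 0 x = 0"
  by (auto simp: lefts_def rights_def)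

lemma lefts_Suc: "lefts a (Suc n) x = lefts a n x + (if x = pos a n \<and> pos a (Suc n) = x - 1 then 1 else 0)"
proof (cases "x = pos a n")
  case True
  show ?thesis
    using ones_le[of "a (pos a n)" "used a n (pos a n)"]
    unfolding True by (simp add: lefts_def used_Suc pos_Suc ones_Suc Suc_diff_le)
qed (simp add: lefts_def used_Suc)

lemma rights_Suc: "rights a (Suc n) x = rights a n x + (if x = pos a n \<and> pos a (Suc n) = x + 1 then 1 else 0)"
proof (cases "x = pos a n")
  case True
  show ?thesis
    unfolding True by (simp add: rights_def used_Suc pos_Suc ones_Suc)
qed (simp add: rights_def used_Suc)

lemma lefts_mono: "m \<le> n \<Longrightarrow> lefts a m x \<le> lefts a n x"
  by (induction n rule: dec_induct) (auto simp: lefts_Suc)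

lemma pos_cases: "pos a (Suc n) = pos a n + 1 \<or> pos a (Suc n) = pos a n - 1"
  by (auto simp: pos_Suc)

lemma pos_le: "pos a n \<le> int n"
  by (induction n) (auto simp: pos_Suc)

text \<open>Crossings of the edge between \<open>x\<close> and \<open>x + 1\<close> alternate in
  direction, so their balance depends only on the sides of the edge on which the start
  \<open>0\<close> and the present position lie.\<close>

lemma rights_lefts_flow:
  "int (rights a n x) = int (lefts a n (x + 1)) + (if 0 \<le> x \<and> x < pos a n then 1 else 0)
     - (if pos a n \<le> x \<and> x < 0 then 1 else 0)"
proof (induction n)
  case (Suc n)
  then show ?case using pos_cases[of a n]
    by (auto simp: rights_Suc lefts_Suc split: if_splits)
qed simp

text \<open>Right steps minus left steps give the position and their sum gives the time; eliminating
  the right steps leaves the factor two.\<close>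

lemma time_eq_lefts:
  assumes "finite A" "\<And>k. k < n \<Longrightarrow> pos a k \<in> A"
  shows "int n = pos a n + 2 * (\<Sum>x\<in>A. int (lefts a n x))"
  using assms(2)
proof (induction n)
  case (Suc n)
  have "(\<Sum>x\<in>A. int (lefts a (Suc n) x)) =
    (\<Sum>x\<in>A. int (lefts a n x)) + (\<Sum>x\<in>A. if x = pos a n \<and> pos a (Suc n) = x - 1 then 1 else 0)"
    unfolding sum.distrib[symmetric] by (intro sum.cong) (auto simp: lefts_Suc)
  also have "(\<Sum>x\<in>A. if x = pos a n \<and> pos a (Suc n) = x - 1 then 1 else (0::int)) =
     (\<Sum>x\<in>A. if x = pos a n then (if pos a (Suc n) = pos a n - 1 then 1 else 0) else 0)"
    by (intro sum.cong) auto
  also have "\<dots> = (if pos a (Suc n) = pos a n - 1 then 1 else 0)"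
    using Suc.prems[of n] assms(1) by simp
  finally show ?case using Suc pos_cases[of a n] by auto
qed simp

text \<open>A visited site to the left of the walk was last left by a right arrow, so the used part
  of its stack ends exactly at a right arrow. A site not yet visited has both counts zero.\<close>

lemma lefts_at_left_of_pos:
  assumes "\<And>x. good (a x)"
  shows "y < pos a n \<Longrightarrow> lefts a n y = zeros_before (a y) (rights a n y)"
proof (induction n arbitrary: y)
  case (Suc n)
  show ?case
  proof (cases "y = pos a n")
    case True
    have *: "a y (used a n y)"
    proof (rule ccontr)
      assume "\<not> a y (used a n y)"
      with True have "pos a (Suc n) = y - 1" by (simp add: pos_Suc)
      with Suc.prems show False by simp
    qed
    have "rights a (Suc n) y = Suc (ones (a y) (used a n y))"
      using True * by (simp add: rights_def used_Suc ones_Suc)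
    moreover have "lefts a (Suc n) y = lefts a n y"
      using True Suc.prems pos_cases[of a n] by (auto simp: lefts_Suc)
    ultimately show ?thesis
      using zeros_before_at[OF assms *] by (simp add: lefts_def)
  next
    case False
    then have "y < pos a n" using Suc.prems pos_cases[of a n] by auto
    then show ?thesis using Suc.IH False by (simp add: lefts_Suc rights_Suc)
  qed
qed simp

lemma lefts_crossing:
  assumes "s \<le> t" "y \<le> pos a s" "pos a t < y"
  shows "lefts a s y < lefts a t y"
  using assms
proof (induction t rule: dec_induct)
  case (step t)
  show ?case
  proof (cases "pos a t < y")
    case True
    then show ?thesis using step by (simp add: lefts_Suc)
  next
    case False
    then have "pos a t = y" "pos a (Suc t) = y - 1" using step pos_cases[of a t] by auto
    then show ?thesis using lefts_mono[of s t a y] step by (simp add: lefts_Suc)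
  qed
qed simp

text \<open>\<open>D x\<close> turns out to be the number of left steps from \<open>x\<close> before the walk hits \<open>n\<close>: by then the
  edge from \<open>x\<close> to \<open>x + 1\<close> has been crossed to the right as often as to the left, and once more if \<open>0 \<le> x\<close>.\<close>

locale left_quota =
  fixes a :: "int \<Rightarrow> nat \<Rightarrow> bool" and n :: nat and D :: "int \<Rightarrow> nat" and x0 :: int
  assumes good: "\<And>x. good (a x)"
    and D_top: "D (int n) = 0"
    and D_rec: "\<And>x. x < int n \<Longrightarrow> D x = zeros_before (a x) (D (x + 1) + (if 0 \<le> x then 1 else 0))"
    and D_bot: "\<And>x. x \<le> x0 \<Longrightarrow> D x = 0" and x0: "x0 \<le> 0"
begin

text \<open>Induction on time. When the walk stands at \<open>x\<close>, its right steps from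
  \<open>x\<close> are bounded by its left steps from \<open>x + 1\<close>, hence by
  \<open>D (x + 1)\<close>, with one to spare if \<open>x < 0\<close>. A left arrow used now
  therefore precedes the right arrow that ends the quota of \<open>x\<close>.\<close>

lemma lefts_le_D:
  assumes "\<And>k. k < t \<Longrightarrow> pos a k < int n"
  shows "x \<le> int n \<Longrightarrow> lefts a t x \<le> D x"
  using assms
proof (induction t arbitrary: x)
  case (Suc t)
  show ?case
  proof (cases "x = pos a t \<and> pos a (Suc t) = x - 1")
    case True
    have lt: "x < int n" using True Suc.prems(2)[of t] by simp
    have na: "\<not> a x (used a t x)"
    proof
      assume "a x (used a t x)"
      with True have "pos a (Suc t) = x + 1" by (simp add: pos_Suc)
      with True show False by simp
    qed
    have "lefts a t (x + 1) \<le> D (x + 1)" using Suc.IH[of "x + 1"] Suc.prems lt by simp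
    moreover have "int (rights a t x) = int (lefts a t (x + 1)) - (if x < 0 then 1 else 0)"
      using rights_lefts_flow[of a t x] True by auto
    ultimately have "ones (a x) (used a t x) < D (x + 1) + (if 0 \<le> x then 1 else 0)"
      by (auto simp: rights_def split: if_splits)
    from zeros_before_less[OF good na this] have "lefts a t x < D x"
      using D_rec[OF lt] by (simp add: lefts_def)
    then show ?thesis using True by (simp add: lefts_Suc)
  next
    case False
    then have "lefts a (Suc t) x = lefts a t x" by (simp add: lefts_Suc)
    then show ?thesis using Suc by simp
  qed
qed simp

lemma pos_ge_x0:
  assumes "\<And>k. k < t \<Longrightarrow> pos a k < int n"
  shows "x0 \<le> pos a t"
proof (rule ccontr)
  assume "\<not> x0 \<le> pos a t"
  then have "lefts a 0 x0 < lefts a t x0" using x0 by (intro lefts_crossing) auto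
  moreover have "lefts a t x0 \<le> D x0" using assms x0 by (intro lefts_le_D) auto
  ultimately show False using D_bot[of x0] by simp
qed

lemma time_bound:
  assumes "\<And>k. k \<le> t \<Longrightarrow> pos a k < int n"
  shows "int t < int n + 2 * (\<Sum>x\<in>{x0..<int n}. int (D x))"
proof -
  have "int t = pos a t + 2 * (\<Sum>x\<in>{x0..<int n}. int (lefts a t x))"
    using assms pos_ge_x0 by (intro time_eq_lefts) (auto intro!: pos_ge_x0)
  also have "\<dots> < int n + 2 * (\<Sum>x\<in>{x0..<int n}. int (D x))"
    using assms by (intro add_less_le_mono mult_left_mono sum_mono) (auto intro!: lefts_le_D)
  finally show ?thesis .
qed

text \<open>While the walk stays below \<open>n\<close>, the quotas bound the elapsed time, so it
  cannot stay there forever.\<close>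

lemma hits: "\<exists>t. pos a t = int n"
proof -
  have "\<exists>t. pos a t \<ge> int n"
  proof (rule ccontr)
    assume *: "\<nexists>t. pos a t \<ge> int n"
    let ?B = "int n + 2 * (\<Sum>x\<in>{x0..<int n}. int (D x))"
    have "0 \<le> ?B" by (intro add_nonneg_nonneg mult_nonneg_nonneg sum_nonneg) auto
    then have "int (nat ?B) < ?B" using * by (intro time_bound) (auto simp: not_le)
    moreover have "int (nat ?B) = ?B" using \<open>0 \<le> ?B\<close> by (rule nat_0_le)
    ultimately show False by (metis less_irrefl)
  qed
  then have ex: "pos a (LEAST t. pos a t \<ge> int n) \<ge> int n" by (rule LeastI_ex)
  show ?thesis
  proof (cases "LEAST t. pos a t \<ge> int n")
    case 0
    then show ?thesis using ex by (intro exI[of _ 0]) simp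
  next
    case (Suc s)
    then have "pos a s < int n" by (metis lessI not_le not_less_Least)
    then show ?thesis using ex pos_cases[of a s] unfolding Suc by (intro exI[of _ "Suc s"]) auto
  qed
qed

definition "T = (LEAST t. pos a t = int n)"

lemma pos_T: "pos a T = int n"
  unfolding T_def using hits by (rule LeastI_ex)

lemma before_T: "k < T \<Longrightarrow> pos a k < int n"
proof -
  assume k: "k < T"
  have "pos a j < int n" if "j \<le> k" for j
    using that
  proof (induction j)
    case 0
    have "0 < T" using k by simp
    then have "pos a 0 \<noteq> int n" unfolding T_def by (rule not_less_Least)
    then show ?case by simp
  next
    case (Suc j)
    then show ?case
      using not_less_Least[of "Suc j" "\<lambda>t. pos a t = int n"] k pos_cases[of a j]
      by (auto simp: T_def)
  qed
  then show ?thesis by simp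
qed

text \<open>Downward induction from \<open>n\<close>: at the hitting time every \<open>x < n\<close>
  lies to the left of the walk, so its left steps are determined by its right steps, and these by
  the left steps from \<open>x + 1\<close>.\<close>

lemma lefts_T:
  assumes "x \<le> int n" shows "lefts a T x = D x"
  using assms
proof (induction x rule: int_le_induct)
  case base
  have "lefts a T (int n) \<le> D (int n)" by (intro lefts_le_D before_T) auto
  then show ?case using D_top by simp
next
  case (step x)
  have "int (rights a T (x - 1)) = int (D x) + (if 0 \<le> x - 1 then 1 else 0)"
    using rights_lefts_flow[of a T "x - 1"] step pos_T by auto
  then have "rights a T (x - 1) = D x + (if 0 \<le> x - 1 then 1 else 0)"
    by (auto split: if_splits)
  moreover have "lefts a T (x - 1) = zeros_before (a (x - 1)) (rights a T (x - 1))"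
    using step pos_T good by (intro lefts_at_left_of_pos) auto
  ultimately show ?case using D_rec[of "x - 1"] step by simp
qed

lemma T_eq: "int T = int n + 2 * (\<Sum>x\<in>{x0..<int n}. int (D x))"
proof -
  have "int T = pos a T + 2 * (\<Sum>x\<in>{x0..<int n}. int (lefts a T x))"
    using before_T pos_ge_x0 by (intro time_eq_lefts) (auto intro!: pos_ge_x0)
  then show ?thesis using pos_T by (simp add: lefts_T)
qed

end

section \<open>Products of copies of a probability space\<close>

lemma measurable_PiM_coord:
  "(\<lambda>w. w i) \<in> measurable (PiM UNIV (\<lambda>_. M)) M"
  by (rule measurable_component_singleton) simp

lemma measurable_into_PiM:
  assumes "space M = UNIV" "\<And>i. (\<lambda>x. f x i) \<in> measurable N M"
  shows "f \<in> measurable N (PiM UNIV (\<lambda>_. M))"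
proof (rule measurable_PiM_single'[where f = "\<lambda>i x. f x i"])
  show "(\<lambda>x. f x i) \<in> measurable N M" for i by fact
  show "f \<in> space N \<rightarrow> (\<Pi>\<^sub>E i\<in>UNIV. space M)"
    unfolding assms(1) by blast
qed

context
  fixes M :: "'b measure"
  assumes prob: "prob_space M" and space: "space M = UNIV"
begin

lemma space_PiM_UNIV: "space (PiM UNIV (\<lambda>_::'i. M)) = UNIV"
  using space by (simp add: space_PiM PiE_UNIV_domain)

lemma prob_space_PiM_UNIV: "prob_space (PiM UNIV (\<lambda>_::'i. M))"
  using prob by (intro prob_space_PiM)

text \<open>This takes the place of conditional expectation: each Markov, supermartingale or
  change-of-measure step below redraws one coordinate that the rest of the integrand
  ignores.\<close>

lemma nn_integral_PiM_resample:
  fixes f :: "('i \<Rightarrow> 'b) \<Rightarrow> ennreal" and i :: 'i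
  assumes [measurable]: "f \<in> borel_measurable (PiM UNIV (\<lambda>_. M))"
  shows "(\<integral>\<^sup>+w. f w \<partial>PiM UNIV (\<lambda>_. M)) = (\<integral>\<^sup>+w. \<integral>\<^sup>+s. f (w(i := s)) \<partial>M \<partial>PiM UNIV (\<lambda>_. M))"
proof -
  let ?P = "PiM UNIV (\<lambda>_::'i. M)"
  interpret M: prob_space M by (rule prob)
  interpret P: prob_space ?P by (rule prob_space_PiM_UNIV)
  interpret pair_sigma_finite M ?P ..
  have [measurable]: "(\<lambda>(x, X). X(i := x)) \<in> measurable (M \<Otimes>\<^sub>M ?P) ?P"
    by (rule measurable_into_PiM[OF space]) (auto simp: split_beta' fun_upd_def)
  have "(\<integral>\<^sup>+w. f w \<partial>?P) = (\<integral>\<^sup>+w. f w \<partial>distr (M \<Otimes>\<^sub>M ?P) ?P (\<lambda>(x, X). X(i := x)))"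
    using distr_pair_PiM_eq_PiM[of UNIV "\<lambda>_. M" i] prob by simp
  also have "\<dots> = (\<integral>\<^sup>+z. f ((snd z)(i := fst z)) \<partial>(M \<Otimes>\<^sub>M ?P))"
    using \<open>(\<lambda>(x, X). X(i := x)) \<in> _\<close> assms by (subst nn_integral_distr) (simp_all add: split_beta')
  also have "\<dots> = (\<integral>\<^sup>+w. \<integral>\<^sup>+s. f (w(i := s)) \<partial>M \<partial>?P)"
  proof -
    have [measurable]: "(\<lambda>z. f ((snd z)(i := fst z))) \<in> borel_measurable (M \<Otimes>\<^sub>M ?P)"
      using measurable_compose[OF \<open>(\<lambda>(x, X). X(i := x)) \<in> _\<close> assms] by (simp add: split_beta')
    show ?thesis
      by (subst nn_integral_snd[symmetric]) auto
  qed
  finally show ?thesis .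
qed

lemma distr_PiM_UNIV_reindex:
  fixes f :: "'i \<Rightarrow> 'k"
  assumes "inj f"
  shows "distr (PiM UNIV (\<lambda>_. M)) (PiM UNIV (\<lambda>_. M)) (\<lambda>w n. w (f n)) = PiM UNIV (\<lambda>_. M)"
  using distr_PiM_reindex[of UNIV "\<lambda>_::'k. M" f UNIV] assms prob by (simp add: restrict_UNIV)

lemma measurable_PiM_reindex:
  "(\<lambda>w n. w (f n)) \<in> measurable (PiM UNIV (\<lambda>_. M)) (PiM UNIV (\<lambda>_. M))"
  by (rule measurable_into_PiM[OF space]) simp

lemma indep_vars_PiM_coords:
  "prob_space.indep_vars (PiM UNIV (\<lambda>_::'i. M)) (\<lambda>_. M) (\<lambda>i w. w i) UNIV"
proof -
  interpret P: prob_space "PiM UNIV (\<lambda>_::'i. M)" by (rule prob_space_PiM_UNIV)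
  have id: "distr (PiM UNIV (\<lambda>_::'i. M)) M (\<lambda>w. w i) = M" for i
    using distr_PiM_component[of UNIV "\<lambda>_. M" i] prob by simp
  show ?thesis
    by (subst P.indep_vars_iff_distr_eq_PiM') (auto simp: id restrict_UNIV distr_id2)
qed

lemma indep_vars_PiM_blocks:
  fixes f :: "'j \<Rightarrow> ('i \<Rightarrow> 'b) \<Rightarrow> real"
  assumes disj: "disjoint_family_on K L"
    and f: "\<And>j. j \<in> L \<Longrightarrow> f j \<in> borel_measurable (PiM UNIV (\<lambda>_. M))"
    and dep: "\<And>j w w'. j \<in> L \<Longrightarrow> (\<And>i. i \<in> K j \<Longrightarrow> w i = w' i) \<Longrightarrow> f j w = f j w'"
  shows "prob_space.indep_vars (PiM UNIV (\<lambda>_. M)) (\<lambda>_. borel) f L"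
proof -
  let ?P = "PiM UNIV (\<lambda>_::'i. M)"
  interpret P: prob_space ?P by (rule prob_space_PiM_UNIV)
  \<comment> \<open>A function of the coordinates in \<open>K j\<close> factors through the
    restriction to \<open>K j\<close>; filling the remaining coordinates with a fixed value provides
    the factor map.\<close>
  define ext where "ext j v = (\<lambda>i. if i \<in> K j then v i else undefined)" for j and v :: "'i \<Rightarrow> 'b"
  have ext: "ext j \<in> measurable (PiM (K j) (\<lambda>_. M)) ?P" for j
  proof (rule measurable_into_PiM[OF space])
    show "(\<lambda>x. ext j x i) \<in> measurable (PiM (K j) (\<lambda>_. M)) M" for i
      using space by (cases "i \<in> K j") (simp_all add: ext_def measurable_component_singleton)
  qed
  have "P.indep_vars (\<lambda>j. PiM (K j) (\<lambda>_. M)) (\<lambda>j w. restrict (\<lambda>i. w i) (K j)) L"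
    using disj by (intro P.indep_vars_restrict[OF indep_vars_PiM_coords]) auto
  then have "P.indep_vars (\<lambda>_. borel) (\<lambda>j w. (f j \<circ> ext j) (restrict (\<lambda>i. w i) (K j))) L"
    by (rule P.indep_vars_compose2) (intro measurable_comp[OF ext] f)
  also have "?this \<longleftrightarrow> ?thesis"
    by (intro P.indep_vars_cong refl ext) (auto simp: ext_def fun_eq_iff intro!: dep)
  finally show ?thesis .
qed

text \<open>The stacks live in a product over sites whose factor is itself a product of uniforms,
  whereas the given walk lives on one flat product; the coupling passes between the two through this
  identity.\<close>

lemma distr_PiM_flatten:
  "distr (PiM UNIV (\<lambda>_::'x. PiM UNIV (\<lambda>_::'i. M))) (PiM UNIV (\<lambda>_. M)) (\<lambda>w (x, i). w x i) = PiM UNIV (\<lambda>_. M)"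
proof (rule measure_eqI_PiM_infinite)
  let ?Q = "PiM UNIV (\<lambda>_::'i. M)" and ?R = "PiM UNIV (\<lambda>_::'x \<times> 'i. M)"
  let ?P = "PiM UNIV (\<lambda>_::'x. ?Q)" and ?t = "\<lambda>w (x, i). w x i"
  interpret M: prob_space M by (rule prob)
  interpret Q: prob_space ?Q by (rule prob_space_PiM_UNIV)
  interpret P: prob_space ?P by (intro prob_space_PiM) unfold_locales
  interpret QQ: product_prob_space "\<lambda>_. M" "UNIV :: 'i set" ..
  interpret PP: product_prob_space "\<lambda>_. ?Q" "UNIV :: 'x set" ..
  have t: "?t \<in> measurable ?P ?R"
    by (intro measurable_into_PiM space)
       (simp add: split_beta' measurable_compose[OF measurable_PiM_coord measurable_PiM_coord])
  show "finite_measure (distr ?P ?R ?t)"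
    using t by (intro prob_space.finite_measure P.prob_space_distr)
  fix A :: "'x \<times> 'i \<Rightarrow> 'b set" and J :: "('x \<times> 'i) set"
  assume J: "finite J" and A: "\<And>i. i \<in> J \<Longrightarrow> A i \<in> sets M"
  let ?E = "prod_emb UNIV (\<lambda>_. M) J (Pi\<^sub>E J A)"
  let ?B = "\<lambda>x. {s \<in> space ?Q. \<forall>i\<in>J `` {x}. s i \<in> A (x, i)}"
  have fin: "finite (J `` {x})" for x using J by (rule finite_Image)
  have "emeasure (distr ?P ?R ?t) ?E = emeasure ?P (?t -` ?E \<inter> space ?P)"
    using J A t by (intro emeasure_distr sets_PiM_I) auto
  also have "?t -` ?E \<inter> space ?P = {w \<in> space ?P. \<forall>x\<in>fst ` J. w x \<in> ?B x}"
    by (force simp: prod_emb_def space_PiM space PiE_iff extensional_def)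
  also have "emeasure ?P \<dots> = (\<Prod>x\<in>fst ` J. emeasure ?Q (?B x))"
    using J A fin by (intro PP.emeasure_PiM_Collect) (auto intro!: sets.sets_Collect_finite_All')
  also have "\<dots> = (\<Prod>x\<in>fst ` J. \<Prod>i\<in>J `` {x}. emeasure M (A (x, i)))"
    using J A fin by (intro prod.cong refl QQ.emeasure_PiM_Collect) auto
  also have "\<dots> = (\<Prod>j\<in>Sigma (fst ` J) (\<lambda>x. J `` {x}). emeasure M (A j))"
    using J fin by (subst prod.Sigma) auto
  also have "Sigma (fst ` J) (\<lambda>x. J `` {x}) = J" by force
  also have "(\<Prod>j\<in>J. emeasure M (A j)) = emeasure ?R ?E"
    using J A prob by (intro emeasure_PiM_emb[symmetric]) auto
  finally show "emeasure (distr ?P ?R ?t) ?E = emeasure ?R ?E" .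
qed auto

end

text \<open>A first-moment form of Borel-Cantelli: the sum has finite integral, so it is almost
  surely finite and its terms vanish.\<close>

lemma AE_tendsto_0_of_summable_nn_integral:
  fixes f :: "nat \<Rightarrow> 'a \<Rightarrow> ennreal"
  assumes [measurable]: "\<And>n. f n \<in> borel_measurable M"
    and "(\<Sum>n. \<integral>\<^sup>+x. f n x \<partial>M) < \<infinity>"
  shows "AE x in M. (\<lambda>n. f n x) \<longlonglongrightarrow> 0"
proof -
  have "(\<integral>\<^sup>+x. (\<Sum>n. f n x) \<partial>M) \<noteq> \<infinity>"
    using assms by (subst nn_integral_suminf) auto
  then have "AE x in M. (\<Sum>n. f n x) \<noteq> \<infinity>"
    by (intro nn_integral_PInf_AE) auto
  then show "AE x in M. (\<lambda>n. f n x) \<longlonglongrightarrow> 0"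
  proof eventually_elim
    case (elim x)
    have fin: "f n x < top" for n
      using elim sum_le_suminf[OF summableI, of "{n}" "\<lambda>n. f n x"] by (auto simp: less_top[symmetric] top_unique)
    have "summable (\<lambda>n. enn2real (f n x))"
      using elim fin by (intro summable_suminf_not_top) auto
    then have "(\<lambda>n. ennreal (enn2real (f n x))) \<longlonglongrightarrow> ennreal 0"
      by (intro tendsto_ennrealI summable_LIMSEQ_zero)
    then show ?case using fin by simp
  qed
qed

section \<open>Square integrable functions\<close>

definition sq_int :: "'a measure \<Rightarrow> ('a \<Rightarrow> real) \<Rightarrow> bool" where
  "sq_int M f \<longleftrightarrow> f \<in> borel_measurable M \<and> integrable M (\<lambda>x. (f x)\<^sup>2)"

definition L2n :: "'a measure \<Rightarrow> ('a \<Rightarrow> real) \<Rightarrow> real" where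
  "L2n M f = sqrt (\<integral>x. (f x)\<^sup>2 \<partial>M)"

lemma sq_int_measurable [measurable_dest]: "sq_int M f \<Longrightarrow> f \<in> borel_measurable M"
  by (simp add: sq_int_def)

lemma sq_int_mult_integrable:
  assumes "sq_int M f" "sq_int M g" shows "integrable M (\<lambda>x. f x * g x)"
proof (rule Bochner_Integration.integrable_bound)
  show "integrable M (\<lambda>x. (f x)\<^sup>2 + (g x)\<^sup>2)" using assms by (auto simp: sq_int_def)
  show "(\<lambda>x. f x * g x) \<in> borel_measurable M" using assms by (auto simp: sq_int_def)
  have "\<bar>a * b\<bar> \<le> a\<^sup>2 + b\<^sup>2" for a b :: real
  proof -
    have "\<bar>a * b\<bar> \<le> 2 * \<bar>a\<bar> * \<bar>b\<bar>" by (simp add: abs_mult)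
    also have "\<dots> \<le> a\<^sup>2 + b\<^sup>2" using sum_squares_bound[of "\<bar>a\<bar>" "\<bar>b\<bar>"] by simp
    finally show ?thesis .
  qed
  then show "AE x in M. norm (f x * g x) \<le> norm ((f x)\<^sup>2 + (g x)\<^sup>2)" by auto
qed

lemma sq_int_add: assumes "sq_int M f" "sq_int M g" shows "sq_int M (\<lambda>x. f x + g x)"
  using assms sq_int_mult_integrable[OF assms]
  by (auto simp: sq_int_def power2_sum mult.assoc)

lemma sq_int_cmult: "sq_int M f \<Longrightarrow> sq_int M (\<lambda>x. c * f x)"
  by (auto simp: sq_int_def power_mult_distrib)

lemma sq_int_diff: "sq_int M f \<Longrightarrow> sq_int M g \<Longrightarrow> sq_int M (\<lambda>x. f x - g x)"
  using sq_int_add[of M f "\<lambda>x. (-1) * g x"] sq_int_cmult[of M g "-1"] by simp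

lemma sq_int_0: "sq_int M (\<lambda>_. 0)"
  by (simp add: sq_int_def)

lemma sq_int_sum: "finite I \<Longrightarrow> (\<And>i. i \<in> I \<Longrightarrow> sq_int M (f i)) \<Longrightarrow> sq_int M (\<lambda>x. \<Sum>i\<in>I. f i x)"
  by (induction I rule: finite_induct) (auto simp: sq_int_0 intro: sq_int_add)

lemma L2n_nonneg: "0 \<le> L2n M f"
  by (simp add: L2n_def)

lemma L2n_sq: "(L2n M f)\<^sup>2 = (\<integral>x. (f x)\<^sup>2 \<partial>M)"
  by (simp add: L2n_def)

lemma L2n_cmult: "L2n M (\<lambda>x. c * f x) = \<bar>c\<bar> * L2n M f"
  by (simp add: L2n_def power_mult_distrib real_sqrt_mult)

lemma L2n_mult_le:
  assumes "sq_int M f" "sq_int M g" shows "\<bar>\<integral>x. f x * g x \<partial>M\<bar> \<le> L2n M f * L2n M g"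
proof -
  have [measurable]: "f \<in> borel_measurable M" "g \<in> borel_measurable M"
    using assms by (auto simp: sq_int_def)
  have nn: "(\<integral>\<^sup>+x. ennreal \<bar>h x\<bar> ^ 2 \<partial>M) = ennreal ((L2n M h)\<^sup>2)" if "sq_int M h" for h
    unfolding L2n_sq using that by (subst nn_integral_eq_integral[symmetric]) (auto simp: sq_int_def ennreal_power)
  have "ennreal (\<integral>x. \<bar>f x * g x\<bar> \<partial>M) = (\<integral>\<^sup>+x. ennreal \<bar>f x * g x\<bar> \<partial>M)"
    using sq_int_mult_integrable[OF assms] by (subst nn_integral_eq_integral) auto
  then have "ennreal ((\<integral>x. \<bar>f x * g x\<bar> \<partial>M)\<^sup>2) = (\<integral>\<^sup>+x. ennreal \<bar>f x\<bar> * ennreal \<bar>g x\<bar> \<partial>M)\<^sup>2"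
    by (simp add: ennreal_power[symmetric] abs_mult ennreal_mult)
  also have "\<dots> \<le> ennreal ((L2n M f)\<^sup>2) * ennreal ((L2n M g)\<^sup>2)"
    using Cauchy_Schwarz_nn_integral[of "\<lambda>x. ennreal \<bar>f x\<bar>" M "\<lambda>x. ennreal \<bar>g x\<bar>"] assms by (simp add: nn)
  also have "\<dots> = ennreal ((L2n M f * L2n M g)\<^sup>2)" by (simp add: ennreal_mult power_mult_distrib)
  finally have "(\<integral>x. \<bar>f x * g x\<bar> \<partial>M)\<^sup>2 \<le> (L2n M f * L2n M g)\<^sup>2" by (simp add: ennreal_le_iff)
  then have "(\<integral>x. \<bar>f x * g x\<bar> \<partial>M) \<le> L2n M f * L2n M g"
    by (rule power2_le_imp_le) (simp add: L2n_nonneg)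
  then show ?thesis using integral_abs_bound[of M "\<lambda>x. f x * g x"] by linarith
qed

lemma L2n_add_le:
  assumes "sq_int M f" "sq_int M g" shows "L2n M (\<lambda>x. f x + g x) \<le> L2n M f + L2n M g"
proof (rule power2_le_imp_le)
  have "(L2n M (\<lambda>x. f x + g x))\<^sup>2 = (\<integral>x. (f x)\<^sup>2 + (g x)\<^sup>2 + 2 * (f x * g x) \<partial>M)"
    by (simp add: L2n_sq power2_sum mult.assoc)
  also have "\<dots> = (\<integral>x. (f x)\<^sup>2 \<partial>M) + (\<integral>x. (g x)\<^sup>2 \<partial>M) + 2 * (\<integral>x. f x * g x \<partial>M)"
    using assms sq_int_mult_integrable[OF assms] by (simp add: sq_int_def)
  also have "\<dots> \<le> (L2n M f + L2n M g)\<^sup>2"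
    using L2n_mult_le[OF assms] by (simp add: L2n_sq power2_sum)
  finally show "(L2n M (\<lambda>x. f x + g x))\<^sup>2 \<le> (L2n M f + L2n M g)\<^sup>2" .
qed (auto intro!: add_nonneg_nonneg L2n_nonneg)

lemma L2n_minus_commute: "L2n M (\<lambda>x. f x - g x) = L2n M (\<lambda>x. g x - f x)"
  by (simp add: L2n_def power2_commute)

lemma L2n_diff_abs_le:
  assumes "sq_int M f" "sq_int M g" shows "\<bar>L2n M f - L2n M g\<bar> \<le> L2n M (\<lambda>x. f x - g x)"
  using L2n_add_le[OF sq_int_diff[OF assms] assms(2)]
    L2n_add_le[OF sq_int_diff[OF assms(2,1)] assms(1)] L2n_minus_commute[of M f g] by simp

context prob_space
begin

lemma sq_int_const: "sq_int M (\<lambda>_. c)"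
  by (simp add: sq_int_def)

lemma sq_int_integrable: "sq_int M f \<Longrightarrow> integrable M f"
  using sq_int_mult_integrable[of M f "\<lambda>_. 1"] sq_int_const[of 1] by simp

lemma sq_int_bounded: "f \<in> borel_measurable M \<Longrightarrow> (\<And>x. \<bar>f x\<bar> \<le> B) \<Longrightarrow> sq_int M f"
  unfolding sq_int_def
  by (auto intro!: integrable_const_bound[where B = "B\<^sup>2"] AE_I2 simp: abs_le_square_iff[symmetric])
     (meson abs_ge_self order_trans)

lemma expectation_abs_le_L2n: assumes "sq_int M f" shows "expectation (\<lambda>x. \<bar>f x\<bar>) \<le> L2n M f"
proof -
  have "sq_int M (\<lambda>x. \<bar>f x\<bar>)" using assms by (auto simp: sq_int_def)
  from L2n_mult_le[OF this sq_int_const[of 1]] show ?thesis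
    by (simp add: L2n_def prob_space)
qed

lemma covariance_centered:
  assumes "sq_int M f" "sq_int M g"
  shows "expectation (\<lambda>x. (f x - expectation f) * (g x - expectation g))
    = expectation (\<lambda>x. f x * g x) - expectation f * expectation g"
proof -
  note [simp] = sq_int_mult_integrable[OF assms] sq_int_integrable[OF assms(1)] sq_int_integrable[OF assms(2)]
  have "expectation (\<lambda>x. (f x - expectation f) * (g x - expectation g))
    = expectation (\<lambda>x. f x * g x - expectation f * g x - expectation g * f x + expectation f * expectation g)"
    by (intro Bochner_Integration.integral_cong) (auto simp: algebra_simps)
  also have "\<dots> = expectation (\<lambda>x. f x * g x) - expectation f * expectation g"
    by (simp add: prob_space)
  finally show ?thesis .
qed

lemma L2n_centered_sum_sq:
  assumes "finite I" "\<And>i. i \<in> I \<Longrightarrow> sq_int M (f i)"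
  shows "(L2n M (\<lambda>x. (\<Sum>i\<in>I. f i x) - expectation (\<lambda>x. \<Sum>i\<in>I. f i x)))\<^sup>2
    = (\<Sum>i\<in>I. \<Sum>j\<in>I. expectation (\<lambda>x. f i x * f j x) - expectation (f i) * expectation (f j))"
proof -
  have c: "sq_int M (\<lambda>x. f i x - expectation (f i))" if "i \<in> I" for i
    using assms that by (intro sq_int_diff sq_int_const) auto
  have "(\<Sum>i\<in>I. f i x) - expectation (\<lambda>x. \<Sum>i\<in>I. f i x) = (\<Sum>i\<in>I. f i x - expectation (f i))" for x
    using assms by (subst Bochner_Integration.integral_sum) (auto simp: sum_subtractf sq_int_integrable)
  then have "(L2n M (\<lambda>x. (\<Sum>i\<in>I. f i x) - expectation (\<lambda>x. \<Sum>i\<in>I. f i x)))\<^sup>2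
     = expectation (\<lambda>x. \<Sum>i\<in>I. \<Sum>j\<in>I. (f i x - expectation (f i)) * (f j x - expectation (f j)))"
    unfolding L2n_sq by (simp add: power2_eq_square sum_product)
  also have "\<dots> = (\<Sum>i\<in>I. \<Sum>j\<in>I. expectation (\<lambda>x. (f i x - expectation (f i)) * (f j x - expectation (f j))))"
    using c by (simp add: Bochner_Integration.integral_sum sq_int_mult_integrable)
  also have "\<dots> = (\<Sum>i\<in>I. \<Sum>j\<in>I. expectation (\<lambda>x. f i x * f j x) - expectation (f i) * expectation (f j))"
    using assms by (intro sum.cong refl covariance_centered) auto
  finally show ?thesis .
qed

end

section \<open>Independent stacks of arrows\<close>

text \<open>Everything that the limit theory uses about a single stack; the cookie chain returns
  only when these conditions are verified. \<open>\<phi> b\<close> is the density of the image of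
  \<open>Q\<close> under \<open>flip b\<close>, and its bound \<open>B\<close> is what keeps the
  limit variance positive.\<close>

locale stack_law = Q: prob_space Q for Q :: "'s measure" +
  fixes arr :: "'s \<Rightarrow> nat \<Rightarrow> bool" and \<rho> C B :: real
    and flip :: "bool \<Rightarrow> 's \<Rightarrow> 's" and \<phi> :: "bool \<Rightarrow> 's \<Rightarrow> real"
  assumes space_Q: "space Q = UNIV"
    and arr_measurable [measurable]: "\<And>j. Measurable.pred Q (\<lambda>s. arr s j)"
    and good_arr: "AE s in Q. good (arr s)"
    and \<rho>: "0 < \<rho>" "\<rho> < 1" and C: "0 \<le> C"
    and moment: "\<And>k. (\<integral>\<^sup>+s. ennreal ((real (zeros_before (arr s) (Suc k)))\<^sup>2) \<partial>Q) \<le> ennreal (\<rho> * (real k)\<^sup>2 + C)"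
    and zero_pos: "\<And>k. 0 < measure Q {s. zeros_before (arr s) k = 0}"
    and arr_flip: "\<And>b s. arr (flip b s) = case_nat b (\<lambda>j. arr s (Suc j))"
    and flip_measurable [measurable]: "\<And>b. flip b \<in> measurable Q Q"
    and \<phi>_measurable [measurable]: "\<And>b. \<phi> b \<in> borel_measurable Q"
    and \<phi>_bounds: "\<And>b s. 0 \<le> \<phi> b s" "\<And>b s. \<phi> b s \<le> B"
    and flip_density: "\<And>b g. g \<in> borel_measurable Q \<Longrightarrow>
      (\<integral>\<^sup>+s. g (flip b s) \<partial>Q) = (\<integral>\<^sup>+s. ennreal (\<phi> b s) * g s \<partial>Q)"
begin

abbreviation F :: "'s \<Rightarrow> nat \<Rightarrow> nat" where "F s \<equiv> zeros_before (arr s)"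

definition P :: "(int \<Rightarrow> 's) measure" where "P = PiM UNIV (\<lambda>_. Q)"

sublocale P: prob_space P
  unfolding P_def by (rule prob_space_PiM_UNIV[OF Q.prob_space_axioms space_Q])

lemma space_P: "space P = UNIV"
  unfolding P_def by (rule space_PiM_UNIV[OF Q.prob_space_axioms space_Q])

lemma coord_measurable: "(\<lambda>w. w i) \<in> measurable P Q"
  unfolding P_def by (rule measurable_PiM_coord)

lemma ones_measurable [measurable]: "(\<lambda>s. ones (arr s) n) \<in> measurable Q (count_space UNIV)"
  by (induction n) (simp_all add: ones_Suc)

lemma F_measurable [measurable]: "(\<lambda>s. F s k) \<in> measurable Q (count_space UNIV)"
  unfolding zeros_before_def good_def by measurable

lemma F_comp_measurable:
  assumes "g \<in> measurable P (count_space UNIV)"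
  shows "(\<lambda>w. F (w i) (g w)) \<in> measurable P (count_space UNIV)"
  using measurable_compose[OF coord_measurable F_measurable]
  by (intro measurable_compose_countable[OF _ assms, of "\<lambda>k w. F (w i) k"])

text \<open>\<open>dn w m j\<close> counts the left steps from site \<open>m - j\<close> before level \<open>m\<close> is hit, and \<open>kc w m z\<close> is the
  same chain started at \<open>z\<close> and killed at zero.\<close>

primrec dn :: "(int \<Rightarrow> 's) \<Rightarrow> int \<Rightarrow> nat \<Rightarrow> nat" where
  "dn w m 0 = 0"
| "dn w m (Suc j) = F (w (m - 1 - int j)) (Suc (dn w m j))"

primrec kc :: "(int \<Rightarrow> 's) \<Rightarrow> int \<Rightarrow> nat \<Rightarrow> nat \<Rightarrow> nat" where
  "kc w m z 0 = z"
| "kc w m z (Suc j) = (if kc w m z j = 0 then 0 else F (w (m - 1 - int j)) (Suc (kc w m z j)))"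

lemma dn_shift: "dn (\<lambda>i. w (i + a)) m j = dn w (m + a) j"
  by (induction j) (auto simp: algebra_simps)

lemma dn_cong: "(\<And>i. m - int j \<le> i \<Longrightarrow> i < m \<Longrightarrow> w i = w' i) \<Longrightarrow> dn w m j = dn w' m j"
  by (induction j) auto

lemma kc_cong: "(\<And>i. m - int j \<le> i \<Longrightarrow> i < m \<Longrightarrow> w i = w' i) \<Longrightarrow> kc w m z j = kc w' m z j"
  by (induction j) auto

lemma dn_measurable [measurable]: "(\<lambda>w. dn w m j) \<in> measurable P (count_space UNIV)"
proof (induction j)
  case (Suc j)
  then have "(\<lambda>w. Suc (dn w m j)) \<in> measurable P (count_space UNIV)" by simp
  then show ?case by (simp add: F_comp_measurable)
qed simp

lemma kc_measurable:
  assumes g [measurable]: "g \<in> measurable P (count_space UNIV)"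
  shows "(\<lambda>w. kc w m (g w) j) \<in> measurable P (count_space UNIV)"
proof (induction j)
  case (Suc j)
  note [measurable] = Suc
  have [measurable]: "(\<lambda>w. F (w (m - 1 - int j)) (Suc (kc w m (g w) j))) \<in> measurable P (count_space UNIV)"
    by (rule F_comp_measurable) simp
  show ?case by simp
qed (use g in simp)

text \<open>When the chain read from the higher level reaches \<open>m\<close> its value is at least
  zero, where the other one starts. Below \<open>m\<close> both use the same stacks, and
  monotonicity preserves the order.\<close>

lemma dn_le_dn: "dn w m j \<le> dn w (m + int i) (i + j)"
proof (induction j)
  case (Suc j)
  then show ?case by (auto simp: algebra_simps intro!: zeros_before_mono)
qed simp

text \<open>Two chains started at different levels coalesce as soon as the larger one vanishes.\<close>

lemma dn_le_dn_plus_kc: "dn w (m + int i) (i + j) \<le> dn w m j + kc w m (dn w (m + int i) i) j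
   \<and> (kc w m (dn w (m + int i) i) j = 0 \<longrightarrow> dn w (m + int i) (i + j) = dn w m j)
   \<and> (kc w m (dn w (m + int i) i) j \<noteq> 0 \<longrightarrow> dn w (m + int i) (i + j) = kc w m (dn w (m + int i) i) j)"
proof (induction j)
  case (Suc j)
  have *: "m + int i - 1 - int (i + j) = m - 1 - int j" by simp
  show ?case using Suc dn_le_dn[of w m "Suc j" i] by (auto simp: * simp del: of_nat_add)
qed auto

text \<open>The constant \<open>A\<close> is chosen so that \<open>z\<^sup>2 + A\<close> contracts under the chain killed at zero: for
  large \<open>z\<close> by the quadratic drift, for small \<open>z\<close> because of the chance of being killed.\<close>

lemma killed_contraction_ex:
  "\<exists>A r. 0 \<le> A \<and> 0 < r \<and> r < 1 \<and> (\<forall>z>0. (\<integral>\<^sup>+s. ennreal (if F s (Suc z) = 0 then 0 else (real (F s (Suc z)))\<^sup>2 + A) \<partial>Q)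
     \<le> ennreal (r * ((real z)\<^sup>2 + A)))"
proof -
  obtain z0 :: nat where z0: "2 * (C + 1) / (1 - \<rho>) < real z0" using reals_Archimedean2 by blast
  define \<epsilon> where "\<epsilon> = measure Q {s. F s (Suc z0) = 0}"
  have \<epsilon>: "0 < \<epsilon>" "\<epsilon> \<le> 1" using zero_pos by (auto simp: \<epsilon>_def)
  define A where "A = 2 * C / \<epsilon>"
  \<comment> \<open>The first term is used for small \<open>z\<close>. For large \<open>z\<close>
    the second keeps at least half of the drift surplus \<open>1 - \<rho>\<close>, and the third
    gives \<open>A * (1 - r) \<le> 1\<close>, which is the summand 1 in the choice of
    \<open>z0\<close>.\<close>
  define r where "r = max (1 - \<epsilon> / 2) (max ((1 + \<rho>) / 2) (1 - 1 / (A + 1)))"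
  have A: "0 \<le> A" using C \<epsilon> by (simp add: A_def)
  have r: "0 < r" "r < 1" "\<rho> \<le> r" "1 - \<epsilon> / 2 \<le> r" "(1 + \<rho>) / 2 \<le> r" "1 - 1 / (A + 1) \<le> r"
    using \<rho> \<epsilon> A by (auto simp: r_def less_max_iff_disj le_max_iff_disj)
  have Ar: "A * (1 - r) \<le> 1"
  proof -
    have "A * (1 - r) \<le> A * (1 / (A + 1))" using r A by (intro mult_left_mono) auto
    also have "\<dots> \<le> 1" using A by simp
    finally show ?thesis .
  qed
  have "(\<integral>\<^sup>+s. ennreal (if F s (Suc z) = 0 then 0 else (real (F s (Suc z)))\<^sup>2 + A) \<partial>Q)
     \<le> ennreal (r * ((real z)\<^sup>2 + A))" for z
  proof -
    let ?E = "{s. F s (Suc z) \<noteq> 0}"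
    have "{s \<in> space Q. F s (Suc z) \<noteq> 0} \<in> sets Q" by measurable
    then have E [measurable]: "?E \<in> sets Q" by (simp add: space_Q)
    have "(\<integral>\<^sup>+s. ennreal (if F s (Suc z) = 0 then 0 else (real (F s (Suc z)))\<^sup>2 + A) \<partial>Q)
      = (\<integral>\<^sup>+s. ennreal ((real (F s (Suc z)))\<^sup>2) + ennreal A * indicator ?E s \<partial>Q)"
      using A by (intro nn_integral_cong) (auto simp: indicator_def simp flip: ennreal_plus)
    also have "\<dots> = (\<integral>\<^sup>+s. ennreal ((real (F s (Suc z)))\<^sup>2) \<partial>Q) + ennreal A * emeasure Q ?E"
      by (subst nn_integral_add) (simp_all only: nn_integral_cmult_indicator[OF E], measurable)
    also have "\<dots> \<le> ennreal (\<rho> * (real z)\<^sup>2 + C) + ennreal A * ennreal (measure Q ?E)"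
      using moment[of z] by (intro add_mono) (auto simp: Q.emeasure_eq_measure)
    also have "\<dots> = ennreal (\<rho> * (real z)\<^sup>2 + C + A * measure Q ?E)"
      using A \<rho> C by (simp add: ennreal_mult)
    also have "\<dots> \<le> ennreal (r * ((real z)\<^sup>2 + A))"
    proof (rule ennreal_leI, cases "z0 \<le> z")
      case True
      have "C + 1 \<le> (1 - \<rho>) / 2 * real z0"
        using z0 \<rho> by (simp add: field_simps)
      also have "\<dots> \<le> (1 - \<rho>) / 2 * (real z)\<^sup>2"
      proof (intro mult_left_mono)
        have "real z0 \<le> real z" using True by simp
        also have "\<dots> \<le> (real z)\<^sup>2" by (cases z) (auto simp: power2_eq_square)
        finally show "real z0 \<le> (real z)\<^sup>2" .
      qed (use \<rho> in auto)
      also have "\<dots> \<le> (r - \<rho>) * (real z)\<^sup>2" using r by (intro mult_right_mono) auto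
      finally have 1: "C + 1 \<le> (r - \<rho>) * (real z)\<^sup>2" .
      have "A * measure Q ?E \<le> A * 1" using A by (intro mult_left_mono) auto
      with 1 Ar show "\<rho> * (real z)\<^sup>2 + C + A * measure Q ?E \<le> r * ((real z)\<^sup>2 + A)"
        by (simp add: algebra_simps)
    next
      case False
      have "\<epsilon> \<le> measure Q {s. F s (Suc z) = 0}"
        unfolding \<epsilon>_def
      proof (intro Q.finite_measure_mono subsetI)
        have "{s \<in> space Q. F s (Suc z) = 0} \<in> Q.events" by measurable
        then show "{s. F s (Suc z) = 0} \<in> Q.events" by (simp add: space_Q)
        fix s assume "s \<in> {s. F s (Suc z0) = 0}"
        then show "s \<in> {s. F s (Suc z) = 0}"
          using zeros_before_mono[of "Suc z" "Suc z0" "arr s"] False by auto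
      qed
      moreover have "measure Q ?E = 1 - measure Q {s. F s (Suc z) = 0}"
      proof -
        have "{s \<in> space Q. F s (Suc z) = 0} \<in> Q.events" by measurable
        then have "{s. F s (Suc z) = 0} \<in> Q.events" by (simp add: space_Q)
        moreover have "?E = space Q - {s. F s (Suc z) = 0}" by (auto simp: space_Q)
        ultimately show ?thesis using Q.prob_compl by metis
      qed
      ultimately have "A * measure Q ?E \<le> A * (1 - \<epsilon>)" using A by (intro mult_left_mono) auto
      moreover have "C + A * (1 - \<epsilon>) \<le> A * (1 - \<epsilon> / 2)"
        using \<epsilon> by (simp add: A_def field_simps)
      moreover have "A * (1 - \<epsilon> / 2) \<le> A * r" using A r by (intro mult_left_mono) auto
      moreover have "\<rho> * (real z)\<^sup>2 \<le> r * (real z)\<^sup>2" using r by (intro mult_right_mono) auto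
      ultimately show "\<rho> * (real z)\<^sup>2 + C + A * measure Q ?E \<le> r * ((real z)\<^sup>2 + A)"
        by (simp add: algebra_simps)
    qed
    finally show ?thesis .
  qed
  then show ?thesis using A r by blast
qed

definition "kA = (SOME A. \<exists>r. 0 \<le> A \<and> 0 < r \<and> r < 1 \<and> (\<forall>z>0. (\<integral>\<^sup>+s. ennreal (if F s (Suc z) = 0 then 0 else (real (F s (Suc z)))\<^sup>2 + A) \<partial>Q)
     \<le> ennreal (r * ((real z)\<^sup>2 + A))))"

definition "kr = (SOME r. 0 \<le> kA \<and> 0 < r \<and> r < 1 \<and> (\<forall>z>0. (\<integral>\<^sup>+s. ennreal (if F s (Suc z) = 0 then 0 else (real (F s (Suc z)))\<^sup>2 + kA) \<partial>Q)
     \<le> ennreal (r * ((real z)\<^sup>2 + kA))))"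

text \<open>Lyapunov function of the killed chain: it vanishes at the absorbing state, so the jump
  from \<open>kA\<close> down to 0 makes the chance of absorption count.\<close>

definition V :: "nat \<Rightarrow> real" where "V z = (if z = 0 then 0 else (real z)\<^sup>2 + kA)"

lemma kA: "0 \<le> kA" and kr: "0 < kr" "kr < 1"
  and V_contraction: "z > 0 \<Longrightarrow> (\<integral>\<^sup>+s. ennreal (V (F s (Suc z))) \<partial>Q) \<le> ennreal (kr * V z)"
proof -
  have "\<exists>r. 0 \<le> kA \<and> 0 < r \<and> r < 1 \<and> (\<forall>z>0. (\<integral>\<^sup>+s. ennreal (if F s (Suc z) = 0 then 0 else (real (F s (Suc z)))\<^sup>2 + kA) \<partial>Q)
     \<le> ennreal (r * ((real z)\<^sup>2 + kA)))"
    unfolding kA_def using killed_contraction_ex by (rule someI_ex)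
  then have "0 \<le> kA \<and> 0 < kr \<and> kr < 1 \<and> (\<forall>z>0. (\<integral>\<^sup>+s. ennreal (if F s (Suc z) = 0 then 0 else (real (F s (Suc z)))\<^sup>2 + kA) \<partial>Q)
     \<le> ennreal (kr * ((real z)\<^sup>2 + kA)))"
    unfolding kr_def by (rule someI_ex)
  then show "0 \<le> kA" "0 < kr" "kr < 1"
    "z > 0 \<Longrightarrow> (\<integral>\<^sup>+s. ennreal (V (F s (Suc z))) \<partial>Q) \<le> ennreal (kr * V z)"
    by (auto simp: V_def)
qed

lemma V_nonneg: "0 \<le> V z" and V_ge: "(real z)\<^sup>2 \<le> V z" and V_le: "V z \<le> (real z)\<^sup>2 + kA"
  and V_ge_self: "real z \<le> V z"
proof -
  show "0 \<le> V z" "(real z)\<^sup>2 \<le> V z" "V z \<le> (real z)\<^sup>2 + kA" using kA by (auto simp: V_def)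
  moreover have "real z \<le> (real z)\<^sup>2" by (cases z) (auto simp: power2_eq_square)
  ultimately show "real z \<le> V z" by linarith
qed

section \<open>Moment bounds obtained by redrawing one site\<close>

lemma nn_integral_resample:
  "f \<in> borel_measurable P \<Longrightarrow> (\<integral>\<^sup>+w. f w \<partial>P) = (\<integral>\<^sup>+w. \<integral>\<^sup>+s. f (w(i := s)) \<partial>Q \<partial>P)"
  unfolding P_def by (rule nn_integral_PiM_resample[OF Q.prob_space_axioms space_Q])

text \<open>\<open>inv\<close> says that the starting value ignores the stacks below
  \<open>m\<close>, the only ones the killed chain consumes. Each step thus meets a fresh stack and
  contributes one factor \<open>kr\<close>.\<close>

lemma nn_integral_V_kc:
  assumes g [measurable]: "g \<in> measurable P (count_space UNIV)" and inv: "\<And>w i s. i < m \<Longrightarrow> g (w(i := s)) = g w"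
  shows "(\<integral>\<^sup>+w. ennreal (V (kc w m (g w) j)) \<partial>P) \<le> ennreal (kr ^ j) * (\<integral>\<^sup>+w. ennreal (V (g w)) \<partial>P)"
proof (induction j)
  case (Suc j)
  note [measurable] = kc_measurable[OF g]
  let ?i = "m - 1 - int j"
  have k: "kc (w(?i := s)) m (g (w(?i := s))) j = kc w m (g w) j" for w s
    by (subst inv) (auto intro!: kc_cong)
  have "(\<integral>\<^sup>+w. ennreal (V (kc w m (g w) (Suc j))) \<partial>P)
    = (\<integral>\<^sup>+w. \<integral>\<^sup>+s. ennreal (V (kc (w(?i := s)) m (g (w(?i := s))) (Suc j))) \<partial>Q \<partial>P)"
    by (rule nn_integral_resample) measurable
  also have "\<dots> = (\<integral>\<^sup>+w. \<integral>\<^sup>+s. ennreal (V (if kc w m (g w) j = 0 then 0 else F s (Suc (kc w m (g w) j)))) \<partial>Q \<partial>P)"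
    by (simp only: kc.simps k fun_upd_same)
  also have "\<dots> \<le> (\<integral>\<^sup>+w. ennreal (kr * V (kc w m (g w) j)) \<partial>P)"
  proof (rule nn_integral_mono)
    fix w show "(\<integral>\<^sup>+s. ennreal (V (if kc w m (g w) j = 0 then 0 else F s (Suc (kc w m (g w) j)))) \<partial>Q)
      \<le> ennreal (kr * V (kc w m (g w) j))"
      using V_contraction[of "kc w m (g w) j"] by (cases "kc w m (g w) j = 0") (simp_all add: V_def[of 0])
  qed
  also have "\<dots> = ennreal kr * (\<integral>\<^sup>+w. ennreal (V (kc w m (g w) j)) \<partial>P)"
    using kr V_nonneg by (subst nn_integral_cmult[symmetric]) (auto simp: ennreal_mult)
  also have "\<dots> \<le> ennreal kr * (ennreal (kr ^ j) * (\<integral>\<^sup>+w. ennreal (V (g w)) \<partial>P))"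
    using Suc by (intro mult_left_mono) auto
  also have "\<dots> = ennreal (kr ^ Suc j) * (\<integral>\<^sup>+w. ennreal (V (g w)) \<partial>P)"
    using kr by (simp add: ennreal_mult mult.assoc)
  finally show ?case .
qed simp

text \<open>The bound is the fixed point of the moment recursion that sends \<open>x\<close> to
  \<open>\<rho> * x + C\<close>, and the chain starts at zero, below it.\<close>

lemma nn_integral_dn_sq: "(\<integral>\<^sup>+w. ennreal ((real (dn w m j))\<^sup>2) \<partial>P) \<le> ennreal (C / (1 - \<rho>))"
proof (induction j)
  case (Suc j)
  let ?i = "m - 1 - int j"
  have k: "dn (w(?i := s)) m j = dn w m j" for w s by (auto intro!: dn_cong)
  have "(\<integral>\<^sup>+w. ennreal ((real (dn w m (Suc j)))\<^sup>2) \<partial>P)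
    = (\<integral>\<^sup>+w. \<integral>\<^sup>+s. ennreal ((real (dn (w(?i := s)) m (Suc j)))\<^sup>2) \<partial>Q \<partial>P)"
    by (rule nn_integral_resample) measurable
  also have "\<dots> = (\<integral>\<^sup>+w. \<integral>\<^sup>+s. ennreal ((real (F s (Suc (dn w m j))))\<^sup>2) \<partial>Q \<partial>P)"
    by (simp only: dn.simps k fun_upd_same)
  also have "\<dots> \<le> (\<integral>\<^sup>+w. ennreal (\<rho> * (real (dn w m j))\<^sup>2 + C) \<partial>P)"
    by (intro nn_integral_mono moment)
  also have "\<dots> = (\<integral>\<^sup>+w. ennreal \<rho> * ennreal ((real (dn w m j))\<^sup>2) + ennreal C \<partial>P)"
    using \<rho> C by (intro nn_integral_cong) (auto simp: ennreal_mult)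
  also have "\<dots> = ennreal \<rho> * (\<integral>\<^sup>+w. ennreal ((real (dn w m j))\<^sup>2) \<partial>P) + ennreal C"
    by (subst nn_integral_add) (auto simp: nn_integral_cmult P.emeasure_space_1)
  also have "\<dots> \<le> ennreal \<rho> * ennreal (C / (1 - \<rho>)) + ennreal C"
    using Suc by (intro add_mono mult_left_mono) auto
  also have "\<dots> = ennreal (C / (1 - \<rho>))"
    using \<rho> C by (auto simp: field_simps simp flip: ennreal_plus ennreal_mult)
  finally show ?case .
qed simp

definition "CV = C / (1 - \<rho>) + kA"

lemma CV_nonneg: "0 \<le> CV"
  using C \<rho> kA by (simp add: CV_def)

lemma nn_integral_V_dn: "(\<integral>\<^sup>+w. ennreal (V (dn w m j)) \<partial>P) \<le> ennreal CV"
proof -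
  have "(\<integral>\<^sup>+w. ennreal (V (dn w m j)) \<partial>P) \<le> (\<integral>\<^sup>+w. ennreal ((real (dn w m j))\<^sup>2) + ennreal kA \<partial>P)"
    using V_le kA by (intro nn_integral_mono) (auto simp flip: ennreal_plus intro!: ennreal_leI)
  also have "\<dots> = (\<integral>\<^sup>+w. ennreal ((real (dn w m j))\<^sup>2) \<partial>P) + ennreal kA"
    by (subst nn_integral_add) (auto simp: P.emeasure_space_1)
  also have "\<dots> \<le> ennreal (C / (1 - \<rho>)) + ennreal kA" by (intro add_mono nn_integral_dn_sq) auto
  also have "\<dots> = ennreal CV" using C \<rho> kA by (simp add: CV_def)
  finally show ?thesis .
qed

lemma nn_integral_V_kc_dn: "(\<integral>\<^sup>+w. ennreal (V (kc w m (dn w (m + int i) i) j)) \<partial>P) \<le> ennreal (CV * kr ^ j)"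
proof -
  have "(\<integral>\<^sup>+w. ennreal (V (kc w m (dn w (m + int i) i) j)) \<partial>P)
     \<le> ennreal (kr ^ j) * (\<integral>\<^sup>+w. ennreal (V (dn w (m + int i) i)) \<partial>P)"
    by (rule nn_integral_V_kc) (auto intro!: dn_cong)
  also have "\<dots> \<le> ennreal (kr ^ j) * ennreal CV" by (intro mult_left_mono nn_integral_V_dn) auto
  also have "\<dots> = ennreal (CV * kr ^ j)" using kr CV_nonneg by (simp add: ennreal_mult mult.commute)
  finally show ?thesis .
qed

section \<open>Cost in mean square of changing the level\<close>

definition D :: "nat \<Rightarrow> nat \<Rightarrow> (int \<Rightarrow> 's) \<Rightarrow> real" where
  "D m x w = real (dn w (int m) (m - x))"

lemma D_measurable [measurable]: "D m x \<in> borel_measurable P"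
  unfolding D_def[abs_def] by measurable

lemma sq_int_D: "sq_int P (D m x)"
  unfolding sq_int_def
proof
  show "integrable P (\<lambda>w. (D m x w)\<^sup>2)"
    using nn_integral_dn_sq[of "int m" "m - x"]
    by (intro integrableI_bounded) (auto simp: D_def intro: le_less_trans)
qed measurable

lemma D_mono: "x \<le> m \<Longrightarrow> m \<le> n \<Longrightarrow> D m x w \<le> D n x w"
  using dn_le_dn[of w "int m" "m - x" "n - m"] by (simp add: D_def)

lemma D_nonneg: "0 \<le> D n x w" by (simp add: D_def)

text \<open>The difference is at most the chain killed at zero that starts at \<open>m\<close> from
  what the chain of level \<open>n\<close> carries there. It has \<open>m - x\<close> steps to die,
  and the rate for second moments is \<open>kr\<close>.\<close>

lemma D_diff_sq:
  assumes "x \<le> m" "m \<le> n"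
  shows "L2n P (\<lambda>w. D n x w - D m x w) \<le> sqrt CV * sqrt kr ^ (m - x)"
proof -
  let ?k = "\<lambda>w. kc w (int m) (dn w (int n) (n - m)) (m - x)"
  have le: "D n x w - D m x w \<le> real (?k w)" for w
    using dn_le_dn_plus_kc[of w "int m" "n - m" "m - x"] assms by (simp add: D_def)
  have sq: "(D n x w - D m x w)\<^sup>2 \<le> V (?k w)" for w
  proof -
    have "(D n x w - D m x w)\<^sup>2 \<le> (real (?k w))\<^sup>2"
      using le D_mono[OF assms] by (intro power_mono) auto
    then show ?thesis using V_ge[of "?k w"] by linarith
  qed
  have "ennreal (\<integral>w. (D n x w - D m x w)\<^sup>2 \<partial>P) = (\<integral>\<^sup>+w. ennreal ((D n x w - D m x w)\<^sup>2) \<partial>P)"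
    using sq_int_diff[OF sq_int_D sq_int_D, of n x m x]
    by (subst nn_integral_eq_integral) (auto simp: sq_int_def)
  also have "\<dots> \<le> (\<integral>\<^sup>+w. ennreal (V (?k w)) \<partial>P)"
    using sq by (intro nn_integral_mono ennreal_leI)
  also have "\<dots> \<le> ennreal (CV * kr ^ (m - x))"
    using nn_integral_V_kc_dn[of "int m" "n - m" "m - x"] assms by simp
  finally have "(\<integral>w. (D n x w - D m x w)\<^sup>2 \<partial>P) \<le> CV * kr ^ (m - x)"
    using CV_nonneg kr by (simp add: ennreal_le_iff)
  then show ?thesis
    unfolding L2n_def by (simp add: real_sqrt_mult[symmetric] real_sqrt_power[symmetric])
qed

end

context stack_law
begin

section \<open>Variance of the number of left steps\<close>

definition q :: real where "q = sqrt kr"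

lemma q: "0 < q" "q < 1"
  using kr by (auto simp: q_def)

lemma L2n_D_diff: "x \<le> m \<Longrightarrow> m \<le> n \<Longrightarrow> L2n P (\<lambda>w. D n x w - D m x w) \<le> sqrt CV * q ^ (m - x)"
  unfolding q_def by (rule D_diff_sq)

lemma D_self [simp]: "D m m w = 0"
  by (simp add: D_def)

lemma D_cong: "x \<le> m \<Longrightarrow> (\<And>i. int x \<le> i \<Longrightarrow> i < int m \<Longrightarrow> w i = w' i) \<Longrightarrow> D m x w = D m x w'"
  unfolding D_def by (intro arg_cong[where f = real] dn_cong) auto

lemma D_shift: "x \<le> m \<Longrightarrow> D (a + m) (a + x) w = D m x (\<lambda>i. w (i + int a))"
  by (simp add: D_def dn_shift add.commute)

lemma shift_measurable: "(\<lambda>w i. w (i + a)) \<in> measurable P P"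
  unfolding P_def by (rule measurable_PiM_reindex[OF Q.prob_space_axioms space_Q])

lemma distr_shift: "distr P P (\<lambda>w i. w (i + a)) = P"
  unfolding P_def by (rule distr_PiM_UNIV_reindex[OF Q.prob_space_axioms space_Q]) (auto simp: inj_def)

lemma expectation_indep:
  assumes "sq_int P f" "sq_int P g"
    and "\<And>w w'. (\<And>i. i \<in> A \<Longrightarrow> w i = w' i) \<Longrightarrow> f w = f w'"
    and "\<And>w w'. (\<And>i. i \<in> A' \<Longrightarrow> w i = w' i) \<Longrightarrow> g w = g w'"
    and "A \<inter> A' = {}"
  shows "P.expectation (\<lambda>w. f w * g w) = P.expectation f * P.expectation g"
proof -
  have "P.indep_vars (\<lambda>_. borel) (case_bool f g) UNIV"
    unfolding P_def
  proof (rule indep_vars_PiM_blocks[OF Q.prob_space_axioms space_Q, where K = "case_bool A A'"])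
    show "disjoint_family_on (case_bool A A') UNIV"
      using assms(5) by (auto simp: disjoint_family_on_def split: bool.splits)
    show "case_bool f g j \<in> borel_measurable (PiM UNIV (\<lambda>_. Q))" for j
      using assms(1,2) by (cases j) (auto simp: sq_int_def P_def)
    show "case_bool f g j w = case_bool f g j w'" if "\<And>i. i \<in> (case j of True \<Rightarrow> A | False \<Rightarrow> A') \<Longrightarrow> w i = w' i" for j w w'
    proof (cases j)
      case True
      then show ?thesis using assms(3)[of w w'] that by simp
    next
      case False
      then show ?thesis using assms(4)[of w w'] that by simp
    qed
  qed
  moreover have "case_bool borel borel = (\<lambda>_. borel :: real measure)" by (auto simp: fun_eq_iff split: bool.splits)
  ultimately have "P.indep_var borel f borel g"
    unfolding P.indep_var_def by simp
  then show ?thesis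
    using assms(1,2) by (intro P.indep_var_lebesgue_integral P.sq_int_integrable)
qed

text \<open>\<open>e\<close> and \<open>e'\<close> are the errors made at \<open>x\<close> and
  \<open>y\<close> by restarting at levels \<open>m\<close> and \<open>m'\<close> instead of reading
  from \<open>n\<close>. If \<open>y\<close> lies below a common restart level, both errors are
  small and Cauchy-Schwarz suffices. Otherwise \<open>e\<close> is cut at \<open>y\<close> into a
  part independent of \<open>e'\<close> and a small remainder. Products of expectations are
  nonnegative by monotonicity and may be dropped from an upper bound.\<close>

lemma covariance_le:
  assumes "x \<le> y" "y < n" "x \<le> m" "y \<le> m'" "m' \<le> n" "m \<le> y \<or> m = m'"
  defines "e \<equiv> \<lambda>w. D n x w - D m x w" and "e' \<equiv> \<lambda>w. D n y w - D m' y w"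
  shows "P.expectation (\<lambda>w. e w * e' w) - P.expectation e * P.expectation e' \<le> CV * q ^ (m' - x)"
proof (cases "m \<le> y")
  case False
  then have m: "m = m'" "y < m" using assms by auto
  have sq: "sq_int P e" "sq_int P e'" unfolding e_def e'_def by (intro sq_int_diff sq_int_D)+
  have "P.expectation (\<lambda>w. e w * e' w) \<le> L2n P e * L2n P e'"
    using L2n_mult_le[OF sq] by simp
  also have "\<dots> \<le> (sqrt CV * q ^ (m - x)) * (sqrt CV * q ^ (m' - y))"
    unfolding e_def e'_def using assms m q CV_nonneg by (intro mult_mono L2n_D_diff L2n_nonneg mult_nonneg_nonneg) auto
  also have "\<dots> = CV * (q ^ (m' - x) * q ^ (m' - y))" using CV_nonneg m by (simp add: algebra_simps)
  also have "\<dots> \<le> CV * (q ^ (m' - x) * 1)"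
    using q CV_nonneg by (intro mult_left_mono power_le_one) auto
  finally have "P.expectation (\<lambda>w. e w * e' w) \<le> CV * q ^ (m' - x)" by simp
  moreover have "0 \<le> P.expectation e * P.expectation e'"
    unfolding e_def e'_def using assms m D_mono by (intro mult_nonneg_nonneg integral_nonneg_AE AE_I2) auto
  ultimately show ?thesis by simp
next
  case True
  \<comment> \<open>\<open>f\<close> reads only the sites from \<open>x\<close> to \<open>y\<close>,
    while \<open>e'\<close> reads only sites from \<open>y\<close> on. The remainder
    \<open>h\<close> is the change of level from \<open>y\<close> to \<open>n\<close>, of size
    \<open>q ^ (y - x)\<close>; together with \<open>q ^ (m' - y)\<close> for \<open>e'\<close> this
    gives the exponent \<open>m' - x\<close>.\<close>
  define f where "f = (\<lambda>w. D y x w - D m x w)"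
  define h where "h = (\<lambda>w. D n x w - D y x w)"
  have sq: "sq_int P e" "sq_int P e'" "sq_int P f" "sq_int P h"
    unfolding e_def e'_def f_def h_def by (intro sq_int_diff sq_int_D)+
  have e: "e w = f w + h w" for w by (simp add: e_def f_def h_def)
  have ind: "P.expectation (\<lambda>w. f w * e' w) = P.expectation f * P.expectation e'"
    by (rule expectation_indep[OF sq(3,2), of "{int x..<int y}" "{int y..<int n}"])
       (use assms True in \<open>auto simp: f_def e'_def intro!: arg_cong2[where f = minus] D_cong\<close>)
  have "P.expectation (\<lambda>w. e w * e' w) = P.expectation f * P.expectation e' + P.expectation (\<lambda>w. h w * e' w)"
    unfolding e ind[symmetric] using sq by (simp add: distrib_right sq_int_mult_integrable)
  moreover have "P.expectation e * P.expectation e' = P.expectation f * P.expectation e' + P.expectation h * P.expectation e'"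
    unfolding e using sq by (simp add: distrib_right P.sq_int_integrable)
  moreover have "0 \<le> P.expectation h * P.expectation e'"
    unfolding h_def e'_def using assms True D_mono by (intro mult_nonneg_nonneg integral_nonneg_AE AE_I2) auto
  moreover have "P.expectation (\<lambda>w. h w * e' w) \<le> CV * q ^ (m' - x)"
  proof -
    have "P.expectation (\<lambda>w. h w * e' w) \<le> L2n P h * L2n P e'"
      using L2n_mult_le[OF sq(4,2)] by simp
    also have "\<dots> \<le> (sqrt CV * q ^ (y - x)) * (sqrt CV * q ^ (m' - y))"
      unfolding h_def e'_def using assms q CV_nonneg by (intro mult_mono L2n_D_diff L2n_nonneg mult_nonneg_nonneg) auto
    also have "\<dots> = CV * q ^ ((y - x) + (m' - y))" using CV_nonneg by (simp add: algebra_simps power_add)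
    finally show ?thesis using assms by simp
  qed
  ultimately show ?thesis by linarith
qed

lemma sum_power_diff_le: "(\<Sum>x\<le>y. q ^ (y - x)) \<le> 1 / (1 - q)"
proof -
  have "(\<Sum>x\<le>y. q ^ (y - x)) = (\<Sum>x\<le>y. q ^ x)"
    by (rule sum.reindex_bij_witness[of _ "\<lambda>x. y - x" "\<lambda>x. y - x"]) auto
  also have "\<dots> \<le> (\<Sum>x. q ^ x)"
    using q by (intro sum_le_suminf summable_geometric) auto
  also have "\<dots> = 1 / (1 - q)" using q by (intro suminf_geometric) auto
  finally show ?thesis .
qed

definition K1 :: real where "K1 = 2 * CV / (1 - q)"

lemma K1_nonneg: "0 \<le> K1"
  using CV_nonneg q by (simp add: K1_def)

text \<open>One estimate for two uses: with \<open>m x = x\<close> the subtracted terms vanish and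
  it bounds the variance of the whole count; with \<open>m x\<close> the end of the block of
  \<open>x\<close> it bounds the cost of restarting. \<open>cons\<close> says that a later site
  either lies beyond the restart level of \<open>x\<close> or shares it.\<close>

lemma variance_sum_le:
  fixes m :: "nat \<Rightarrow> nat"
  assumes m: "\<And>x. x < n \<Longrightarrow> x \<le> m x \<and> m x \<le> n" and cons: "\<And>x y. x \<le> y \<Longrightarrow> y < n \<Longrightarrow> m x \<le> y \<or> m x = m y"
  defines "E \<equiv> \<lambda>w. \<Sum>x<n. D n x w - D (m x) x w"
  shows "(L2n P (\<lambda>w. E w - P.expectation E))\<^sup>2 \<le> K1 * (\<Sum>y<n. q ^ (m y - y))"
proof -
  let ?e = "\<lambda>x w. D n x w - D (m x) x w"
  let ?c = "\<lambda>x y. P.expectation (\<lambda>w. ?e x w * ?e y w) - P.expectation (?e x) * P.expectation (?e y)"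
  \<comment> \<open>The covariance bound holds for ordered pairs. Adding \<open>?h x y\<close> and
    \<open>?h y x\<close> covers both orders at once and accounts for the factor 2 in
    \<open>K1\<close>.\<close>
  let ?h = "\<lambda>x y. if x \<le> y then CV * q ^ (m y - x) else 0"
  have h0: "0 \<le> ?h x y" for x y using q CV_nonneg by simp
  have le: "?c x y \<le> ?h x y" if "x \<le> y" "y < n" for x y
    using that covariance_le[of x y n "m x" "m y"] m[of x] m[of y] cons[of x y] by auto
  have c: "?c x y \<le> ?h x y + ?h y x" if "x < n" "y < n" for x y
  proof (cases "x \<le> y")
    case True
    then show ?thesis using le[OF True that(2)] h0[of y x] by linarith
  next
    case False
    have "?c x y = ?c y x" by (simp add: mult.commute)
    then show ?thesis using le[of y x] False that h0[of x y] by linarith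
  qed
  have "(L2n P (\<lambda>w. E w - P.expectation E))\<^sup>2 = (\<Sum>x<n. \<Sum>y<n. ?c x y)"
    unfolding E_def by (rule P.L2n_centered_sum_sq) (auto intro!: sq_int_diff sq_int_D)
  also have "\<dots> \<le> (\<Sum>x<n. \<Sum>y<n. ?h x y + ?h y x)"
    by (intro sum_mono c) auto
  also have "\<dots> = (\<Sum>x<n. \<Sum>y<n. ?h x y) + (\<Sum>x<n. \<Sum>y<n. ?h y x)"
    by (simp add: sum.distrib)
  also have "(\<Sum>x<n. \<Sum>y<n. ?h x y) = (\<Sum>x<n. \<Sum>y<n. ?h y x)"
    by (rule sum.swap)
  also have "(\<Sum>x<n. \<Sum>y<n. ?h y x) = (\<Sum>y<n. \<Sum>x\<le>y. CV * q ^ (m y - x))"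
    by (intro sum.cong sum.mono_neutral_cong_right) auto
  also have "\<dots> \<le> (\<Sum>y<n. CV / (1 - q) * q ^ (m y - y))"
  proof (intro sum_mono)
    fix y assume y: "y \<in> {..<n}"
    have "(\<Sum>x\<le>y. CV * q ^ (m y - x)) = (\<Sum>x\<le>y. CV * q ^ (m y - y) * q ^ (y - x))"
      using m[of y] y by (intro sum.cong refl) (auto simp: mult.assoc simp flip: power_add)
    also have "\<dots> \<le> CV * q ^ (m y - y) * (1 / (1 - q))"
      unfolding sum_distrib_left[symmetric] using q CV_nonneg by (intro mult_left_mono sum_power_diff_le) auto
    finally show "(\<Sum>x\<le>y. CV * q ^ (m y - x)) \<le> CV / (1 - q) * q ^ (m y - y)" by simp
  qed
  finally have "(L2n P (\<lambda>w. E w - P.expectation E))\<^sup>2 \<le> 2 * (\<Sum>y<n. CV / (1 - q) * q ^ (m y - y))" by simp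
  then show ?thesis unfolding sum_distrib_left[symmetric] by (simp add: K1_def)
qed

section \<open>Comparison with independent blocks\<close>

definition Bn :: "nat \<Rightarrow> (int \<Rightarrow> 's) \<Rightarrow> real" where
  "Bn n w = (\<Sum>x<n. D n x w)"

definition cB :: "nat \<Rightarrow> (int \<Rightarrow> 's) \<Rightarrow> real" where
  "cB n w = Bn n w - P.expectation (Bn n)"

lemma sq_int_Bn: "sq_int P (Bn n)"
  unfolding Bn_def[abs_def] by (intro sq_int_sum sq_int_D) auto

lemma sq_int_cB: "sq_int P (cB n)"
  unfolding cB_def[abs_def] by (intro sq_int_diff sq_int_Bn P.sq_int_const)

lemma Bn_measurable [measurable]: "Bn n \<in> borel_measurable P" and cB_measurable [measurable]: "cB n \<in> borel_measurable P"
  using sq_int_Bn sq_int_cB by (auto simp: sq_int_def)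

lemma Bn_nonneg: "0 \<le> Bn n w"
  unfolding Bn_def by (intro sum_nonneg D_nonneg)

lemma variance_Bn_le: "(L2n P (cB n))\<^sup>2 \<le> K1 * real n"
  using variance_sum_le[of n "\<lambda>x. x"] by (simp add: cB_def[abs_def] Bn_def[abs_def])

text \<open>Restarting from zero at the right end of the block, instead of reading from
  \<open>n\<close>, makes the sum depend on the stacks of this block alone.\<close>

definition blk :: "nat \<Rightarrow> nat \<Rightarrow> (int \<Rightarrow> 's) \<Rightarrow> real" where
  "blk L i w = (\<Sum>x=i*L..<i*L+L. D (i*L+L) x w)"

lemma blk_shift: "blk L i w = Bn L (\<lambda>j. w (j + int (i * L)))"
proof -
  have "blk L i w = (\<Sum>x<L. D (i*L+L) (i*L+x) w)"
    unfolding blk_def by (rule sum.reindex_bij_witness[of _ "\<lambda>x. i*L+x" "\<lambda>x. x - i*L"]) auto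
  then show ?thesis by (simp add: D_shift Bn_def)
qed

lemma blk_measurable [measurable]: "blk L i \<in> borel_measurable P"
  unfolding blk_def[abs_def] by measurable

lemma distr_blk: "distr P borel (blk L i) = distr P borel (Bn L)"
proof -
  have "distr P borel (Bn L) = distr (distr P P (\<lambda>w j. w (j + int (i * L)))) borel (Bn L)"
    by (simp add: distr_shift)
  also have "\<dots> = distr P borel (blk L i)"
    by (subst distr_distr) (auto simp: shift_measurable blk_shift[abs_def] comp_def)
  finally show ?thesis ..
qed

lemma sq_int_blk: "sq_int P (blk L i)"
  unfolding blk_def[abs_def] by (intro sq_int_sum sq_int_D) auto

lemma integral_blk: "g \<in> borel_measurable borel \<Longrightarrow> (\<integral>w. (g (blk L i w) :: real) \<partial>P) = (\<integral>w. g (Bn L w) \<partial>P)"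
proof -
  assume [measurable]: "g \<in> borel_measurable borel"
  have "(\<integral>w. g (blk L i w) \<partial>P) = (\<integral>x. g x \<partial>distr P borel (blk L i))" by (subst integral_distr) auto
  also have "\<dots> = (\<integral>w. g (Bn L w) \<partial>P)" unfolding distr_blk by (subst integral_distr) auto
  finally show ?thesis .
qed

lemma expectation_blk: "P.expectation (blk L i) = P.expectation (Bn L)"
  using integral_blk[of "\<lambda>x. x" L i] by simp

definition cblk :: "nat \<Rightarrow> nat \<Rightarrow> (int \<Rightarrow> 's) \<Rightarrow> real" where
  "cblk L i w = blk L i w - P.expectation (Bn L)"

lemma sq_int_cblk: "sq_int P (cblk L i)"
  unfolding cblk_def[abs_def] by (intro sq_int_diff sq_int_blk P.sq_int_const)

lemma cblk_measurable [measurable]: "cblk L i \<in> borel_measurable P"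
  using sq_int_cblk by (auto simp: sq_int_def)

lemma blk_cong:
  assumes "\<And>j. int (i * L) \<le> j \<Longrightarrow> j < int (i * L + L) \<Longrightarrow> w j = w' j"
  shows "blk L i w = blk L i w'"
  unfolding blk_def
proof (intro sum.cong D_cong refl)
  fix x j assume x: "x \<in> {i * L..<i * L + L}" and j: "int x \<le> j" "j < int (i * L + L)"
  have "int (i * L) \<le> int x" using x by (intro of_nat_mono) auto
  then show "w j = w' j" using assms[of j] j by linarith
qed auto

lemma cblk_cong:
  assumes "\<And>j. j \<in> {int (i * L)..<int (i * L + L)} \<Longrightarrow> w j = w' j"
  shows "cblk L i w = cblk L i w'"
  using blk_cong[of i L w w'] assms by (simp add: cblk_def)

lemma blk_sites_disjoint:
  assumes "i \<noteq> j"
  shows "{int (i*L)..<int (i*L+L)} \<inter> {int (j*L)..<int (j*L+L)} = {}"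
proof -
  have *: "{int (i*L)..<int (i*L+L)} \<inter> {int (j*L)..<int (j*L+L)} = {}" if "i < j" for i j :: nat
  proof -
    have "Suc i * L \<le> j * L" using that by (intro mult_right_mono) auto
    then have "i * L + L \<le> j * L" by simp
    then have "int (i*L+L) \<le> int (j*L)" by (rule of_nat_mono)
    then show ?thesis by (auto simp del: of_nat_add of_nat_mult)
  qed
  show ?thesis
    using assms *[of i j] *[of j i] by (cases "i < j") (auto simp: Int_commute)
qed

lemma indep_cblk: "P.indep_vars (\<lambda>_. borel) (cblk L) UNIV"
  unfolding P_def
proof (rule indep_vars_PiM_blocks[OF Q.prob_space_axioms space_Q, where K = "\<lambda>i. {int (i*L)..<int (i*L+L)}"])
  show "disjoint_family_on (\<lambda>i. {int (i*L)..<int (i*L+L)}) UNIV"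
    unfolding disjoint_family_on_def using blk_sites_disjoint by blast
  show "cblk L j \<in> borel_measurable (PiM UNIV (\<lambda>_. Q))" for j
    using cblk_measurable by (simp add: P_def)
  show "cblk L j w = cblk L j w'" if "\<And>i. i \<in> {int (j*L)..<int (j*L+L)} \<Longrightarrow> w i = w' i" for j w w'
    using that by (rule cblk_cong)
qed

lemma expectation_cblk: "P.expectation (cblk L i) = 0"
  unfolding cblk_def[abs_def] using P.sq_int_integrable[OF sq_int_blk]
  by (simp add: expectation_blk P.prob_space)

lemma L2n_cblk: "L2n P (cblk L i) = L2n P (cB L)"
  unfolding L2n_def cblk_def cB_def by (subst integral_blk[where g = "\<lambda>x. (x - P.expectation (Bn L))\<^sup>2"]) auto

lemma L2n_sum_cblk: "(L2n P (\<lambda>w. \<Sum>i<k. cblk L i w))\<^sup>2 = real k * (L2n P (cB L))\<^sup>2"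
proof -
  have "P.expectation (\<lambda>w. \<Sum>i<k. cblk L i w) = 0"
    using sq_int_cblk by (subst Bochner_Integration.integral_sum) (auto simp: expectation_cblk P.sq_int_integrable)
  then have "(L2n P (\<lambda>w. \<Sum>i<k. cblk L i w))\<^sup>2
     = (\<Sum>i<k. \<Sum>j<k. P.expectation (\<lambda>w. cblk L i w * cblk L j w) - P.expectation (cblk L i) * P.expectation (cblk L j))"
    using P.L2n_centered_sum_sq[of "{..<k}" "cblk L"] sq_int_cblk by simp
  also have "\<dots> = (\<Sum>i<k. \<Sum>j<k. if i = j then (L2n P (cB L))\<^sup>2 else 0)"
  proof (intro sum.cong refl)
    fix i j
    show "P.expectation (\<lambda>w. cblk L i w * cblk L j w) - P.expectation (cblk L i) * P.expectation (cblk L j)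
       = (if i = j then (L2n P (cB L))\<^sup>2 else 0)"
    proof (cases "i = j")
      case True
      then show ?thesis using L2n_cblk[of L i] by (simp add: expectation_cblk L2n_sq[symmetric] flip: power2_eq_square)
    next
      case False
      have "P.expectation (\<lambda>w. cblk L i w * cblk L j w) = P.expectation (cblk L i) * P.expectation (cblk L j)"
        by (rule expectation_indep[OF sq_int_cblk sq_int_cblk cblk_cong cblk_cong blk_sites_disjoint[OF False]])
      then show ?thesis using False by simp
    qed
  qed
  also have "\<dots> = real k * (L2n P (cB L))\<^sup>2" by simp
  finally show ?thesis .
qed

text \<open>Within a block the restart errors form a geometric series in the distance to the right
  end, so each block costs at most \<open>1 / (1 - q)\<close>, whatever its length. The cost is thus
  proportional to the number of blocks rather than to \<open>n\<close>.\<close>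

lemma block_approx:
  assumes L: "0 < L"
  shows "(L2n P (\<lambda>w. cB n w - (\<Sum>i<n div L. cblk L i w)))\<^sup>2 \<le> K1 / (1 - q) * (real (n div L) + real L)"
proof -
  define k where "k = n div L"
  \<comment> \<open>Sites past the last complete block are restarted at themselves, so their
    restarted count is zero. Each contributes \<open>q ^ 0\<close>, and there are fewer than
    \<open>L\<close> of them.\<close>
  define m where "m x = (if x < k * L then (x div L) * L + L else x)" for x
  have kL: "k * L \<le> n" by (simp add: k_def)
  have nkL: "n < k * L + L" using L dividend_less_div_times[of L n] by (simp add: k_def add.commute)
  have divle: "(x div L) * L + L \<le> k * L" if "x < k * L" for x
  proof -
    have "x div L < k" using that L by (simp add: less_mult_imp_div_less)
    then have "Suc (x div L) * L \<le> k * L" by (intro mult_right_mono) auto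
    then show ?thesis by simp
  qed
  have xlt: "x < (x div L) * L + L" for x using L dividend_less_div_times[of L x] by (simp add: add.commute)
  have m1: "x \<le> m x \<and> m x \<le> n" if "x < n" for x
    using that kL divle[of x] xlt[of x] by (auto simp: m_def)
  have m2: "m x \<le> y \<or> m x = m y" if "x \<le> y" "y < n" for x y
  proof (cases "x < k * L \<and> y < (x div L) * L + L")
    case True
    then have y: "y < k * L" using divle[of x] by simp
    have "x div L \<le> y div L" using that by (intro div_le_mono)
    moreover have "y div L < Suc (x div L)"
      using True L by (simp add: less_mult_imp_div_less)
    ultimately have "y div L = x div L" by simp
    then show ?thesis using True y by (simp add: m_def)
  qed (use that in \<open>auto simp: m_def\<close>)
  have blocks: "(\<Sum>x<k*L. f x) = (\<Sum>i<k. \<Sum>x=i*L..<i*L+L. f x)" for f :: "nat \<Rightarrow> real"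
    by (rule sum.nat_group[symmetric])
  have divL: "x div L = i" if "x \<in> {i*L..<i*L+L}" for x i
    using that L by (intro div_nat_eqI) (auto simp: mult.commute)
  have inblk: "x < k * L" if "x \<in> {i*L..<i*L+L}" "i < k" for x i
  proof -
    have "Suc i * L \<le> k * L" using that by (intro mult_right_mono) auto
    then show ?thesis using that by auto
  qed
  have split: "{..<n} = {..<k*L} \<union> {k*L..<n}" using kL by auto
  have "(\<Sum>x<n. D (m x) x w) = (\<Sum>i<k. blk L i w)" for w
  proof -
    have "(\<Sum>x<n. D (m x) x w) = (\<Sum>x<k*L. D (m x) x w) + (\<Sum>x=k*L..<n. D (m x) x w)"
      unfolding split by (rule sum.union_disjoint) auto
    also have "(\<Sum>x=k*L..<n. D (m x) x w) = 0" by (intro sum.neutral) (auto simp: m_def)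
    also have "(\<Sum>x<k*L. D (m x) x w) = (\<Sum>i<k. \<Sum>x=i*L..<i*L+L. D (m x) x w)" by (rule blocks)
    also have "\<dots> = (\<Sum>i<k. blk L i w)"
      unfolding blk_def using divL inblk by (intro sum.cong refl) (auto simp: m_def)
    finally show ?thesis by simp
  qed
  then have eq: "(\<Sum>x<n. D n x w - D (m x) x w) = Bn n w - (\<Sum>i<k. blk L i w)" for w
    by (simp add: sum_subtractf Bn_def)
  have ex: "P.expectation (\<lambda>w. Bn n w - (\<Sum>i<k. blk L i w)) = P.expectation (Bn n) - real k * P.expectation (Bn L)"
    using P.sq_int_integrable[OF sq_int_Bn] P.sq_int_integrable[OF sq_int_blk] by (simp add: expectation_blk)
  have "(L2n P (\<lambda>w. cB n w - (\<Sum>i<k. cblk L i w)))\<^sup>2 = (L2n P (\<lambda>w. (\<Sum>x<n. D n x w - D (m x) x w) - P.expectation (\<lambda>w. \<Sum>x<n. D n x w - D (m x) x w)))\<^sup>2"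
    unfolding eq ex by (simp add: cB_def cblk_def sum_subtractf algebra_simps)
  also have "\<dots> \<le> K1 * (\<Sum>y<n. q ^ (m y - y))"
    by (rule variance_sum_le[OF m1 m2])
  also have "\<dots> \<le> K1 * (1 / (1 - q) * (real k + real L))"
  proof (rule mult_left_mono[OF _ K1_nonneg])
    have "(\<Sum>y<n. q ^ (m y - y)) = (\<Sum>y<k*L. q ^ (m y - y)) + (\<Sum>y=k*L..<n. q ^ (m y - y))"
      unfolding split by (rule sum.union_disjoint) auto
    also have "(\<Sum>y=k*L..<n. q ^ (m y - y)) = real (n - k * L)" by (simp add: m_def)
    also have "\<dots> \<le> 1 / (1 - q) * real L"
    proof -
      have "1 * real (n - k * L) \<le> 1 / (1 - q) * real L" using nkL q by (intro mult_mono) auto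
      then show ?thesis by simp
    qed
    also have "(\<Sum>y<k*L. q ^ (m y - y)) = (\<Sum>i<k. \<Sum>x=i*L..<i*L+L. q ^ (m x - x))" by (rule blocks)
    also have "\<dots> \<le> (\<Sum>i<k. 1 / (1 - q))"
    proof (intro sum_mono)
      fix i assume i: "i \<in> {..<k}"
      have "(\<Sum>x=i*L..<i*L+L. q ^ (m x - x)) = (\<Sum>x=i*L..<i*L+L. q ^ (i * L + L - x))"
        using i divL inblk by (intro sum.cong refl) (auto simp: m_def)
      also have "\<dots> \<le> (\<Sum>x\<le>i*L+L. q ^ (i * L + L - x))"
        using q by (intro sum_mono2) auto
      also have "\<dots> \<le> 1 / (1 - q)" by (rule sum_power_diff_le)
      finally show "(\<Sum>x=i*L..<i*L+L. q ^ (m x - x)) \<le> 1 / (1 - q)" .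
    qed
    finally show "(\<Sum>y<n. q ^ (m y - y)) \<le> 1 / (1 - q) * (real k + real L)"
      by (simp add: distrib_left field_simps add_divide_distrib)
  qed
  finally show ?thesis by (simp add: k_def)
qed

section \<open>Lower bound for the variance\<close>

text \<open>The two chains agree until site \<open>i\<close>, separate strictly there because at
  least one right arrow is awaited, and stay ordered afterwards by monotonicity.\<close>

lemma dn_flip:
  assumes good: "good (arr s)" and i: "i = m - 1 - int j0"
  shows "dn (w(i := flip True s)) m j \<le> dn (w(i := flip False s)) m j
    \<and> (j = Suc j0 \<longrightarrow> dn (w(i := flip True s)) m j < dn (w(i := flip False s)) m j)"
proof (induction j)
  case (Suc j)
  let ?T = "w(i := flip True s)" and ?F = "w(i := flip False s)"
  have g: "good (\<lambda>j. arr s (Suc j))"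
  proof -
    have "case_nat (arr s 0) (\<lambda>j. arr s (Suc j)) = arr s" by (auto simp: fun_eq_iff split: nat.split)
    then show ?thesis using good good_Cons[of "arr s 0" "\<lambda>j. arr s (Suc j)"] by simp
  qed
  show ?case
  proof (cases "j = j0")
    case True
    have "dn ?T m j = dn ?F m j" using i True by (intro dn_cong) auto
    then have "dn ?T m (Suc j) < dn ?F m (Suc j)"
      using i True zeros_before_flip[OF g, of "Suc (dn ?F m j)"] by (simp add: arr_flip)
    then show ?thesis using less_imp_le by blast
  next
    case False
    then have T: "?T (m - 1 - int j) = w (m - 1 - int j)" and F: "?F (m - 1 - int j) = w (m - 1 - int j)"
      using i by auto
    have "dn ?T m j \<le> dn ?F m j" using Suc by blast
    then have "dn ?T m (Suc j) \<le> dn ?F m (Suc j)"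
      unfolding dn.simps T F by (intro zeros_before_mono Suc_le_mono[THEN iffD2])
    then show ?thesis using False by blast
  qed
qed simp

lemma Bn_flip:
  assumes "good (arr s)" "x < n"
  shows "1 + Bn n (w(int x := flip True s)) \<le> Bn n (w(int x := flip False s))"
proof -
  let ?T = "w(int x := flip True s)" and ?F = "w(int x := flip False s)"
  have i: "int x = int n - 1 - int (n - 1 - x)" using assms by simp
  have le: "D n y ?T + (if y = x then 1 else 0) \<le> D n y ?F" if "y < n" for y
  proof -
    note d = dn_flip[OF assms(1) i, of w "n - y"]
    show ?thesis
    proof (cases "y = x")
      case True
      then have "n - y = Suc (n - 1 - x)" using assms by simp
      then show ?thesis using d True unfolding D_def by auto
    next
      case False
      then show ?thesis using d unfolding D_def by simp
    qed
  qed
  have "Bn n ?T + 1 = (\<Sum>y<n. D n y ?T + (if y = x then 1 else 0))"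
    unfolding Bn_def sum.distrib using assms by simp
  also have "\<dots> \<le> Bn n ?F" unfolding Bn_def using le by (intro sum_mono) auto
  finally show ?thesis by simp
qed

section \<open>Change of measure at one site\<close>

lemma nn_integral_flip_site:
  assumes [measurable]: "g \<in> borel_measurable P"
  shows "(\<integral>\<^sup>+w. g (w(i := flip b (w i))) \<partial>P) = (\<integral>\<^sup>+w. ennreal (\<phi> b (w i)) * g w \<partial>P)"
proof -
  note [measurable] = coord_measurable
  have upd: "(\<lambda>s. w(i := s)) \<in> measurable Q P" for w
    unfolding P_def by (rule measurable_into_PiM[OF space_Q]) (auto simp: fun_upd_def space_Q)
  have updf: "(\<lambda>w. w(i := flip b (w i))) \<in> measurable P P"
    unfolding P_def
  proof (rule measurable_into_PiM[OF space_Q])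
    fix k show "(\<lambda>w. (w(i := flip b (w i))) k) \<in> measurable (PiM UNIV (\<lambda>_. Q)) Q"
      using measurable_compose[OF measurable_PiM_coord flip_measurable] measurable_PiM_coord
      by (cases "k = i") auto
  qed
  have [measurable]: "(\<lambda>w. \<phi> b (w i)) \<in> borel_measurable P"
    by (rule measurable_compose[OF coord_measurable \<phi>_measurable])
  have "(\<integral>\<^sup>+w. g (w(i := flip b (w i))) \<partial>P) = (\<integral>\<^sup>+w. \<integral>\<^sup>+s. g (w(i := flip b s)) \<partial>Q \<partial>P)"
    using measurable_compose[OF updf assms] by (subst nn_integral_resample[where i = i]) auto
  also have "\<dots> = (\<integral>\<^sup>+w. \<integral>\<^sup>+s. ennreal (\<phi> b s) * g (w(i := s)) \<partial>Q \<partial>P)"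
    using measurable_compose[OF upd assms] by (intro nn_integral_cong flip_density)
  also have "\<dots> = (\<integral>\<^sup>+w. ennreal (\<phi> b (w i)) * g w \<partial>P)"
    by (subst (2) nn_integral_resample[where i = i]) auto
  finally show ?thesis .
qed

text \<open>Plays the role of a score: bounded, of mean zero, and correlated with the count
  \<open>Bn n\<close> by at least one at every site below \<open>n\<close>.\<close>

definition \<psi> :: "'s \<Rightarrow> real" where "\<psi> s = \<phi> False s - \<phi> True s"

lemma \<phi>_coord_measurable [measurable]: "(\<lambda>w. \<phi> b (w i)) \<in> borel_measurable P"
  by (rule measurable_compose[OF coord_measurable \<phi>_measurable])

lemma sq_int_\<phi>: "sq_int P (\<lambda>w. \<phi> b (w i))"
  using \<phi>_bounds by (intro P.sq_int_bounded[where B = B]) auto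

lemma sq_int_\<psi>: "sq_int P (\<lambda>w. \<psi> (w i))"
  unfolding \<psi>_def by (intro sq_int_diff sq_int_\<phi>)

lemma \<psi>_abs: "\<bar>\<psi> s\<bar> \<le> B"
  using \<phi>_bounds[of True s] \<phi>_bounds[of False s] by (auto simp: \<psi>_def abs_le_iff)

lemma B_nonneg: "0 \<le> B"
  using \<psi>_abs[of undefined] by linarith

lemma expectation_\<psi>: "P.expectation (\<lambda>w. \<psi> (w i)) = 0"
proof -
  have "P.expectation (\<lambda>w. \<phi> b (w i)) = 1" for b
  proof -
    have "ennreal (P.expectation (\<lambda>w. \<phi> b (w i))) = (\<integral>\<^sup>+w. ennreal (\<phi> b (w i)) * 1 \<partial>P)"
      using \<phi>_bounds P.sq_int_integrable[OF sq_int_\<phi>] by (subst nn_integral_eq_integral[symmetric]) auto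
    also have "\<dots> = (\<integral>\<^sup>+w. 1 \<partial>P)"
      by (subst nn_integral_flip_site[symmetric, where g = "\<lambda>_. 1"]) auto
    also have "\<dots> = ennreal 1" by (simp add: P.emeasure_space_1)
    finally show ?thesis using \<phi>_bounds by (subst (asm) ennreal_inj) (auto intro!: integral_nonneg_AE)
  qed
  then show ?thesis unfolding \<psi>_def by (simp add: P.sq_int_integrable[OF sq_int_\<phi>])
qed

text \<open>Weighting by \<open>\<phi> b\<close> is the same as flipping the first arrow at the site
  to \<open>b\<close>, so the expectation is the mean gain from flipping right to left, and this
  gain is almost surely at least one.\<close>

lemma expectation_Bn_\<psi>:
  assumes x: "x < n"
  shows "1 \<le> P.expectation (\<lambda>w. Bn n w * \<psi> (w (int x)))"
proof -
  let ?g = "\<lambda>b w. Bn n (w(int x := flip b (w (int x))))"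
  have int: "integrable P (\<lambda>w. \<phi> b (w (int x)) * Bn n w)" for b
    by (intro sq_int_mult_integrable sq_int_\<phi> sq_int_Bn)
  have eq: "(\<integral>\<^sup>+w. ennreal (?g b w) \<partial>P) = ennreal (P.expectation (\<lambda>w. \<phi> b (w (int x)) * Bn n w))" for b
    using nn_integral_flip_site[of "\<lambda>w. ennreal (Bn n w)" "int x" b] int[of b] \<phi>_bounds Bn_nonneg
    by (subst nn_integral_eq_integral[symmetric]) (auto simp: ennreal_mult)
  have good: "AE w in P. good (arr (w (int x)))"
    unfolding P_def using AE_PiM_component[of UNIV "\<lambda>_. Q" "int x"] Q.prob_space_axioms good_arr by simp
  have "ennreal (1 + P.expectation (\<lambda>w. \<phi> True (w (int x)) * Bn n w)) = 1 + (\<integral>\<^sup>+w. ennreal (?g True w) \<partial>P)"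
    unfolding eq using \<phi>_bounds Bn_nonneg by (subst ennreal_plus) (auto intro!: integral_nonneg_AE)
  also have "\<dots> = (\<integral>\<^sup>+w. 1 + ennreal (?g True w) \<partial>P)"
  proof -
    have "(\<lambda>w. w(int x := flip True (w (int x)))) \<in> measurable P P"
      unfolding P_def
    proof (rule measurable_into_PiM[OF space_Q])
      fix k show "(\<lambda>w. (w(int x := flip True (w (int x)))) k) \<in> measurable (PiM UNIV (\<lambda>_. Q)) Q"
        using measurable_compose[OF measurable_PiM_coord flip_measurable] measurable_PiM_coord
        by (cases "k = int x") auto
    qed
    from measurable_compose[OF this Bn_measurable[of n]] have "?g True \<in> borel_measurable P" .
    then show ?thesis by (subst nn_integral_add) (auto simp: P.emeasure_space_1)
  qed
  also have "\<dots> \<le> (\<integral>\<^sup>+w. ennreal (?g False w) \<partial>P)"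
  proof (rule nn_integral_mono_AE, use good in eventually_elim)
    fix w assume "good (arr (w (int x)))"
    from Bn_flip[OF this x, of w] show "1 + ennreal (?g True w) \<le> ennreal (?g False w)"
      using ennreal_leI[of "1 + ?g True w" "?g False w"] Bn_nonneg by simp
  qed
  also have "\<dots> = ennreal (P.expectation (\<lambda>w. \<phi> False (w (int x)) * Bn n w))" by (rule eq)
  finally have "1 + P.expectation (\<lambda>w. \<phi> True (w (int x)) * Bn n w) \<le> P.expectation (\<lambda>w. \<phi> False (w (int x)) * Bn n w)"
    using \<phi>_bounds Bn_nonneg by (subst (asm) ennreal_le_iff) (auto intro!: integral_nonneg_AE)
  moreover have "P.expectation (\<lambda>w. Bn n w * \<psi> (w (int x))) =
      P.expectation (\<lambda>w. \<phi> False (w (int x)) * Bn n w) - P.expectation (\<lambda>w. \<phi> True (w (int x)) * Bn n w)"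
    using int[of True] int[of False] by (simp add: \<psi>_def algebra_simps)
  ultimately show ?thesis by simp
qed

text \<open>The scores at different sites are independent and centred, so their sum has second
  moment at most \<open>n * B\<^sup>2\<close>, while its covariance with the count is at least
  \<open>n\<close>. Cauchy-Schwarz then gives a variance of order \<open>n\<close>.\<close>

lemma variance_Bn_ge: "real n \<le> B\<^sup>2 * (L2n P (cB n))\<^sup>2"
proof (cases "n = 0")
  case False
  let ?\<Phi> = "\<lambda>w. \<Sum>x<n. \<psi> (w (int x))"
  have sq: "sq_int P ?\<Phi>" by (intro sq_int_sum sq_int_\<psi>) auto
  have E0: "P.expectation ?\<Phi> = 0"
    using P.sq_int_integrable[OF sq_int_\<psi>] by (simp add: expectation_\<psi>)
  have "(L2n P ?\<Phi>)\<^sup>2 = (\<Sum>x<n. \<Sum>y<n. P.expectation (\<lambda>w. \<psi> (w (int x)) * \<psi> (w (int y))) - 0)"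
    using P.L2n_centered_sum_sq[of "{..<n}" "\<lambda>x w. \<psi> (w (int x))"] E0 sq_int_\<psi> by (simp add: expectation_\<psi>)
  also have "\<dots> \<le> (\<Sum>x<n. \<Sum>y<n. if x = y then B\<^sup>2 else 0)"
  proof (intro sum_mono)
    fix x y
    show "P.expectation (\<lambda>w. \<psi> (w (int x)) * \<psi> (w (int y))) - 0 \<le> (if x = y then B\<^sup>2 else 0)"
    proof (cases "x = y")
      case True
      have "P.expectation (\<lambda>w. (\<psi> (w (int x)))\<^sup>2) \<le> P.expectation (\<lambda>w. B\<^sup>2)"
        using sq_int_\<psi> \<psi>_abs B_nonneg by (intro integral_mono) (auto simp: sq_int_def abs_le_square_iff[symmetric])
      then show ?thesis using True by (simp add: power2_eq_square P.prob_space)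
    next
      case False
      have "P.expectation (\<lambda>w. \<psi> (w (int x)) * \<psi> (w (int y))) = P.expectation (\<lambda>w. \<psi> (w (int x))) * P.expectation (\<lambda>w. \<psi> (w (int y)))"
        using False by (intro expectation_indep[of _ _ "{int x}" "{int y}"] sq_int_\<psi>) auto
      then show ?thesis using False by (simp add: expectation_\<psi>)
    qed
  qed
  also have "\<dots> = real n * B\<^sup>2" by simp
  finally have \<Phi>: "L2n P ?\<Phi> \<le> sqrt (real n * B\<^sup>2)"
    by (intro real_le_rsqrt)
  have "real n \<le> (\<Sum>x<n. P.expectation (\<lambda>w. Bn n w * \<psi> (w (int x))))"
    using sum_mono[of "{..<n}" "\<lambda>_. 1::real"] expectation_Bn_\<psi> by simp
  also have "\<dots> = P.expectation (\<lambda>w. \<Sum>x<n. Bn n w * \<psi> (w (int x)))"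
    using sq_int_mult_integrable[OF sq_int_Bn sq_int_\<psi>] by (subst Bochner_Integration.integral_sum) auto
  also have "\<dots> = P.expectation (\<lambda>w. Bn n w * ?\<Phi> w)" by (simp add: sum_distrib_left)
  also have "\<dots> = P.expectation (\<lambda>w. cB n w * ?\<Phi> w)"
    using P.covariance_centered[OF sq_int_Bn sq, of n] unfolding E0 by (simp add: cB_def)
  also have "\<dots> \<le> L2n P (cB n) * L2n P ?\<Phi>" using L2n_mult_le[OF sq_int_cB sq, of n] by linarith
  also have "\<dots> \<le> L2n P (cB n) * sqrt (real n * B\<^sup>2)" by (intro mult_left_mono \<Phi> L2n_nonneg)
  finally have le: "real n \<le> L2n P (cB n) * sqrt (real n * B\<^sup>2)" .
  have "real n * real n \<le> (L2n P (cB n) * sqrt (real n * B\<^sup>2))\<^sup>2"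
    using power_mono[OF le, of 2] by (simp only: power2_eq_square[of "real n"])
  also have "\<dots> = real n * (B\<^sup>2 * (L2n P (cB n))\<^sup>2)"
    by (simp add: power_mult_distrib algebra_simps)
  finally show ?thesis using False by (simp add: mult_le_cancel_left)
qed simp

section \<open>Mean number of left steps per site\<close>

definition d :: "nat \<Rightarrow> real" where "d j = P.expectation (D j 0)"

lemma expectation_D: "x \<le> n \<Longrightarrow> P.expectation (D n x) = d (n - x)"
proof -
  assume x: "x \<le> n"
  have "d (n - x) = (\<integral>w. D (n - x) 0 w \<partial>distr P P (\<lambda>w i. w (i + int x)))"
    by (simp add: distr_shift d_def)
  also have "\<dots> = P.expectation (\<lambda>w. D (n - x) 0 (\<lambda>i. w (i + int x)))"
    by (rule integral_distr[OF shift_measurable]) simp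
  also have "\<dots> = P.expectation (D n x)"
  proof -
    have "D n x = (\<lambda>w. D (n - x) 0 (\<lambda>i. w (i + int x)))"
      using D_shift[of 0 "n - x" x] x by (intro ext) simp
    then show ?thesis by simp
  qed
  finally show ?thesis by simp
qed

lemma d_diff: "0 \<le> d (j + i) - d j" "d (j + i) - d j \<le> sqrt CV * q ^ j"
proof -
  have eq: "d (j + i) - d j = P.expectation (\<lambda>w. D (j + i) 0 w - D j 0 w)"
    unfolding d_def using P.sq_int_integrable[OF sq_int_D] by simp
  show "0 \<le> d (j + i) - d j"
    unfolding eq using D_mono[of 0 j "j + i"] by (intro integral_nonneg_AE) auto
  have "d (j + i) - d j \<le> P.expectation (\<lambda>w. \<bar>D (j + i) 0 w - D j 0 w\<bar>)"
    unfolding eq using integral_abs_bound[of P "\<lambda>w. D (j + i) 0 w - D j 0 w"] by linarith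
  also have "\<dots> \<le> L2n P (\<lambda>w. D (j + i) 0 w - D j 0 w)"
    by (intro P.expectation_abs_le_L2n sq_int_diff sq_int_D)
  also have "\<dots> \<le> sqrt CV * q ^ j" using L2n_D_diff[of 0 j "j + i"] by simp
  finally show "d (j + i) - d j \<le> sqrt CV * q ^ j" .
qed

definition dinf :: real where "dinf = lim d"

lemma d_lim: "d \<longlonglongrightarrow> dinf"
proof -
  have "incseq d" using d_diff(1)[of _ 1] by (intro incseq_SucI) (simp add: algebra_simps)
  moreover have "d j \<le> d 0 + sqrt CV" for j using d_diff(2)[of 0 j] by simp
  ultimately obtain l where "d \<longlonglongrightarrow> l" using incseq_convergent[of d "d 0 + sqrt CV"] by blast
  then show ?thesis unfolding dinf_def by (simp add: limI)
qed

lemma dinf_bounds: "d j \<le> dinf" "dinf - d j \<le> sqrt CV * q ^ j" "0 \<le> dinf"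
proof -
  have "(\<lambda>i. d (j + i)) \<longlonglongrightarrow> dinf" for j using LIMSEQ_ignore_initial_segment[OF d_lim, of j] by (simp add: add.commute)
  then have l: "(\<lambda>i. d (j + i) - d j) \<longlonglongrightarrow> dinf - d j" for j by (intro tendsto_intros)
  show le: "d j \<le> dinf" for j using LIMSEQ_le_const[OF l, of 0 j] d_diff(1)[of j] by auto
  show "dinf - d j \<le> sqrt CV * q ^ j" using LIMSEQ_le_const2[OF l, of j] d_diff(2)[of j] by auto
  show "0 \<le> dinf" using le[of 0] by (simp add: d_def D_def[abs_def])
qed

text \<open>Only sites near the level feel that the chain has just started, and their deficits form
  a geometric series. Centring by \<open>n * dinf\<close> in place of the mean therefore shifts the
  count by a bounded amount, negligible on the scale \<open>sqrt n\<close>.\<close>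

lemma expectation_Bn: "\<bar>P.expectation (Bn n) - real n * dinf\<bar> \<le> sqrt CV / (1 - q)"
proof -
  have "P.expectation (Bn n) = (\<Sum>x<n. d (n - x))"
    unfolding Bn_def[abs_def] using P.sq_int_integrable[OF sq_int_D]
    by (subst Bochner_Integration.integral_sum) (auto simp: expectation_D)
  then have eq: "real n * dinf - P.expectation (Bn n) = (\<Sum>x<n. dinf - d (n - x))"
    by (simp add: sum_subtractf)
  have "(\<Sum>x<n. dinf - d (n - x)) \<le> (\<Sum>x<n. sqrt CV * q ^ (n - x))"
    by (intro sum_mono dinf_bounds)
  also have "\<dots> \<le> (\<Sum>x\<le>n. sqrt CV * q ^ (n - x))"
    using q CV_nonneg by (intro sum_mono2) auto
  also have "\<dots> \<le> sqrt CV * (1 / (1 - q))"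
    unfolding sum_distrib_left[symmetric] using CV_nonneg by (intro mult_left_mono sum_power_diff_le) auto
  finally have "(\<Sum>x<n. dinf - d (n - x)) \<le> sqrt CV / (1 - q)" by simp
  moreover have "0 \<le> (\<Sum>x<n. dinf - d (n - x))" using dinf_bounds(1) by (intro sum_nonneg) auto
  ultimately show ?thesis using eq by linarith
qed

end

section \<open>Central limit theorem for the number of left steps\<close>

lemma tendsto_div_nat:
  assumes "0 < (L::nat)"
  shows "(\<lambda>n. real (n div L) / real n) \<longlonglongrightarrow> 1 / real L" "filterlim (\<lambda>n. n div L) at_top sequentially"
proof -
  have b: "real n / L - 1 \<le> real (n div L)" "real (n div L) \<le> real n / L" for n
  proof -
    have "real (n div L) = of_int \<lfloor>real n / real L\<rfloor>" by (simp add: floor_divide_of_nat_eq)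
    then show "real n / L - 1 \<le> real (n div L)" "real (n div L) \<le> real n / L" by linarith+
  qed
  show "(\<lambda>n. real (n div L) / real n) \<longlonglongrightarrow> 1 / real L"
  proof (rule tendsto_sandwich)
    show "eventually (\<lambda>n. 1 / real L - 1 / real n \<le> real (n div L) / real n) sequentially"
      using eventually_gt_at_top[of 0]
    proof eventually_elim
      case (elim n)
      have "1 / real L - 1 / real n = (real n / L - 1) / real n" using elim by (simp add: field_simps)
      also have "\<dots> \<le> real (n div L) / real n" using b(1)[of n] by (intro divide_right_mono) auto
      finally show ?case .
    qed
    show "eventually (\<lambda>n. real (n div L) / real n \<le> 1 / real L) sequentially"
      using eventually_gt_at_top[of 0]
    proof eventually_elim
      case (elim n)
      have "real (n div L) / real n \<le> (real n / L) / real n" using b(2)[of n] by (intro divide_right_mono) auto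
      also have "\<dots> = 1 / real L" using elim by simp
      finally show ?case .
    qed
    have "(\<lambda>n. 1 / real L - 1 / real n) \<longlonglongrightarrow> 1 / real L - 0" by (intro tendsto_intros lim_1_over_n)
    then show "(\<lambda>n. 1 / real L - 1 / real n) \<longlonglongrightarrow> 1 / real L" by simp
  qed simp
  show "filterlim (\<lambda>n. n div L) at_top sequentially"
    unfolding filterlim_at_top
  proof
    fix k show "eventually (\<lambda>n. k \<le> n div L) sequentially"
      using eventually_ge_at_top[of "k * L"]
    proof eventually_elim
      case (elim n)
      then have "k * L div L \<le> n div L" by (rule div_le_mono)
      then show ?case using assms by simp
    qed
  qed
qed

lemma norm_iexp_diff_le: "cmod (iexp x - iexp y) \<le> \<bar>x - y\<bar>"
proof -
  have "cmod (iexp x - iexp y) = cmod (iexp y * (iexp (x - y) - 1))"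
    by (simp add: algebra_simps flip: exp_add)
  also have "\<dots> = cmod (iexp (x - y) - 1)" by (simp add: norm_mult)
  also have "\<dots> \<le> \<bar>x - y\<bar>" using iexp_approx1[of "x - y" 0] by simp
  finally show ?thesis .
qed

text \<open>Characteristic functions are Lipschitz with respect to the mean absolute difference, so
  the later approximations reduce to estimates in mean or in mean square.\<close>

lemma (in prob_space) char_diff_le:
  assumes [measurable]: "f \<in> borel_measurable M" "g \<in> borel_measurable M" and int: "integrable M (\<lambda>x. f x - g x)"
  shows "cmod (char (distr M borel f) t - char (distr M borel g) t) \<le> \<bar>t\<bar> * expectation (\<lambda>x. \<bar>f x - g x\<bar>)"
proof -
  have i: "integrable M (\<lambda>x. iexp (t * h x))" if [measurable]: "h \<in> borel_measurable M" for h
    by (rule integrable_const_bound[where B = 1]) auto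
  have c: "char (distr M borel h) t = (\<integral>x. iexp (t * h x) \<partial>M)" if [measurable]: "h \<in> borel_measurable M" for h
    unfolding char_def by (subst integral_distr) auto
  have "cmod (char (distr M borel f) t - char (distr M borel g) t) = cmod (\<integral>x. iexp (t * f x) - iexp (t * g x) \<partial>M)"
    unfolding c[OF assms(1)] c[OF assms(2)] by (subst Bochner_Integration.integral_diff[OF i i]) auto
  also have "\<dots> \<le> (\<integral>x. cmod (iexp (t * f x) - iexp (t * g x)) \<partial>M)"
    by (rule integral_norm_bound)
  also have "\<dots> \<le> (\<integral>x. \<bar>t\<bar> * \<bar>f x - g x\<bar> \<partial>M)"
  proof (rule integral_mono)
    show "integrable M (\<lambda>x. cmod (iexp (t * f x) - iexp (t * g x)))" using i by (intro integrable_norm Bochner_Integration.integrable_diff) auto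
    show "integrable M (\<lambda>x. \<bar>t\<bar> * \<bar>f x - g x\<bar>)" using int by auto
    show "cmod (iexp (t * f x) - iexp (t * g x)) \<le> \<bar>t\<bar> * \<bar>f x - g x\<bar>" for x
      using norm_iexp_diff_le[of "t * f x" "t * g x"] by (simp add: abs_mult right_diff_distrib[symmetric])
  qed
  finally show ?thesis by simp
qed

context stack_law
begin

definition K2 :: real where "K2 = K1 / (1 - q)"

definition an :: "nat \<Rightarrow> real" where "an n = L2n P (cB n) / sqrt (real n)"

lemma B_pos: "0 < B"
  using variance_Bn_ge[of 1] B_nonneg by (cases "B = 0") auto

lemma an_ge: "0 < n \<Longrightarrow> 1 / B \<le> an n"
proof -
  assume n: "0 < n"
  have "sqrt (real n) \<le> sqrt (B\<^sup>2 * (L2n P (cB n))\<^sup>2)" by (intro real_sqrt_le_mono variance_Bn_ge)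
  also have "\<dots> = B * L2n P (cB n)" using B_pos by (simp add: real_sqrt_mult L2n_nonneg)
  finally show ?thesis using n B_pos by (simp add: an_def field_simps)
qed

lemma L2n_cB: "L2n P (cB n) = sqrt (real n) * an n" if "0 < n"
  using that by (simp add: an_def)

lemma block_L2n:
  assumes "0 < L" shows "L2n P (\<lambda>w. cB n w - (\<Sum>i<n div L. cblk L i w)) \<le> sqrt (K2 * (real (n div L) + real L))"
  using block_approx[OF assms, of n] by (intro real_le_rsqrt) (simp add: K2_def)

lemma sq_int_sum_cblk: "sq_int P (\<lambda>w. \<Sum>i<k. cblk L i w)"
  by (intro sq_int_sum sq_int_cblk) auto

lemma L2n_sum_cblk': "L2n P (\<lambda>w. \<Sum>i<k. cblk L i w) = sqrt (real k) * L2n P (cB L)"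
  using L2n_sum_cblk[where k = k and L = L] L2n_nonneg
  by (metis real_sqrt_unique real_sqrt_mult real_sqrt_abs abs_of_nonneg)

lemma err_tendsto:
  assumes L: "0 < L"
  shows "(\<lambda>n. sqrt (K2 * (real (n div L) + real L)) / sqrt (real n)) \<longlonglongrightarrow> sqrt (K2 / real L)"
proof -
  have "(\<lambda>n. sqrt (K2 * (real (n div L) / real n + real L * (1 / real n)))) \<longlonglongrightarrow> sqrt (K2 * (1 / real L + real L * 0))"
    by (intro tendsto_intros tendsto_div_nat L lim_1_over_n)
  then show ?thesis
    by (simp add: real_sqrt_divide[symmetric] add_divide_distrib[symmetric])
qed

lemma ratio_tendsto:
  assumes L: "0 < L"
  shows "(\<lambda>n. sqrt (real (n div L) * real L) / sqrt (real n)) \<longlonglongrightarrow> 1"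
proof -
  have "(\<lambda>n. sqrt (real (n div L) / real n * real L)) \<longlonglongrightarrow> sqrt (1 / real L * real L)"
    by (intro tendsto_intros tendsto_div_nat L)
  then show ?thesis
    using L by (simp add: real_sqrt_divide[symmetric])
qed

text \<open>Triangle inequality in mean square: the centred count differs from the sum of the block
  variables by the restart error, and independence makes the norm of that sum \<open>sqrt k\<close>
  times the norm for one block. After division by \<open>sqrt n\<close> the error tends to
  \<open>sqrt (K2 / L)\<close>.\<close>

lemma an_approx:
  assumes L: "0 < L" and "0 < \<epsilon>"
  shows "eventually (\<lambda>n. \<bar>an n - an L\<bar> < sqrt (K2 / real L) + \<epsilon>) sequentially"
proof -
  have "(\<lambda>n. sqrt (K2 * (real (n div L) + real L)) / sqrt (real n) + \<bar>sqrt (real (n div L) * real L) / sqrt (real n) - 1\<bar> * an L)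
     \<longlonglongrightarrow> sqrt (K2 / real L) + \<bar>1 - 1\<bar> * an L"
    by (intro tendsto_intros err_tendsto ratio_tendsto L)
  then have "eventually (\<lambda>n. sqrt (K2 * (real (n div L) + real L)) / sqrt (real n) + \<bar>sqrt (real (n div L) * real L) / sqrt (real n) - 1\<bar> * an L
     < sqrt (K2 / real L) + \<epsilon>) sequentially"
    using \<open>0 < \<epsilon>\<close> by (intro order_tendstoD) auto
  then show ?thesis
    using eventually_gt_at_top[of 0]
  proof eventually_elim
    case (elim n)
    let ?r = "sqrt (real (n div L) * real L) / sqrt (real n)"
    have "\<bar>L2n P (cB n) - sqrt (real (n div L)) * L2n P (cB L)\<bar> \<le> sqrt (K2 * (real (n div L) + real L))"
      using L2n_diff_abs_le[OF sq_int_cB sq_int_sum_cblk, of n L "n div L"] block_L2n[OF L, of n]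
      unfolding L2n_sum_cblk' by linarith
    then have "\<bar>L2n P (cB n) - sqrt (real (n div L)) * L2n P (cB L)\<bar> / sqrt (real n) \<le> sqrt (K2 * (real (n div L) + real L)) / sqrt (real n)"
      by (intro divide_right_mono) auto
    also have "\<bar>L2n P (cB n) - sqrt (real (n div L)) * L2n P (cB L)\<bar> / sqrt (real n)
      = \<bar>(L2n P (cB n) - sqrt (real (n div L)) * L2n P (cB L)) / sqrt (real n)\<bar>" by simp
    also have "(L2n P (cB n) - sqrt (real (n div L)) * L2n P (cB L)) / sqrt (real n) = an n - ?r * an L"
      using L by (simp add: an_def[of n] L2n_cB[of L] diff_divide_distrib real_sqrt_mult)
    finally have 1: "\<bar>an n - ?r * an L\<bar> \<le> sqrt (K2 * (real (n div L) + real L)) / sqrt (real n)" .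
    have "an L \<ge> 0" by (simp add: an_def L2n_nonneg)
    then have "\<bar>?r * an L - an L\<bar> = \<bar>?r - 1\<bar> * an L"
      by (metis abs_mult abs_of_nonneg left_diff_distrib mult_1)
    with 1 elim show ?case by linarith
  qed
qed

lemma small_err: "0 < \<epsilon> \<Longrightarrow> \<exists>L0>0. \<forall>L\<ge>L0. sqrt (K2 / real L) < \<epsilon>"
proof -
  assume "0 < \<epsilon>"
  have "(\<lambda>L. sqrt (K2 * (1 / real L))) \<longlonglongrightarrow> sqrt (K2 * 0)" by (intro tendsto_intros lim_1_over_n)
  then have "eventually (\<lambda>L. sqrt (K2 / real L) < \<epsilon>) sequentially"
    using \<open>0 < \<epsilon>\<close> by (intro order_tendstoD(2)[of _ "sqrt (K2 * 0)"]) auto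
  then obtain L0 where "\<forall>L\<ge>L0. sqrt (K2 / real L) < \<epsilon>" unfolding eventually_sequentially by blast
  then show ?thesis by (intro exI[of _ "max 1 L0"]) auto
qed

definition \<sigma> :: real where "\<sigma> = lim an"

text \<open>For fixed \<open>L\<close> all late values lie within about \<open>sqrt (K2 / L)\<close>
  of \<open>an L\<close>; taking \<open>L\<close> large makes the sequence Cauchy.\<close>

lemma an_lim: "an \<longlonglongrightarrow> \<sigma>"
proof -
  have "Cauchy an"
  proof (rule metric_CauchyI)
    fix e :: real assume e: "0 < e"
    obtain L where L: "0 < L" "sqrt (K2 / real L) < e / 4" using small_err[of "e/4"] e by auto
    obtain M where M: "\<And>n. n \<ge> M \<Longrightarrow> \<bar>an n - an L\<bar> < sqrt (K2 / real L) + e / 4"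
      using an_approx[OF L(1), of "e/4"] e unfolding eventually_sequentially by auto
    show "\<exists>M. \<forall>m\<ge>M. \<forall>n\<ge>M. dist (an m) (an n) < e"
    proof (intro exI allI impI)
      fix m n assume "M \<le> m" "M \<le> n"
      with M[of m] M[of n] L show "dist (an m) (an n) < e" unfolding dist_real_def by linarith
    qed
  qed
  then show ?thesis unfolding \<sigma>_def by (simp add: real_Cauchy_convergent convergent_LIMSEQ_iff[symmetric])
qed

lemma \<sigma>_pos: "0 < \<sigma>"
proof -
  have "1 / B \<le> \<sigma>" using LIMSEQ_le_const[OF an_lim, of "1 / B"] an_ge by (meson less_le_trans zero_less_one not_less_eq_eq One_nat_def Suc_le_eq)
  then show ?thesis using B_pos by (meson divide_pos_pos less_le_trans zero_less_one)
qed

lemma block_clt: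
  assumes L: "0 < L"
  shows "(\<lambda>k. char (distr P borel (\<lambda>w. (\<Sum>i<k. cblk L i w) / sqrt (real k * (L2n P (cB L))\<^sup>2))) t)
     \<longlonglongrightarrow> complex_of_real (exp (- (t\<^sup>2) / 2))"
proof -
  have pos: "0 < L2n P (cB L)" using L2n_cB[of L] an_ge[of L] L B_pos
    by (metis L2n_nonneg less_eq_real_def mult_eq_0_iff not_less of_nat_0_less_iff real_sqrt_gt_0_iff zero_less_divide_1_iff order.strict_trans2)
  have W: "weak_conv_m (\<lambda>k. distr P borel (\<lambda>w. (\<Sum>i<k. cblk L i w) / sqrt (real k * (L2n P (cB L))\<^sup>2))) std_normal_distribution"
  proof (rule P.central_limit_theorem_zero_mean[OF indep_cblk expectation_cblk pos, where \<mu> = "distr P borel (cblk L 0)"])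
    show "integrable P (\<lambda>x. (cblk L n x)\<^sup>2)" for n using sq_int_cblk by (auto simp: sq_int_def)
    show "P.variance (cblk L n) = (L2n P (cB L))\<^sup>2" for n
      using L2n_cblk[of L n] by (simp add: expectation_cblk L2n_sq[symmetric])
    show "distr P borel (cblk L n) = distr P borel (cblk L 0)" for n
    proof -
      have "distr P borel (cblk L i) = distr (distr P borel (blk L i)) borel (\<lambda>x. x - P.expectation (Bn L))" for i
        by (subst distr_distr) (auto simp: comp_def cblk_def[abs_def])
      then show ?thesis by (simp add: distr_blk)
    qed
  qed
  have "(\<lambda>k. char (distr P borel (\<lambda>w. (\<Sum>i<k. cblk L i w) / sqrt (real k * (L2n P (cB L))\<^sup>2))) t) \<longlonglongrightarrow> char std_normal_distribution t"
  proof (rule levy_continuity1[OF _ _ W])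
    show "real_distribution (distr P borel (\<lambda>w. (\<Sum>i<n. cblk L i w) / sqrt (real n * (L2n P (cB L))\<^sup>2)))" for n
      by (intro P.real_distribution_distr) measurable
    show "real_distribution std_normal_distribution" by (rule real_dist_normal_dist)
  qed
  then show ?thesis by (simp add: char_std_normal_distribution)
qed

text \<open>Two errors are kept apart: the restart error, and the mismatch between the norm of the
  block sum and \<open>\<sigma> * sqrt n\<close>. Evaluation at \<open>\<sigma> * t\<close> absorbs
  the scale of the limit into the argument.\<close>

lemma char_cB_diff:
  assumes L: "0 < L" and n: "0 < n" and k: "0 < n div L"
  shows "cmod (char (distr P borel (\<lambda>w. cB n w / sqrt (real n))) t
     - char (distr P borel (\<lambda>w. (\<Sum>i<n div L. cblk L i w) / sqrt (real (n div L) * (L2n P (cB L))\<^sup>2))) (\<sigma> * t))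
    \<le> \<bar>t\<bar> * (sqrt (K2 * (real (n div L) + real L)) / sqrt (real n) + \<bar>sqrt (real (n div L) * real L) / sqrt (real n) * an L - \<sigma>\<bar>)"
proof -
  define k where "k = n div L"
  define s where "s = L2n P (cB L)"
  have s: "0 < s" unfolding s_def using L2n_cB[of L] an_ge[of L] L B_pos
    by (metis L2n_nonneg less_eq_real_def mult_eq_0_iff not_less of_nat_0_less_iff real_sqrt_gt_0_iff zero_less_divide_1_iff order.strict_trans2)
  have kpos: "0 < real k" using assms by (simp add: k_def)
  let ?S = "\<lambda>w. \<Sum>i<k. cblk L i w"
  let ?f = "\<lambda>w. cB n w / sqrt (real n)" and ?g = "\<lambda>w. \<sigma> * (?S w / sqrt (real k * s\<^sup>2))"
  have sf: "sq_int P ?f" using sq_int_cmult[OF sq_int_cB, of "1 / sqrt (real n)" n] by simp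
  have sg: "sq_int P ?g" using sq_int_cmult[OF sq_int_sum_cblk, of "\<sigma> / sqrt (real k * s\<^sup>2)" L k] by simp
  have ceq: "char (distr P borel (\<lambda>w. ?S w / sqrt (real k * s\<^sup>2))) (\<sigma> * t) = char (distr P borel ?g) t"
    unfolding char_def by (subst (1 2) integral_distr) (auto simp: algebra_simps)
  have "P.expectation (\<lambda>w. \<bar>?f w - ?g w\<bar>) \<le> L2n P (\<lambda>w. ?f w - ?g w)"
    using sf sg by (intro P.expectation_abs_le_L2n sq_int_diff)
  also have "L2n P (\<lambda>w. ?f w - ?g w) = L2n P (\<lambda>w. 1 / sqrt (real n) * (cB n w - ?S w) + (1 / sqrt (real n) - \<sigma> / sqrt (real k * s\<^sup>2)) * ?S w)"
    by (intro arg_cong[where f = "L2n P"]) (auto simp: fun_eq_iff algebra_simps)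
  also have "\<dots> \<le> L2n P (\<lambda>w. 1 / sqrt (real n) * (cB n w - ?S w)) + L2n P (\<lambda>w. (1 / sqrt (real n) - \<sigma> / sqrt (real k * s\<^sup>2)) * ?S w)"
    by (intro L2n_add_le sq_int_cmult sq_int_diff sq_int_cB sq_int_sum_cblk)
  also have "L2n P (\<lambda>w. 1 / sqrt (real n) * (cB n w - ?S w)) = 1 / sqrt (real n) * L2n P (\<lambda>w. cB n w - ?S w)"
    unfolding L2n_cmult by simp
  also have "\<dots> \<le> 1 / sqrt (real n) * sqrt (K2 * (real k + real L))"
    unfolding k_def by (intro mult_left_mono block_L2n L) auto
  also have "L2n P (\<lambda>w. (1 / sqrt (real n) - \<sigma> / sqrt (real k * s\<^sup>2)) * ?S w) = \<bar>1 / sqrt (real n) - \<sigma> / sqrt (real k * s\<^sup>2)\<bar> * (sqrt (real k) * s)"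
    unfolding L2n_cmult L2n_sum_cblk' s_def ..
  also have "\<dots> = \<bar>(1 / sqrt (real n) - \<sigma> / sqrt (real k * s\<^sup>2)) * (sqrt (real k) * s)\<bar>"
    using s by (simp add: abs_mult)
  also have "(1 / sqrt (real n) - \<sigma> / sqrt (real k * s\<^sup>2)) * (sqrt (real k) * s) = sqrt (real k * real L) / sqrt (real n) * an L - \<sigma>"
    using s kpos L by (simp add: left_diff_distrib real_sqrt_mult an_def s_def[symmetric])
  finally have "P.expectation (\<lambda>w. \<bar>?f w - ?g w\<bar>) \<le> sqrt (K2 * (real k + real L)) / sqrt (real n) + \<bar>sqrt (real k * real L) / sqrt (real n) * an L - \<sigma>\<bar>"
    by simp
  then have "\<bar>t\<bar> * P.expectation (\<lambda>w. \<bar>?f w - ?g w\<bar>) \<le> \<bar>t\<bar> * (sqrt (K2 * (real k + real L)) / sqrt (real n) + \<bar>sqrt (real k * real L) / sqrt (real n) * an L - \<sigma>\<bar>)"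
    by (rule mult_left_mono) simp
  moreover have "cmod (char (distr P borel ?f) t - char (distr P borel ?g) t) \<le> \<bar>t\<bar> * P.expectation (\<lambda>w. \<bar>?f w - ?g w\<bar>)"
    using sf sg by (intro P.char_diff_le P.sq_int_integrable sq_int_diff) (auto simp: sq_int_def)
  ultimately have "cmod (char (distr P borel ?f) t - char (distr P borel (\<lambda>w. ?S w / sqrt (real k * s\<^sup>2))) (\<sigma> * t))
     \<le> \<bar>t\<bar> * (sqrt (K2 * (real k + real L)) / sqrt (real n) + \<bar>sqrt (real k * real L) / sqrt (real n) * an L - \<sigma>\<bar>)"
    unfolding ceq by linarith
  then show ?thesis unfolding k_def s_def .
qed

text \<open>The order of the limits matters: \<open>L\<close> is fixed first, so that the restart
  error is small uniformly for late \<open>n\<close>, and only then the classical theorem is applied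
  with \<open>n div L\<close> blocks.\<close>

theorem clt_cB:
  "(\<lambda>n. char (distr P borel (\<lambda>w. cB n w / sqrt (real n))) t) \<longlonglongrightarrow> complex_of_real (exp (- ((\<sigma> * t)\<^sup>2) / 2))"
proof (rule LIMSEQ_I)
  fix e :: real assume e: "0 < e"
  \<comment> \<open>Three portions of \<open>\<delta>\<close> are spent: on the restart error, on
    the distance of \<open>an L\<close> from \<open>\<sigma>\<close>, and on waiting for large
    \<open>n\<close>. The last quarter of \<open>e\<close> is left for the classical theorem, and
    \<open>\<bar>t\<bar> + 1\<close> avoids division by zero.\<close>
  define \<delta> where "\<delta> = e / (4 * (\<bar>t\<bar> + 1))"
  have \<delta>: "0 < \<delta>" using e by (simp add: \<delta>_def add_nonneg_pos)
  have t\<delta>: "\<bar>t\<bar> * (3 * \<delta>) \<le> 3 * e / 4"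
  proof -
    have "\<bar>t\<bar> * (3 * \<delta>) \<le> (\<bar>t\<bar> + 1) * (3 * \<delta>)" using \<delta> by (intro mult_right_mono) auto
    also have "\<dots> = 3 * e / 4" by (simp add: \<delta>_def add_nonneg_pos field_simps add_eq_0_iff)
    finally show ?thesis .
  qed
  obtain L0 where L0: "0 < L0" "\<And>L. L \<ge> L0 \<Longrightarrow> sqrt (K2 / real L) < \<delta>" using small_err[OF \<delta>] by blast
  obtain L1 where L1: "\<And>L. L \<ge> L1 \<Longrightarrow> \<bar>an L - \<sigma>\<bar> < \<delta>" using LIMSEQ_D[OF an_lim \<delta>] by auto
  define L where "L = max L0 L1"
  have L: "0 < L" "sqrt (K2 / real L) < \<delta>" "\<bar>an L - \<sigma>\<bar> < \<delta>" using L0 L1 by (auto simp: L_def)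
  let ?G = "\<lambda>k. char (distr P borel (\<lambda>w. (\<Sum>i<k. cblk L i w) / sqrt (real k * (L2n P (cB L))\<^sup>2))) (\<sigma> * t)"
  have "(\<lambda>n. ?G (n div L)) \<longlonglongrightarrow> complex_of_real (exp (- ((\<sigma> * t)\<^sup>2) / 2))"
    by (rule filterlim_compose[OF block_clt[OF L(1)] tendsto_div_nat(2)[OF L(1)]])
  from tendstoD[OF this, of "e/4"] e
  have 1: "eventually (\<lambda>n. dist (?G (n div L)) (complex_of_real (exp (- ((\<sigma> * t)\<^sup>2) / 2))) < e / 4) sequentially" by simp
  have "(\<lambda>n. sqrt (K2 * (real (n div L) + real L)) / sqrt (real n) + \<bar>sqrt (real (n div L) * real L) / sqrt (real n) * an L - \<sigma>\<bar>)
     \<longlonglongrightarrow> sqrt (K2 / real L) + \<bar>1 * an L - \<sigma>\<bar>"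
    by (intro tendsto_intros err_tendsto ratio_tendsto L)
  then have 2: "eventually (\<lambda>n. sqrt (K2 * (real (n div L) + real L)) / sqrt (real n) + \<bar>sqrt (real (n div L) * real L) / sqrt (real n) * an L - \<sigma>\<bar> < 3 * \<delta>) sequentially"
    using L \<delta> by (intro order_tendstoD) auto
  have 3: "eventually (\<lambda>n. 0 < n div L) sequentially"
    using tendsto_div_nat(2)[OF L(1)] unfolding filterlim_at_top by (rule eventually_mono[OF spec[of _ 1]]) simp
  have "eventually (\<lambda>n. cmod (char (distr P borel (\<lambda>w. cB n w / sqrt (real n))) t - complex_of_real (exp (- ((\<sigma> * t)\<^sup>2) / 2))) < e) sequentially"
    using 1 2 3 eventually_gt_at_top[of 0]
  proof eventually_elim
    case (elim n)
    have "cmod (char (distr P borel (\<lambda>w. cB n w / sqrt (real n))) t - ?G (n div L))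
      \<le> \<bar>t\<bar> * (sqrt (K2 * (real (n div L) + real L)) / sqrt (real n) + \<bar>sqrt (real (n div L) * real L) / sqrt (real n) * an L - \<sigma>\<bar>)"
      using elim by (intro char_cB_diff L) auto
    also have "\<dots> \<le> \<bar>t\<bar> * (3 * \<delta>)" using elim by (intro mult_left_mono) auto
    also have "\<dots> \<le> 3 * e / 4" by (rule t\<delta>)
    finally have "cmod (char (distr P borel (\<lambda>w. cB n w / sqrt (real n))) t - ?G (n div L)) \<le> 3 * e / 4" .
    moreover have "cmod (?G (n div L) - complex_of_real (exp (- ((\<sigma> * t)\<^sup>2) / 2))) < e / 4"
      using elim by (simp add: dist_norm)
    ultimately show ?case
      using norm_diff_triangle_le[of "char (distr P borel (\<lambda>w. cB n w / sqrt (real n))) t" "?G (n div L)" "3 * e / 4" "complex_of_real (exp (- ((\<sigma> * t)\<^sup>2) / 2))"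
        "cmod (?G (n div L) - complex_of_real (exp (- ((\<sigma> * t)\<^sup>2) / 2)))"] by linarith
  qed
  then show "\<exists>no. \<forall>n\<ge>no. cmod (char (distr P borel (\<lambda>w. cB n w / sqrt (real n))) t - complex_of_real (exp (- ((\<sigma> * t)\<^sup>2) / 2))) < e"
    unfolding eventually_sequentially .
qed

end

section \<open>The normal distribution function\<close>

lemma Phi_eq_cdf: "Phi x = cdf std_normal_distribution x"
proof -
  have int: "integrable lborel (\<lambda>z. std_normal_density z * indicator {..x} z)"
    by (rule integrable_real_mult_indicator) auto
  have "emeasure std_normal_distribution {..x} = (\<integral>\<^sup>+z. ennreal (std_normal_density z) * indicator {..x} z \<partial>lborel)"
    by (subst emeasure_density) auto
  also have "\<dots> = (\<integral>\<^sup>+z. ennreal (std_normal_density z * indicator {..x} z) \<partial>lborel)"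
    by (intro nn_integral_cong) (auto simp: indicator_def)
  also have "\<dots> = ennreal (\<integral>z. std_normal_density z * indicator {..x} z \<partial>lborel)"
    using int by (intro nn_integral_eq_integral) (auto simp: indicator_def)
  finally have "measure std_normal_distribution {..x} = (\<integral>z. std_normal_density z * indicator {..x} z \<partial>lborel)"
    by (simp add: measure_def indicator_def integral_nonneg_AE)
  also have "\<dots> = Phi x"
    unfolding Phi_def set_lebesgue_integral_def
    by (intro Bochner_Integration.integral_cong) (auto simp: std_normal_density_def)
  finally show ?thesis by (simp add: cdf_def)
qed

lemma isCont_Phi: "isCont Phi x"
proof -
  interpret N: real_distribution std_normal_distribution by (rule real_dist_normal_dist)
  have "emeasure std_normal_distribution {x} = (\<integral>\<^sup>+z. ennreal (std_normal_density z) * indicator {x} z \<partial>lborel)"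
    by (subst emeasure_density) auto
  also have "\<dots> = 0" by (rule nn_integral_null_set) (rule null_setsI, simp_all)
  finally have "measure std_normal_distribution {x} = 0" by (simp add: measure_def)
  then have "isCont (cdf std_normal_distribution) x" by (simp add: N.isCont_cdf)
  then show ?thesis by (simp add: Phi_eq_cdf[abs_def] cong: if_cong)
qed

text \<open>The normal distribution function is continuous everywhere, so weak convergence means
  convergence at every point, and Levy's theorem is available in both directions.\<close>

lemma (in prob_space) tendsto_Phi_iff_char:
  fixes f :: "nat \<Rightarrow> 'a \<Rightarrow> real"
  assumes [measurable]: "\<And>n. f n \<in> borel_measurable M"
  shows "(\<forall>x. (\<lambda>n. measure M {w \<in> space M. f n w \<le> x}) \<longlonglongrightarrow> Phi x)
    \<longleftrightarrow> (\<forall>t. (\<lambda>n. char (distr M borel (f n)) t) \<longlonglongrightarrow> complex_of_real (exp (- (t\<^sup>2) / 2)))"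
proof -
  have rd: "real_distribution (distr M borel (f n))" for n by (rule real_distribution_distr) measurable
  have cdf: "cdf (distr M borel (f n)) x = measure M {w \<in> space M. f n w \<le> x}" for n x
    unfolding cdf_def by (subst measure_distr) (auto intro!: arg_cong[where f = "measure M"])
  have cont: "isCont (cdf std_normal_distribution) x" for x
    using isCont_Phi[of x] by (simp add: Phi_eq_cdf[abs_def])
  have W: "(\<forall>x. (\<lambda>n. measure M {w \<in> space M. f n w \<le> x}) \<longlonglongrightarrow> Phi x)
    \<longleftrightarrow> weak_conv_m (\<lambda>n. distr M borel (f n)) std_normal_distribution"
    using cont by (simp add: weak_conv_m_def weak_conv_def cdf Phi_eq_cdf)
  have "weak_conv_m (\<lambda>n. distr M borel (f n)) std_normal_distribution
    \<longleftrightarrow> (\<forall>t. (\<lambda>n. char (distr M borel (f n)) t) \<longlonglongrightarrow> char std_normal_distribution t)"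
    using levy_continuity[of "\<lambda>n. distr M borel (f n)", OF rd real_dist_normal_dist]
      levy_continuity1[of "\<lambda>n. distr M borel (f n)", OF rd real_dist_normal_dist] by blast
  then show ?thesis unfolding W by (simp add: char_std_normal_distribution)
qed

lemma (in prob_space) tendsto_Phi_uminus:
  fixes f :: "nat \<Rightarrow> 'a \<Rightarrow> real"
  assumes [measurable]: "\<And>n. f n \<in> borel_measurable M"
    and lim: "\<And>x. (\<lambda>n. measure M {w \<in> space M. f n w \<le> x}) \<longlonglongrightarrow> Phi x"
  shows "(\<lambda>n. measure M {w \<in> space M. - f n w \<le> x}) \<longlonglongrightarrow> Phi x"
proof -
  have "(\<lambda>n. char (distr M borel (\<lambda>w. - f n w)) t) \<longlonglongrightarrow> complex_of_real (exp (- (t\<^sup>2) / 2))" for t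
  proof -
    have "char (distr M borel (\<lambda>w. - f n w)) t = char (distr M borel (f n)) (- t)" for n
      unfolding char_def by (subst (1 2) integral_distr) auto
    moreover have "(\<lambda>n. char (distr M borel (f n)) (- t)) \<longlonglongrightarrow> complex_of_real (exp (- ((- t)\<^sup>2) / 2))"
      using tendsto_Phi_iff_char[of f, OF assms(1)] lim by blast
    ultimately show ?thesis by simp
  qed
  then show ?thesis using tendsto_Phi_iff_char[of "\<lambda>n w. - f n w"] by simp
qed

text \<open>The moving argument is trapped by fixed points on either side of \<open>x\<close>:
  monotonicity passes to the fixed points, and continuity of the limit brings them back to
  \<open>x\<close>.\<close>

lemma tendsto_mono_locally_uniform:
  fixes G :: "nat \<Rightarrow> real \<Rightarrow> real"
  assumes mono: "\<And>n. mono (G n)" and lim: "\<And>y. (\<lambda>n. G n y) \<longlonglongrightarrow> \<Psi> y" and cont: "isCont \<Psi> x"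
    and m: "filterlim m at_top sequentially" and y: "y \<longlonglongrightarrow> x"
  shows "(\<lambda>n. G (m n) (y n)) \<longlonglongrightarrow> \<Psi> x"
proof (rule order_tendstoI)
  fix a assume "a < \<Psi> x"
  then have "eventually (\<lambda>z. a < \<Psi> z) (at x)"
    using cont by (simp add: isCont_def order_tendsto_iff)
  then have "eventually (\<lambda>z. a < \<Psi> z) (at_left x)" by (rule filter_leD[OF at_le, rotated]) simp
  then obtain b where b: "b < x" "\<And>z. b < z \<Longrightarrow> z < x \<Longrightarrow> a < \<Psi> z"
    unfolding eventually_at_left_field by auto
  define z where "z = (b + x) / 2"
  have z: "z < x" "a < \<Psi> z" using b by (auto simp: z_def)
  have "eventually (\<lambda>n. a < G (m n) z) sequentially"
    using filterlim_compose[OF lim[of z] m] z by (intro order_tendstoD) auto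
  moreover have "eventually (\<lambda>n. z < y n) sequentially" using y z by (intro order_tendstoD)
  ultimately show "eventually (\<lambda>n. a < G (m n) (y n)) sequentially"
    by eventually_elim (meson less_imp_le less_le_trans mono monoD)
next
  fix a assume "\<Psi> x < a"
  then have "eventually (\<lambda>z. \<Psi> z < a) (at x)"
    using cont by (simp add: isCont_def order_tendsto_iff)
  then have "eventually (\<lambda>z. \<Psi> z < a) (at_right x)" by (rule filter_leD[OF at_le, rotated]) simp
  then obtain b where b: "x < b" "\<And>z. x < z \<Longrightarrow> z < b \<Longrightarrow> \<Psi> z < a"
    unfolding eventually_at_right_field by auto
  define z where "z = (b + x) / 2"
  have z: "x < z" "\<Psi> z < a" using b by (auto simp: z_def)
  have "eventually (\<lambda>n. G (m n) z < a) sequentially"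
    using filterlim_compose[OF lim[of z] m] z by (intro order_tendstoD) auto
  moreover have "eventually (\<lambda>n. y n < z) sequentially" using y z by (intro order_tendstoD)
  ultimately show "eventually (\<lambda>n. G (m n) (y n) < a) sequentially"
    by eventually_elim (meson less_imp_le le_less_trans mono monoD)
qed

text \<open>Along squares a variance of order \<open>n\<close> makes the Chebyshev bounds summable,
  while the ratio of consecutive terms tends to one, so monotone interpolation loses nothing.
  \<open>Suc\<close> keeps the values positive.\<close>

definition sq :: "nat \<Rightarrow> nat" where "sq m = (Suc m)\<^sup>2"

text \<open>Deterministic inversion. With \<open>M n\<close> the last index whose hitting time is at
  most \<open>n\<close>, the next square has not been hit, which bounds the position above, and the
  walk has not fallen far below the present square, which bounds it below. Both bounds are
  asymptotic to \<open>n / \<tau>\<close>.\<close>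

lemma position_from_hitting_times:
  fixes X :: "nat \<Rightarrow> int" and T :: "nat \<Rightarrow> nat"
  assumes before: "\<And>m t. t < T m \<Longrightarrow> X t < int (sq m)"
    and after: "eventually (\<lambda>m. \<forall>t\<ge>T m. int (sq m) - int (Suc m) \<le> X t) sequentially"
    and T_ge: "\<And>m. sq m \<le> T m"
    and T_lim: "(\<lambda>m. real (T m) / real (sq m)) \<longlonglongrightarrow> \<tau>" and \<tau>: "0 < \<tau>"
  shows "filterlim X at_top sequentially" "(\<lambda>n. real_of_int (X n) / real n) \<longlonglongrightarrow> 1 / \<tau>"
proof -
  have sq_ge: "Suc m \<le> sq m" for m by (simp add: sq_def power2_eq_square)
  define M where "M n = Max {m. T m \<le> n}" for n
  have fin: "finite {m. T m \<le> n}" for n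
  proof (rule finite_subset[of _ "{..n}"])
    show "{m. T m \<le> n} \<subseteq> {..n}"
    proof
      fix m assume "m \<in> {m. T m \<le> n}"
      then show "m \<in> {..n}" using T_ge[of m] sq_ge[of m] by simp
    qed
  qed simp
  have M1: "T (M n) \<le> n" if "T m \<le> n" for n m
    using Max_in[OF fin[of n]] that unfolding M_def by blast
  have M2: "n < T (Suc (M n))" for n
    using Max_ge[OF fin[of n], of "Suc (M n)"] unfolding M_def by (meson Suc_n_not_le_n mem_Collect_eq not_le)
  have M_ge: "m \<le> M n" if "T m \<le> n" for m n
    using that Max_ge[OF fin[of n]] unfolding M_def by blast
  have M_lim: "filterlim M at_top sequentially"
    unfolding filterlim_at_top
  proof
    fix m show "eventually (\<lambda>n. m \<le> M n) sequentially"
      using eventually_ge_at_top[of "T m"] by eventually_elim (rule M_ge)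
  qed
  have after': "eventually (\<lambda>n. \<forall>t\<ge>T (M n). int (sq (M n)) - int (Suc (M n)) \<le> X t) sequentially"
    using M_lim after by (rule eventually_compose_filterlim[rotated])
  have lower: "eventually (\<lambda>n. int (sq (M n)) - int (Suc (M n)) \<le> X n) sequentially"
    using after' eventually_ge_at_top[of "T 0"] by eventually_elim (use M1 in blast)
  show "filterlim X at_top sequentially"
  proof (rule filterlim_at_top_mono)
    show "eventually (\<lambda>n. int (M n) \<le> X n) sequentially"
      using lower
    proof eventually_elim
      case (elim n)
      have "int (M n) \<le> int (sq (M n)) - int (Suc (M n))" by (simp add: sq_def power2_eq_square)
      then show ?case using elim by linarith
    qed
    show "filterlim (\<lambda>n. int (M n)) at_top sequentially"
      by (rule filterlim_compose[OF filterlim_int_sequentially M_lim])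
  qed
  have inv: "(\<lambda>m. real (sq m) / real (T m)) \<longlonglongrightarrow> 1 / \<tau>"
    using tendsto_divide[OF tendsto_const[of 1] T_lim] \<tau> by simp
  have r1: "(\<lambda>m. real (sq (Suc m)) / real (sq m)) \<longlonglongrightarrow> 1"
    unfolding sq_def by real_asymp
  have r2: "(\<lambda>m. (real (sq m) - real (Suc m)) / real (sq (Suc m))) \<longlonglongrightarrow> 1"
    unfolding sq_def by real_asymp
  have sqpos: "0 < real (sq m)" for m using sq_ge[of m] by linarith
  have Tpos: "0 < real (T m)" for m using sqpos[of m] T_ge[of m] by linarith
  have up: "(\<lambda>m. real (sq (Suc m)) / real (T m)) \<longlonglongrightarrow> 1 / \<tau>"
    using tendsto_mult[OF r1 inv] sqpos by (simp add: less_imp_neq[symmetric])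
  have lo: "(\<lambda>m. (real (sq m) - real (Suc m)) / real (T (Suc m))) \<longlonglongrightarrow> 1 / \<tau>"
    using tendsto_mult[OF r2 LIMSEQ_Suc[OF inv]] sqpos by (simp add: less_imp_neq[symmetric])
  show "(\<lambda>n. real_of_int (X n) / real n) \<longlonglongrightarrow> 1 / \<tau>"
  proof (rule tendsto_sandwich[OF _ _ filterlim_compose[OF lo M_lim] filterlim_compose[OF up M_lim]])
    show "eventually (\<lambda>n. (real (sq (M n)) - real (Suc (M n))) / real (T (Suc (M n))) \<le> real_of_int (X n) / real n) sequentially"
      using lower eventually_gt_at_top[of 0]
    proof eventually_elim
      case (elim n)
      have 1: "real (sq (M n)) - real (Suc (M n)) \<le> real_of_int (X n)" using elim by linarith
      have 0: "0 \<le> real (sq (M n)) - real (Suc (M n))" using sq_ge[of "M n"] by linarith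
      show ?case
        using elim 0 1 M2[of n] by (intro frac_le) auto
    qed
    show "eventually (\<lambda>n. real_of_int (X n) / real n \<le> real (sq (Suc (M n))) / real (T (M n))) sequentially"
      using eventually_ge_at_top[of "T 0"] eventually_gt_at_top[of 0]
    proof eventually_elim
      case (elim n)
      have 1: "real_of_int (X n) \<le> real (sq (Suc (M n)))" using before[OF M2[of n]] by linarith
      show ?case
        using elim 1 M1[of 0 n] Tpos[of "M n"] by (intro frac_le) auto
    qed
  qed
qed

section \<open>The walk in independent stacks\<close>

context stack_law
begin

abbreviation arrows :: "(int \<Rightarrow> 's) \<Rightarrow> int \<Rightarrow> nat \<Rightarrow> bool" where "arrows w \<equiv> \<lambda>x. arr (w x)"

definition X :: "nat \<Rightarrow> (int \<Rightarrow> 's) \<Rightarrow> int" where "X n w = pos (arrows w) n"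

definition T :: "nat \<Rightarrow> (int \<Rightarrow> 's) \<Rightarrow> nat" where "T n w = (LEAST t. X t w = int n)"

lemma X_used_measurable:
  "X n \<in> measurable P (count_space UNIV) \<and> (\<forall>x. (\<lambda>w. used (arrows w) n x) \<in> measurable P (count_space UNIV))"
proof (induction n)
  case 0
  then show ?case by (simp add: X_def[abs_def])
next
  case (Suc n)
  have X [measurable]: "X n \<in> measurable P (count_space UNIV)" using Suc by simp
  have u [measurable]: "(\<lambda>w. used (arrows w) n x) \<in> measurable P (count_space UNIV)" for x using Suc by blast
  have a [measurable]: "Measurable.pred P (\<lambda>w. arr (w x) j)" for x j
    by (rule measurable_compose[OF coord_measurable arr_measurable])
  have [measurable]: "Measurable.pred P (\<lambda>w. arr (w x) (used (arrows w) n x))" for x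
    by (rule measurable_compose_countable[OF a u])
  have [measurable]: "Measurable.pred P (\<lambda>w. arr (w (X n w)) (used (arrows w) n (X n w)))"
    by (rule measurable_compose_countable[where f = "\<lambda>x w. arr (w x) (used (arrows w) n x)", OF _ X]) measurable
  have "X (Suc n) = (\<lambda>w. if arr (w (X n w)) (used (arrows w) n (X n w)) then X n w + 1 else X n w - 1)"
    by (auto simp: X_def pos_Suc fun_eq_iff)
  then have "X (Suc n) \<in> measurable P (count_space UNIV)" by simp
  moreover have "(\<lambda>w. used (arrows w) (Suc n) x) \<in> measurable P (count_space UNIV)" for x
  proof -
    have "(\<lambda>w. used (arrows w) (Suc n) x) = (\<lambda>w. if x = X n w then Suc (used (arrows w) n x) else used (arrows w) n x)"
      by (auto simp: X_def used_Suc fun_eq_iff)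
    then show ?thesis by simp
  qed
  ultimately show ?case by blast
qed

lemma X_measurable [measurable]: "X n \<in> measurable P (count_space UNIV)"
  using X_used_measurable by blast

lemma T_measurable [measurable]: "T n \<in> measurable P (count_space UNIV)"
  unfolding T_def[abs_def] by measurable

text \<open>On negative sites the first passage to the right contributes no immigration.\<close>

primrec dz :: "(int \<Rightarrow> 's) \<Rightarrow> nat \<Rightarrow> nat \<Rightarrow> nat" where
  "dz w z 0 = z"
| "dz w z (Suc j) = F (w (- 1 - int j)) (dz w z j)"

definition Neg :: "nat \<Rightarrow> (int \<Rightarrow> 's) \<Rightarrow> ennreal" where
  "Neg n w = (\<Sum>j. ennreal (real (dz w (dn w (int n) n) j)))"

text \<open>An extra awaited right arrow only raises the killed chain; and once that chain has died,
  this one is zero too and stays so, because no left arrow precedes the zeroth right arrow.\<close>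

lemma dz_le_kc: "dz w z j \<le> kc w 0 z j"
proof (induction j)
  case (Suc j)
  have "F (w (- 1 - int j)) (dz w z j) \<le> F (w (- 1 - int j)) (Suc (kc w 0 z j))"
    using Suc by (intro zeros_before_mono) simp
  then show ?case using Suc by auto
qed simp

lemma dz_measurable [measurable]: "(\<lambda>w. dz w (dn w (int n) n) j) \<in> measurable P (count_space UNIV)"
  by (induction j) (simp_all add: F_comp_measurable)

lemma Neg_measurable [measurable]: "Neg n \<in> borel_measurable P"
  unfolding Neg_def[abs_def] by measurable

definition K3 :: real where "K3 = CV / (1 - kr)"

text \<open>Uniform in \<open>n\<close>: what the chain carries to site \<open>0\<close> has bounded
  second moment whatever the level, and to the left of \<open>0\<close> it dies out geometrically.
  Negative sites thus matter neither for the speed nor on the scale \<open>sqrt n\<close>.\<close>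

lemma nn_integral_Neg: "(\<integral>\<^sup>+w. Neg n w \<partial>P) \<le> ennreal K3"
proof -
  have "(\<integral>\<^sup>+w. Neg n w \<partial>P) = (\<Sum>j. \<integral>\<^sup>+w. ennreal (real (dz w (dn w (int n) n) j)) \<partial>P)"
    unfolding Neg_def by (rule nn_integral_suminf) measurable
  also have "\<dots> \<le> (\<Sum>j. ennreal (CV * kr ^ j))"
  proof (intro suminf_le summableI)
    fix j
    have "(\<integral>\<^sup>+w. ennreal (real (dz w (dn w (int n) n) j)) \<partial>P) \<le> (\<integral>\<^sup>+w. ennreal (V (kc w 0 (dn w (0 + int n) n) j)) \<partial>P)"
      by (intro nn_integral_mono ennreal_leI order_trans[OF _ V_ge_self]) (simp add: dz_le_kc)
    also have "\<dots> \<le> ennreal (CV * kr ^ j)" by (rule nn_integral_V_kc_dn)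
    finally show "(\<integral>\<^sup>+w. ennreal (real (dz w (dn w (int n) n) j)) \<partial>P) \<le> ennreal (CV * kr ^ j)" .
  qed
  also have "\<dots> = ennreal K3"
  proof (rule suminf_ennreal_eq)
    show "(\<lambda>j. CV * kr ^ j) sums K3"
      unfolding K3_def using kr sums_mult[OF geometric_sums[of kr], of CV] by simp
  qed (use CV_nonneg kr in auto)
  finally show ?thesis .
qed

lemma K3_nonneg: "0 \<le> K3" using CV_nonneg kr by (simp add: K3_def)

definition regular :: "(int \<Rightarrow> 's) \<Rightarrow> bool" where
  "regular w \<longleftrightarrow> (\<forall>x. good (arr (w x))) \<and> (\<forall>n. \<exists>j. dz w (dn w (int n) n) j = 0)"

text \<open>A summable sequence of natural numbers contains a zero; the site where it occurs
  supplies the left boundary needed by \<open>left_quota\<close>.\<close>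

lemma AE_regular: "AE w in P. regular w"
proof -
  have "AE w in P. good (arr (w x))" for x
    unfolding P_def using AE_PiM_component[of UNIV "\<lambda>_. Q" x] Q.prob_space_axioms good_arr by simp
  then have 1: "AE w in P. \<forall>x. good (arr (w x))" by (simp add: AE_all_countable)
  have "AE w in P. Neg n w \<noteq> \<infinity>" for n
  proof (rule nn_integral_PInf_AE)
    have "(\<integral>\<^sup>+w. Neg n w \<partial>P) < \<infinity>" using nn_integral_Neg[of n] by (rule le_less_trans) simp
    then show "(\<integral>\<^sup>+w. Neg n w \<partial>P) \<noteq> \<infinity>" by simp
  qed measurable
  then have 2: "AE w in P. \<forall>n. Neg n w \<noteq> \<infinity>" by (simp add: AE_all_countable)
  from 1 2 show ?thesis
  proof eventually_elim
    case (elim w)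
    have "\<exists>j. dz w (dn w (int n) n) j = 0" for n
    proof -
      have "summable (\<lambda>j. real (dz w (dn w (int n) n) j))"
        using elim(2) unfolding Neg_def by (intro summable_suminf_not_top) auto
      then have "(\<lambda>j. real (dz w (dn w (int n) n) j)) \<longlonglongrightarrow> 0" by (rule summable_LIMSEQ_zero)
      from LIMSEQ_D[OF this, of 1] obtain j where "\<bar>real (dz w (dn w (int n) n) j)\<bar> < 1" by auto
      then show ?thesis by (intro exI[of _ j]) simp
    qed
    then show ?case using elim by (simp add: regular_def)
  qed
qed

definition Dl :: "(int \<Rightarrow> 's) \<Rightarrow> nat \<Rightarrow> int \<Rightarrow> nat" where
  "Dl w n x = (if 0 \<le> x then dn w (int n) (nat (int n - x)) else dz w (dn w (int n) n) (nat (- x)))"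

lemma quota:
  assumes "regular w"
  shows "\<exists>x0. left_quota (arrows w) n (Dl w n) x0"
proof -
  obtain j where j: "dz w (dn w (int n) n) j = 0" using assms by (auto simp: regular_def)
  have j': "dz w (dn w (int n) n) i = 0" if "j \<le> i" for i
    using that j by (induction i rule: dec_induct) auto
  have "left_quota (arrows w) n (Dl w n) (- int j)"
  proof
    show "good (arr (w x))" for x using assms by (simp add: regular_def)
    show "Dl w n (int n) = 0" by (simp add: Dl_def)
    show "Dl w n x = F (w x) (Dl w n (x + 1) + (if 0 \<le> x then 1 else 0))" if "x < int n" for x
    proof (cases "0 \<le> x")
      case True
      define i where "i = nat (int n - x - 1)"
      have "nat (int n - x) = Suc i" "nat (int n - (x + 1)) = i" "int n - 1 - int i = x" using that by (auto simp: i_def)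
      then show ?thesis using True by (simp add: Dl_def)
    next
      case False
      define i where "i = nat (- x - 1)"
      have i: "nat (- x) = Suc i" "- 1 - int i = x" using False by (auto simp: i_def)
      have "Dl w n (x + 1) = dz w (dn w (int n) n) i"
        using False by (cases "x = -1") (auto simp: Dl_def i_def)
      then show ?thesis using False i by (simp add: Dl_def)
    qed
    show "Dl w n x = 0" if "x \<le> - int j" for x
    proof (cases "x = 0")
      case True
      then show ?thesis using that j by (simp add: Dl_def)
    next
      case False
      then show ?thesis using that j'[of "nat (- x)"] by (simp add: Dl_def)
    qed
  qed simp
  then show ?thesis by blast
qed

lemma T_left_quota: "left_quota (arrows w) n (Dl w n) x0 \<Longrightarrow> T n w = left_quota.T (arrows w) n"
  by (simp add: T_def X_def left_quota.T_def)

lemma before_T: "regular w \<Longrightarrow> t < T n w \<Longrightarrow> X t w < int n"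
  using quota[of w n] left_quota.before_T T_left_quota by (metis X_def)

lemma X_T: "regular w \<Longrightarrow> X (T n w) w = int n"
  using quota[of w n] left_quota.pos_T T_left_quota by (metis X_def)

lemma T_ge: "regular w \<Longrightarrow> n \<le> T n w"
  using X_T[of w n] pos_le[of "arrows w" "T n w"] by (simp add: X_def)

lemma lefts_T: "regular w \<Longrightarrow> y \<le> n \<Longrightarrow> real (lefts (arrows w) (T n w) (int y)) = D n y w"
proof -
  assume w: "regular w" and y: "y \<le> n"
  obtain x0 where q: "left_quota (arrows w) n (Dl w n) x0" using quota[OF w] by blast
  show ?thesis using left_quota.lefts_T[OF q, of "int y"] T_left_quota[OF q] y
    by (simp add: Dl_def D_def nat_diff_distrib' flip: of_nat_diff)
qed

lemma T_bounds:
  assumes w: "regular w"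
  shows "real n + 2 * Bn n w \<le> real (T n w)"
    and "ennreal (real (T n w) - real n - 2 * Bn n w) \<le> 2 * Neg n w"
proof -
  obtain x0 where q: "left_quota (arrows w) n (Dl w n) x0" using quota[OF w] by blast
  have x0: "x0 \<le> 0" using q by (simp add: left_quota_def)
  have "int (T n w) = int n + 2 * (\<Sum>x\<in>{x0..<int n}. int (Dl w n x))"
    using left_quota.T_eq[OF q] T_left_quota[OF q] by simp
  also have "{x0..<int n} = {x0..<0} \<union> {0..<int n}" using x0 by auto
  also have "(\<Sum>x\<in>{x0..<0} \<union> {0..<int n}. int (Dl w n x)) = (\<Sum>x\<in>{x0..<0}. int (Dl w n x)) + (\<Sum>x\<in>{0..<int n}. int (Dl w n x))"
    by (rule sum.union_disjoint) auto
  finally have "real_of_int (int (T n w)) = real_of_int (int n + 2 * ((\<Sum>x\<in>{x0..<0}. int (Dl w n x)) + (\<Sum>x\<in>{0..<int n}. int (Dl w n x))))"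
    by (rule arg_cong)
  then have T: "real (T n w) = real n + 2 * ((\<Sum>x\<in>{x0..<0}. real (Dl w n x)) + (\<Sum>x\<in>{0..<int n}. real (Dl w n x)))"
    by simp
  have B: "(\<Sum>x\<in>{0..<int n}. real (Dl w n x)) = Bn n w"
    unfolding Bn_def D_def
    by (rule sum.reindex_bij_witness[of _ int nat]) (auto simp: Dl_def nat_diff_distrib' simp flip: of_nat_diff)
  have N: "(\<Sum>x\<in>{x0..<0}. real (Dl w n x)) = (\<Sum>j\<in>{1..nat (- x0)}. real (dz w (dn w (int n) n) j))"
    by (rule sum.reindex_bij_witness[of _ "\<lambda>j. - int j" "\<lambda>x. nat (- x)"]) (auto simp: Dl_def)
  have "ennreal (\<Sum>x\<in>{x0..<0}. real (Dl w n x)) = (\<Sum>j\<in>{1..nat (- x0)}. ennreal (real (dz w (dn w (int n) n) j)))"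
    unfolding N by (subst sum_ennreal) auto
  also have "\<dots> \<le> Neg n w" unfolding Neg_def by (intro sum_le_suminf summableI) auto
  finally have le: "ennreal (\<Sum>x\<in>{x0..<0}. real (Dl w n x)) \<le> Neg n w" .
  have nn: "0 \<le> (\<Sum>x\<in>{x0..<0}. real (Dl w n x))" by (intro sum_nonneg) auto
  show "real n + 2 * Bn n w \<le> real (T n w)" unfolding T B using nn by simp
  have "real (T n w) - real n - 2 * Bn n w = 2 * (\<Sum>x\<in>{x0..<0}. real (Dl w n x))" using T B by simp
  then have "ennreal (real (T n w) - real n - 2 * Bn n w) = 2 * ennreal (\<Sum>x\<in>{x0..<0}. real (Dl w n x))"
    using nn by (simp add: ennreal_mult)
  also have "\<dots> \<le> 2 * Neg n w" using le by (rule mult_left_mono) simp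
  finally show "ennreal (real (T n w) - real n - 2 * Bn n w) \<le> 2 * Neg n w" .
qed

text \<open>All left steps from \<open>y\<close> made after level \<open>k\<close> is hit. The
  supremum over higher levels is a monotone limit, so one integral bound controls backtracking at
  all later times.\<close>

definition bk :: "nat \<Rightarrow> nat \<Rightarrow> (int \<Rightarrow> 's) \<Rightarrow> ennreal" where
  "bk k y w = (SUP N. ennreal (D (k + N) y w - D k y w))"

lemma bk_measurable [measurable]: "bk k y \<in> borel_measurable P"
  unfolding bk_def[abs_def] by measurable

lemma nn_integral_bk:
  assumes "y \<le> k" shows "(\<integral>\<^sup>+w. bk k y w \<partial>P) \<le> ennreal (sqrt CV * q ^ (k - y))"
proof -
  have "(\<integral>\<^sup>+w. bk k y w \<partial>P) = (SUP N. \<integral>\<^sup>+w. ennreal (D (k + N) y w - D k y w) \<partial>P)"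
    unfolding bk_def
  proof (rule nn_integral_monotone_convergence_SUP)
    show "incseq (\<lambda>N w. ennreal (D (k + N) y w - D k y w))"
      using assms by (auto simp: incseq_def le_fun_def intro!: ennreal_leI D_mono)
  qed measurable
  also have "\<dots> \<le> ennreal (sqrt CV * q ^ (k - y))"
  proof (rule SUP_least)
    fix N
    have sq: "sq_int P (\<lambda>w. D (k + N) y w - D k y w)" by (intro sq_int_diff sq_int_D)
    have nn: "0 \<le> D (k + N) y w - D k y w" for w using D_mono[of y k "k + N" w] assms by simp
    have "(\<integral>\<^sup>+w. ennreal (D (k + N) y w - D k y w) \<partial>P) = ennreal (P.expectation (\<lambda>w. \<bar>D (k + N) y w - D k y w\<bar>))"
      using P.sq_int_integrable[OF sq] nn by (simp add: nn_integral_eq_integral)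
    also have "\<dots> \<le> ennreal (sqrt CV * q ^ (k - y))"
      using P.expectation_abs_le_L2n[OF sq] L2n_D_diff[of y k "k + N"] assms by (intro ennreal_leI) simp
    finally show "(\<integral>\<^sup>+w. ennreal (D (k + N) y w - D k y w) \<partial>P) \<le> ennreal (sqrt CV * q ^ (k - y))" .
  qed
  finally show ?thesis .
qed

text \<open>Being below \<open>y\<close> after \<open>k\<close> has been hit requires a further left
  step from \<open>y\<close>, and such a step is still counted when some later level is
  reached.\<close>

lemma backtrack:
  assumes w: "regular w" and y: "y \<le> k" and t: "T k w \<le> t" "X t w < int y"
  shows "1 \<le> bk k y w"
proof -
  \<comment> \<open>Reaching level \<open>Suc t + k\<close> takes at least that many steps, so this
    level is certainly hit after time \<open>t\<close>.\<close>
  have "T (Suc t + k) w \<ge> t" using T_ge[OF w, of "Suc t + k"] by simp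
  then have "lefts (arrows w) (T k w) (int y) < lefts (arrows w) (T (Suc t + k) w) (int y)"
    using lefts_crossing[OF t(1), of "int y" "arrows w"] lefts_mono[of t "T (Suc t + k) w" "arrows w" "int y"] t(2) X_T[OF w, of k] y
    by (simp add: X_def)
  then have "1 \<le> real (lefts (arrows w) (T (Suc t + k) w) (int y)) - real (lefts (arrows w) (T k w) (int y))" by linarith
  also have "\<dots> = D (k + Suc t) y w - D k y w"
    using lefts_T[OF w, of y "Suc t + k"] lefts_T[OF w y] y by (simp add: add.commute)
  finally have "ennreal 1 \<le> ennreal (D (k + Suc t) y w - D k y w)" by (rule ennreal_leI)
  also have "\<dots> \<le> bk k y w" unfolding bk_def by (rule SUP_upper) simp
  finally show ?thesis by simp
qed

text \<open>Returning a distance \<open>Suc m\<close> below \<open>sq m\<close> has an expected cost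
  geometric in \<open>m\<close>, hence summable, although \<open>Suc m\<close> is negligible
  compared with \<open>sq m\<close>.\<close>

lemma AE_no_backtrack:
  "AE w in P. eventually (\<lambda>m. \<forall>t\<ge>T (sq m) w. int (sq m) - int (Suc m) \<le> X t w) sequentially"
proof -
  have le: "Suc m \<le> sq m" for m by (simp add: sq_def power2_eq_square)
  have "AE w in P. (\<lambda>m. bk (sq m) (sq m - Suc m) w) \<longlonglongrightarrow> 0"
  proof (rule AE_tendsto_0_of_summable_nn_integral)
    have "(\<Sum>m. \<integral>\<^sup>+w. bk (sq m) (sq m - Suc m) w \<partial>P) \<le> (\<Sum>m. ennreal (sqrt CV * q * q ^ m))"
    proof (intro suminf_le summableI)
      fix m show "(\<integral>\<^sup>+w. bk (sq m) (sq m - Suc m) w \<partial>P) \<le> ennreal (sqrt CV * q * q ^ m)"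
        using nn_integral_bk[of "sq m - Suc m" "sq m"] le[of m] by (simp add: mult.assoc)
    qed
    also have "\<dots> = ennreal (sqrt CV * q * (1 / (1 - q)))"
    proof (rule suminf_ennreal_eq)
      show "(\<lambda>m. sqrt CV * q * q ^ m) sums (sqrt CV * q * (1 / (1 - q)))"
        using q by (intro sums_mult geometric_sums) auto
    qed (use q CV_nonneg in auto)
    also have "\<dots> < \<infinity>" by simp
    finally show "(\<Sum>m. \<integral>\<^sup>+w. bk (sq m) (sq m - Suc m) w \<partial>P) < \<infinity>" .
  qed measurable
  then show ?thesis using AE_regular
  proof eventually_elim
    case (elim w)
    have "eventually (\<lambda>m. bk (sq m) (sq m - Suc m) w < 1) sequentially"
      using elim(1) by (intro order_tendstoD(2)[of _ 0]) auto
    then show ?case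
    proof eventually_elim
      case (elim m)
      show ?case
      proof (intro allI impI)
        fix t assume "T (sq m) w \<le> t"
        then have "\<not> X t w < int (sq m - Suc m)"
          using backtrack[OF \<open>regular w\<close>, of "sq m - Suc m" "sq m" t] elim by force
        then show "int (sq m) - int (Suc m) \<le> X t w" using le[of m] by (simp add: of_nat_diff)
      qed
    qed
  qed
qed

section \<open>Law of large numbers\<close>

text \<open>Asymptotic time per site: one step of net progress and two for each left step, which has
  to be undone. Ballisticity is the finiteness of this number.\<close>

definition \<tau> :: real where "\<tau> = 1 + 2 * dinf"

lemma \<tau>_pos: "0 < \<tau>" using dinf_bounds(3) by (simp add: \<tau>_def)

lemma suminf_inverse_squares: "(\<Sum>m. ennreal (c / real (sq m))) < \<infinity>" if "0 \<le> c"
proof -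
  have "summable (\<lambda>m. 1 / real (sq m))"
  proof -
    have "summable (\<lambda>m. inverse ((real (Suc m))\<^sup>2))"
      using inverse_power_summable[of 2, where 'a = real]
      by (subst summable_Suc_iff[of "\<lambda>m. inverse ((real m)\<^sup>2)"]) simp
    then show ?thesis by (simp add: sq_def inverse_eq_divide)
  qed
  then have "summable (\<lambda>m. c * (1 / real (sq m)))" by (rule summable_mult)
  then have "(\<Sum>m. ennreal (c * (1 / real (sq m)))) \<noteq> top"
    using that by (intro ennreal_suminf_neq_top) (auto simp: sq_def)
  then show ?thesis by (simp add: less_top)
qed

text \<open>The hitting time splits into its linear part, the centred count, the bounded error of
  the mean, and the contribution of negative sites. Along squares the second and the last are
  summable after normalisation, in mean square and in mean respectively.\<close>

lemma AE_T_sq: "AE w in P. (\<lambda>m. real (T (sq m) w) / real (sq m)) \<longlonglongrightarrow> \<tau>"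
proof -
  have pos: "0 < real (sq m)" for m by (simp add: sq_def)
  have 1: "AE w in P. (\<lambda>m. ennreal ((cB (sq m) w / real (sq m))\<^sup>2)) \<longlonglongrightarrow> 0"
  proof (rule AE_tendsto_0_of_summable_nn_integral)
    have "(\<Sum>m. \<integral>\<^sup>+w. ennreal ((cB (sq m) w / real (sq m))\<^sup>2) \<partial>P) \<le> (\<Sum>m. ennreal (K1 / real (sq m)))"
    proof (intro suminf_le summableI)
      fix m
      have "(\<integral>\<^sup>+w. ennreal ((cB (sq m) w / real (sq m))\<^sup>2) \<partial>P) = ennreal (\<integral>w. (cB (sq m) w / real (sq m))\<^sup>2 \<partial>P)"
        using sq_int_cmult[OF sq_int_cB, of "1 / real (sq m)" "sq m"]
        by (intro nn_integral_eq_integral) (auto simp: sq_int_def)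
      also have "(\<integral>w. (cB (sq m) w / real (sq m))\<^sup>2 \<partial>P) = (L2n P (cB (sq m)))\<^sup>2 / (real (sq m))\<^sup>2"
        by (simp add: power_divide L2n_sq)
      also have "\<dots> \<le> (K1 * real (sq m)) / (real (sq m))\<^sup>2" by (intro divide_right_mono variance_Bn_le) auto
      also have "\<dots> = K1 / real (sq m)" using pos[of m] by (simp add: power2_eq_square)
      finally show "(\<integral>\<^sup>+w. ennreal ((cB (sq m) w / real (sq m))\<^sup>2) \<partial>P) \<le> ennreal (K1 / real (sq m))"
        by (simp add: ennreal_leI)
    qed
    also have "\<dots> < \<infinity>" by (rule suminf_inverse_squares[OF K1_nonneg])
    finally show "(\<Sum>m. \<integral>\<^sup>+w. ennreal ((cB (sq m) w / real (sq m))\<^sup>2) \<partial>P) < \<infinity>" .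
  qed measurable
  have 2: "AE w in P. (\<lambda>m. ennreal (2 / real (sq m)) * Neg (sq m) w) \<longlonglongrightarrow> 0"
  proof (rule AE_tendsto_0_of_summable_nn_integral)
    have "(\<Sum>m. \<integral>\<^sup>+w. ennreal (2 / real (sq m)) * Neg (sq m) w \<partial>P) \<le> (\<Sum>m. ennreal (2 * K3 / real (sq m)))"
    proof (intro suminf_le summableI)
      fix m
      have "(\<integral>\<^sup>+w. ennreal (2 / real (sq m)) * Neg (sq m) w \<partial>P) = ennreal (2 / real (sq m)) * (\<integral>\<^sup>+w. Neg (sq m) w \<partial>P)"
        by (rule nn_integral_cmult) measurable
      also have "\<dots> \<le> ennreal (2 / real (sq m)) * ennreal K3" by (intro mult_left_mono nn_integral_Neg) auto
      also have "\<dots> = ennreal (2 * K3 / real (sq m))" using K3_nonneg by (simp flip: ennreal_mult)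
      finally show "(\<integral>\<^sup>+w. ennreal (2 / real (sq m)) * Neg (sq m) w \<partial>P) \<le> ennreal (2 * K3 / real (sq m))" .
    qed
    also have "\<dots> < \<infinity>" using K3_nonneg by (intro suminf_inverse_squares) simp
    finally show "(\<Sum>m. \<integral>\<^sup>+w. ennreal (2 / real (sq m)) * Neg (sq m) w \<partial>P) < \<infinity>" .
  qed measurable
  from 1 2 AE_regular show ?thesis
  proof eventually_elim
    case (elim w)
    let ?R = "\<lambda>m. real (T (sq m) w) - real (sq m) - 2 * Bn (sq m) w"
    have R0: "0 \<le> ?R m" for m using T_bounds(1)[OF elim(3), of "sq m"] by linarith
    have "(\<lambda>m. (cB (sq m) w / real (sq m))\<^sup>2) \<longlonglongrightarrow> 0"
      using elim(1) tendsto_ennreal_iff[of "\<lambda>m. (cB (sq m) w / real (sq m))\<^sup>2" sequentially 0] by simp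
    then have c: "(\<lambda>m. cB (sq m) w / real (sq m)) \<longlonglongrightarrow> 0"
      using tendsto_real_sqrt[of _ 0] tendsto_rabs_zero_iff by fastforce
    have "(\<lambda>m. ennreal (?R m / real (sq m))) \<longlonglongrightarrow> 0"
    proof (rule tendsto_sandwich[OF _ _ tendsto_const elim(2)])
      show "eventually (\<lambda>m. ennreal (?R m / real (sq m)) \<le> ennreal (2 / real (sq m)) * Neg (sq m) w) sequentially"
      proof (rule always_eventually, rule allI)
        fix m
        have "ennreal (?R m / real (sq m)) = ennreal (1 / real (sq m)) * ennreal (?R m)"
          using pos[of m] R0[of m] by (simp flip: ennreal_mult)
        also have "\<dots> \<le> ennreal (1 / real (sq m)) * (2 * Neg (sq m) w)"
          by (intro mult_left_mono T_bounds(2)[OF elim(3)]) auto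
        also have "\<dots> = ennreal (2 / real (sq m)) * Neg (sq m) w"
        proof -
          have "ennreal (2 / real (sq m)) = ennreal (1 / real (sq m)) * 2"
            by (simp flip: ennreal_mult ennreal_numeral)
          then show ?thesis by (simp add: mult.assoc)
        qed
        finally show "ennreal (?R m / real (sq m)) \<le> ennreal (2 / real (sq m)) * Neg (sq m) w" .
      qed
    qed auto
    then have R: "(\<lambda>m. ?R m / real (sq m)) \<longlonglongrightarrow> 0"
      using tendsto_ennreal_iff[of "\<lambda>m. ?R m / real (sq m)" sequentially 0] R0 by simp
    have e: "(\<lambda>m. (P.expectation (Bn (sq m)) - real (sq m) * dinf) / real (sq m)) \<longlonglongrightarrow> 0"
    proof (rule Lim_null_comparison)
      show "eventually (\<lambda>m. norm ((P.expectation (Bn (sq m)) - real (sq m) * dinf) / real (sq m)) \<le> sqrt CV / (1 - q) / real (sq m)) sequentially"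
        by (intro always_eventually allI, unfold real_norm_def abs_divide abs_of_nat, intro divide_right_mono expectation_Bn) simp
      have "(\<lambda>m. 1 / real (sq m)) \<longlonglongrightarrow> 0" unfolding sq_def by real_asymp
      from tendsto_mult_left[OF this, of "sqrt CV / (1 - q)"]
      show "(\<lambda>m. sqrt CV / (1 - q) / real (sq m)) \<longlonglongrightarrow> 0" by simp
    qed
    have "(\<lambda>m. 1 + 2 * (cB (sq m) w / real (sq m)) + 2 * ((P.expectation (Bn (sq m)) - real (sq m) * dinf) / real (sq m)) + 2 * dinf + ?R m / real (sq m)) \<longlonglongrightarrow> 1 + 2 * 0 + 2 * 0 + 2 * dinf + 0"
      by (intro tendsto_intros c R e)
    moreover have "real (T (sq m) w) / real (sq m) = 1 + 2 * (cB (sq m) w / real (sq m)) + 2 * ((P.expectation (Bn (sq m)) - real (sq m) * dinf) / real (sq m)) + 2 * dinf + ?R m / real (sq m)" for m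
      using pos[of m] by (simp add: cB_def field_simps)
    ultimately show ?case by (simp add: \<tau>_def)
  qed
qed

theorem AE_transient: "AE w in P. filterlim (\<lambda>n. X n w) at_top sequentially"
  and AE_speed: "AE w in P. (\<lambda>n. real_of_int (X n w) / real n) \<longlonglongrightarrow> 1 / \<tau>"
proof -
  have "AE w in P. filterlim (\<lambda>n. X n w) at_top sequentially \<and> (\<lambda>n. real_of_int (X n w) / real n) \<longlonglongrightarrow> 1 / \<tau>"
    using AE_no_backtrack AE_T_sq AE_regular
  proof eventually_elim
    case (elim w)
    note * = before_T[OF elim(3)] elim(1) T_ge[OF elim(3)] elim(2) \<tau>_pos
    show ?case
      using position_from_hitting_times[where T = "\<lambda>m. T (sq m) w" and X = "\<lambda>n. X n w", OF *] by blast
  qed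
  then show "AE w in P. filterlim (\<lambda>n. X n w) at_top sequentially"
    "AE w in P. (\<lambda>n. real_of_int (X n w) / real n) \<longlonglongrightarrow> 1 / \<tau>" by auto
qed

section \<open>Gaussian limit of the position\<close>

definition s :: real where "s = 2 * \<sigma>"

lemma s_pos: "0 < s" using \<sigma>_pos by (simp add: s_def)

text \<open>The sign is reversed because a late hitting time means a position that lags behind; the
  event \<open>n < T m\<close> thus becomes a lower tail of \<open>U m\<close>.\<close>

definition U :: "nat \<Rightarrow> (int \<Rightarrow> 's) \<Rightarrow> real" where
  "U n w = (real n * \<tau> - real (T n w)) / (s * sqrt (real n))"

lemma U_measurable [measurable]: "U n \<in> borel_measurable P"
  unfolding U_def[abs_def] by measurable

text \<open>\<open>U n\<close> differs from \<open>- cB n / (\<sigma> * sqrt n)\<close> by an error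
  with mean of order \<open>1 / sqrt n\<close>: the two parts of \<open>?K\<close> come from the
  negative sites and from centring by \<open>n * dinf\<close>.\<close>

lemma char_U: "(\<lambda>n. char (distr P borel (U n)) t) \<longlonglongrightarrow> complex_of_real (exp (- (t\<^sup>2) / 2))"
proof -
  let ?g = "\<lambda>n w. cB n w / sqrt (real n)"
  let ?K = "2 * K3 + 2 * (sqrt CV / (1 - q))"
  have add_const: "P.expectation (\<lambda>w. \<bar>f w\<bar> + k) = P.expectation (\<lambda>w. \<bar>f w\<bar>) + k" if "integrable P f" for f :: "(int \<Rightarrow> 's) \<Rightarrow> real" and k
    using that by (simp add: P.prob_space)
  have bound: "cmod (char (distr P borel (U n)) t - char (distr P borel (?g n)) (- t / \<sigma>)) \<le> \<bar>t\<bar> * (?K / (s * sqrt (real n)))"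
    if n: "0 < n" for n
  proof -
    let ?h = "\<lambda>w. (- 1 / \<sigma>) * ?g n w"
    let ?R = "\<lambda>w. real (T n w) - real n - 2 * Bn n w"
    let ?c = "P.expectation (Bn n) - real n * dinf"
    have ceq: "char (distr P borel (?g n)) (- t / \<sigma>) = char (distr P borel ?h) t"
      unfolding char_def by (subst (1 2) integral_distr) auto
    have diff: "U n w - ?h w = - (?R w + 2 * ?c) / (s * sqrt (real n))" for w
      using \<sigma>_pos n by (simp add: U_def s_def \<tau>_def cB_def field_simps)
    have RE: "(\<integral>\<^sup>+w. ennreal (norm (?R w)) \<partial>P) \<le> ennreal (2 * K3)"
    proof -
      have "(\<integral>\<^sup>+w. ennreal (norm (?R w)) \<partial>P) \<le> (\<integral>\<^sup>+w. 2 * Neg n w \<partial>P)"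
      proof (rule nn_integral_mono_AE, use AE_regular in eventually_elim)
        fix w assume "regular w"
        from T_bounds[OF this, of n] show "ennreal (norm (?R w)) \<le> 2 * Neg n w" by simp
      qed
      also have "\<dots> = 2 * (\<integral>\<^sup>+w. Neg n w \<partial>P)" by (rule nn_integral_cmult) measurable
      also have "\<dots> \<le> 2 * ennreal K3" by (intro mult_left_mono nn_integral_Neg) auto
      also have "\<dots> = ennreal (2 * K3)" using K3_nonneg by (simp add: ennreal_mult)
      finally show ?thesis .
    qed
    have Rint: "integrable P ?R"
      using RE by (intro integrableI_bounded) (auto intro: le_less_trans)
    have Rle: "P.expectation (\<lambda>w. \<bar>?R w\<bar>) \<le> 2 * K3"
    proof -
      have "ennreal (P.expectation (\<lambda>w. \<bar>?R w\<bar>)) = (\<integral>\<^sup>+w. ennreal (norm (?R w)) \<partial>P)"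
        using Rint by (subst nn_integral_eq_integral) auto
      also note RE
      finally show ?thesis using K3_nonneg by (simp add: ennreal_le_iff)
    qed
    have "P.expectation (\<lambda>w. \<bar>?R w + 2 * ?c\<bar>) \<le> P.expectation (\<lambda>w. \<bar>?R w\<bar> + 2 * \<bar>?c\<bar>)"
    proof (intro integral_mono integrable_abs Bochner_Integration.integrable_add Rint)
      show "\<bar>?R w + 2 * ?c\<bar> \<le> \<bar>?R w\<bar> + 2 * \<bar>?c\<bar>" for w
        using abs_triangle_ineq[of "?R w" "2 * ?c"] by (simp only: abs_mult abs_numeral)
    qed auto
    also have "\<dots> = P.expectation (\<lambda>w. \<bar>?R w\<bar>) + 2 * \<bar>?c\<bar>"
      by (rule add_const[OF Rint])
    also have "\<dots> \<le> ?K" by (intro add_mono Rle mult_left_mono expectation_Bn) simp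
    finally have le: "P.expectation (\<lambda>w. \<bar>?R w + 2 * ?c\<bar>) \<le> ?K" .
    have eq: "P.expectation (\<lambda>w. \<bar>U n w - ?h w\<bar>) = P.expectation (\<lambda>w. \<bar>?R w + 2 * ?c\<bar>) / (s * sqrt (real n))"
    proof -
      have "\<bar>- (?R w + 2 * ?c) / (s * sqrt (real n))\<bar> = \<bar>?R w + 2 * ?c\<bar> / (s * sqrt (real n))" for w
        unfolding abs_divide abs_minus_cancel using s_pos by simp
      then show ?thesis unfolding diff by (simp only: integral_divide_zero)
    qed
    have "P.expectation (\<lambda>w. \<bar>U n w - ?h w\<bar>) \<le> ?K / (s * sqrt (real n))"
      unfolding eq using le s_pos by (intro divide_right_mono) simp_all
    then have "\<bar>t\<bar> * P.expectation (\<lambda>w. \<bar>U n w - ?h w\<bar>) \<le> \<bar>t\<bar> * (?K / (s * sqrt (real n)))"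
      by (rule mult_left_mono) simp
    moreover have "cmod (char (distr P borel (U n)) t - char (distr P borel ?h) t) \<le> \<bar>t\<bar> * P.expectation (\<lambda>w. \<bar>U n w - ?h w\<bar>)"
    proof (rule P.char_diff_le)
      show "integrable P (\<lambda>w. U n w - ?h w)"
        unfolding diff by (intro Bochner_Integration.integrable_divide Bochner_Integration.integrable_minus
            Bochner_Integration.integrable_add Rint P.integrable_const)
    qed measurable
    ultimately show ?thesis unfolding ceq by linarith
  qed
  have lim: "(\<lambda>n. char (distr P borel (?g n)) (- t / \<sigma>)) \<longlonglongrightarrow> complex_of_real (exp (- (t\<^sup>2) / 2))"
    using clt_cB[of "- t / \<sigma>"] \<sigma>_pos by simp
  have "(\<lambda>n. char (distr P borel (U n)) t - char (distr P borel (?g n)) (- t / \<sigma>)) \<longlonglongrightarrow> 0"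
  proof (rule Lim_null_comparison)
    show "eventually (\<lambda>n. norm (char (distr P borel (U n)) t - char (distr P borel (?g n)) (- t / \<sigma>)) \<le> \<bar>t\<bar> * (?K / (s * sqrt (real n)))) sequentially"
      using eventually_gt_at_top[of 0] by eventually_elim (rule bound)
    show "(\<lambda>n. \<bar>t\<bar> * (?K / (s * sqrt (real n)))) \<longlonglongrightarrow> 0"
    proof -
      have "(\<lambda>n. 1 / sqrt (real n)) \<longlonglongrightarrow> 0" by real_asymp
      from tendsto_mult_left[OF this, of "\<bar>t\<bar> * (?K / s)"] show ?thesis by simp
    qed
  qed
  from tendsto_add[OF this lim] show ?thesis by simp
qed

lemma P_U_tendsto: "(\<lambda>n. measure P {w. U n w \<le> y}) \<longlonglongrightarrow> Phi y"
  using P.tendsto_Phi_iff_char[of U] char_U by (simp add: space_P)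

lemma T_gt_iff:
  assumes "0 < m"
  shows "n < T m w \<longleftrightarrow> U m w \<le> (real m * \<tau> - real n - 1) / (s * sqrt (real m))"
proof -
  have "n < T m w \<longleftrightarrow> real n + 1 \<le> real (T m w)" by linarith
  also have "\<dots> \<longleftrightarrow> U m w \<le> (real m * \<tau> - real n - 1) / (s * sqrt (real m))"
  proof -
    have "0 < s * sqrt (real m)" using assms s_pos by simp
    then have "U m w \<le> (real m * \<tau> - real n - 1) / (s * sqrt (real m)) \<longleftrightarrow> real m * \<tau> - real (T m w) \<le> real m * \<tau> - real n - 1"
      unfolding U_def by (subst divide_le_cancel) auto
    then show ?thesis by linarith
  qed
  finally show ?thesis .
qed

text \<open>At a level \<open>n / \<tau> + x * b * sqrt n\<close> the normalised argument of
  \<open>U\<close> tends to \<open>x * b * \<tau> / (s * sqrt (1 / \<tau>))\<close>. It equals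
  \<open>x\<close> exactly for \<open>b = s / (\<tau> * sqrt \<tau>)\<close>, which is where the
  scaling of the position comes from.\<close>

lemma T_gt_tendsto:
  assumes m: "(\<lambda>n. (real (m n) - real n / \<tau>) / sqrt (real n)) \<longlonglongrightarrow> x * (s / (\<tau> * sqrt \<tau>))"
  shows "(\<lambda>n. measure P {w. n < T (m n) w}) \<longlonglongrightarrow> Phi x"
proof -
  have r: "(\<lambda>n. real (m n) / real n) \<longlonglongrightarrow> 1 / \<tau>"
  proof -
    have z: "(\<lambda>n. 1 / sqrt (real n)) \<longlonglongrightarrow> 0" by real_asymp
    have "(\<lambda>n. (real (m n) - real n / \<tau>) / sqrt (real n) * (1 / sqrt (real n)) + 1 / \<tau>) \<longlonglongrightarrow> x * (s / (\<tau> * sqrt \<tau>)) * 0 + 1 / \<tau>"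
      by (intro tendsto_intros m z)
    moreover have "eventually (\<lambda>n. (real (m n) - real n / \<tau>) / sqrt (real n) * (1 / sqrt (real n)) + 1 / \<tau> = real (m n) / real n) sequentially"
      using eventually_gt_at_top[of 0] by eventually_elim (simp add: diff_divide_distrib mult.assoc)
    ultimately show ?thesis using Lim_transform_eventually by force
  qed
  have inf: "filterlim m at_top sequentially"
  proof -
    have "filterlim (\<lambda>n. real (m n) / real n * real n) at_top sequentially"
      using \<tau>_pos by (intro filterlim_tendsto_pos_mult_at_top[OF r] filterlim_real_sequentially) auto
    moreover have "eventually (\<lambda>n. real (m n) / real n * real n = real (m n)) sequentially"
      using eventually_gt_at_top[of 0] by eventually_elim simp
    ultimately have "filterlim (\<lambda>n. real (m n)) at_top sequentially"
      using filterlim_cong[OF refl refl] by force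
    then show ?thesis by (simp add: filterlim_sequentially_iff_filterlim_real)
  qed
  have y: "(\<lambda>n. (real (m n) * \<tau> - real n - 1) / (s * sqrt (real (m n)))) \<longlonglongrightarrow> x"
  proof -
    have z: "(\<lambda>n. 1 / sqrt (real n)) \<longlonglongrightarrow> 0" by real_asymp
    have "(\<lambda>n. ((real (m n) - real n / \<tau>) / sqrt (real n) * \<tau> - 1 / sqrt (real n)) / (s * sqrt (real (m n) / real n)))
       \<longlonglongrightarrow> (x * (s / (\<tau> * sqrt \<tau>)) * \<tau> - 0) / (s * sqrt (1 / \<tau>))"
      using s_pos \<tau>_pos by (intro tendsto_intros m z r) auto
    also have "(x * (s / (\<tau> * sqrt \<tau>)) * \<tau> - 0) / (s * sqrt (1 / \<tau>)) = x"
      using s_pos \<tau>_pos by (simp add: real_sqrt_divide)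
    finally have l: "(\<lambda>n. ((real (m n) - real n / \<tau>) / sqrt (real n) * \<tau> - 1 / sqrt (real n)) / (s * sqrt (real (m n) / real n))) \<longlonglongrightarrow> x" .
    have "eventually (\<lambda>n. ((real (m n) - real n / \<tau>) / sqrt (real n) * \<tau> - 1 / sqrt (real n)) / (s * sqrt (real (m n) / real n))
       = (real (m n) * \<tau> - real n - 1) / (s * sqrt (real (m n)))) sequentially"
      using eventually_gt_at_top[of 0]
    proof eventually_elim
      case (elim n)
      have "((real (m n) - real n / \<tau>) / sqrt (real n) * \<tau> - 1 / sqrt (real n)) = (real (m n) * \<tau> - real n - 1) / sqrt (real n)"
        using \<tau>_pos elim by (simp add: field_simps)
      then show ?case using elim by (simp add: real_sqrt_divide)
    qed
    with l show ?thesis using Lim_transform_eventually by force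
  qed
  have "(\<lambda>n. measure P {w. U (m n) w \<le> (real (m n) * \<tau> - real n - 1) / (s * sqrt (real (m n)))}) \<longlonglongrightarrow> Phi x"
  proof (rule tendsto_mono_locally_uniform[where G = "\<lambda>n y. measure P {w. U n w \<le> y}" and m = m, OF _ P_U_tendsto isCont_Phi inf y])
    fix n
    have "{w. U n w \<le> y} \<in> sets P" for y
    proof -
      have "{w \<in> space P. U n w \<le> y} \<in> sets P" by measurable
      then show ?thesis by (simp add: space_P)
    qed
    then show "mono (\<lambda>y. P.prob {w. U n w \<le> y})"
      by (intro monoI P.finite_measure_mono) auto
  qed
  moreover have "eventually (\<lambda>n. measure P {w. U (m n) w \<le> (real (m n) * \<tau> - real n - 1) / (s * sqrt (real (m n)))} = measure P {w. n < T (m n) w}) sequentially"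
    using inf unfolding filterlim_at_top
    by (rule eventually_mono[OF spec[of _ 1]]) (simp add: T_gt_iff)
  ultimately show ?thesis using Lim_transform_eventually by force
qed

text \<open>If level \<open>m\<close> has not been hit by time \<open>n\<close>, the position is
  below \<open>m\<close>. Conversely, a position below \<open>m\<close> means that level
  \<open>m + r\<close> is still ahead, or that the walk has come back a distance \<open>r\<close>,
  which has probability at most of order \<open>q ^ r\<close>.\<close>

theorem position_clt:
  "(\<lambda>n. measure P {w. (real_of_int (X n w) - real n * (1 / \<tau>)) / (s / (\<tau> * sqrt \<tau>) * sqrt (real n)) \<le> x}) \<longlonglongrightarrow> Phi x"
proof -
  define b where "b = s / (\<tau> * sqrt \<tau>)"
  have b: "0 < b" using s_pos \<tau>_pos by (simp add: b_def)
  \<comment> \<open>The position is an integer, so lying at most at the real threshold is the same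
    as lying strictly below its floor plus one.\<close>
  define l where "l n = \<lfloor>real n / \<tau> + x * b * sqrt (real n)\<rfloor> + 1" for n :: nat
  define m where "m n = nat (l n)" for n :: nat
  \<comment> \<open>The fourth root tends to infinity, which makes backtracking unlikely, yet is
    negligible against \<open>sqrt n\<close>, so the shifted level has the same limit.\<close>
  define r where "r n = nat \<lfloor>sqrt (sqrt (real n))\<rfloor>" for n :: nat
  have r_bounds: "sqrt (sqrt (real n)) - 1 \<le> real (r n)" "real (r n) \<le> sqrt (sqrt (real n))" for n
  proof -
    have "0 \<le> sqrt (sqrt (real n))" by simp
    then show "sqrt (sqrt (real n)) - 1 \<le> real (r n)" "real (r n) \<le> sqrt (sqrt (real n))"
      unfolding r_def by linarith+
  qed
  have lpos: "eventually (\<lambda>n. 0 < l n) sequentially"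
  proof -
    have "filterlim (\<lambda>n. sqrt (real n)) at_top sequentially" by real_asymp
    then have "eventually (\<lambda>n. \<bar>x * b\<bar> * \<tau> \<le> sqrt (real n)) sequentially"
      unfolding filterlim_at_top by blast
    then have "eventually (\<lambda>n. 0 \<le> real n / \<tau> + x * b * sqrt (real n)) sequentially"
    proof eventually_elim
      case (elim n)
      then have "\<bar>x * b\<bar> \<le> sqrt (real n) / \<tau>" using \<tau>_pos by (simp add: field_simps)
      then have "0 \<le> sqrt (real n) * (sqrt (real n) / \<tau> + x * b)" by (intro mult_nonneg_nonneg) (auto simp: abs_le_iff)
      also have "\<dots> = (sqrt (real n) * sqrt (real n)) / \<tau> + x * b * sqrt (real n)" by (simp add: algebra_simps)
      finally show ?case by simp
    qed
    then show ?thesis unfolding l_def by eventually_elim linarith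
  qed
  have z: "(\<lambda>n. 1 / sqrt (real n)) \<longlonglongrightarrow> 0" by real_asymp
  have ev: "eventually (\<lambda>n. real (m n) = real_of_int (l n)) sequentially"
    using lpos by eventually_elim (simp add: m_def)
  have m_lim: "(\<lambda>n. (real (m n) - real n / \<tau>) / sqrt (real n)) \<longlonglongrightarrow> x * b"
  proof (rule tendsto_sandwich)
    show "eventually (\<lambda>n. x * b \<le> (real (m n) - real n / \<tau>) / sqrt (real n)) sequentially"
      using ev eventually_gt_at_top[of 0]
    proof eventually_elim
      case (elim n)
      have "x * b * sqrt (real n) \<le> real (m n) - real n / \<tau>" unfolding elim(1) l_def by linarith
      then show ?case using elim by (simp add: field_simps)
    qed
    show "eventually (\<lambda>n. (real (m n) - real n / \<tau>) / sqrt (real n) \<le> x * b + 1 / sqrt (real n)) sequentially"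
      using ev eventually_gt_at_top[of 0]
    proof eventually_elim
      case (elim n)
      have "real (m n) - real n / \<tau> \<le> x * b * sqrt (real n) + 1" unfolding elim(1) l_def by linarith
      then have "(real (m n) - real n / \<tau>) / sqrt (real n) \<le> (x * b * sqrt (real n) + 1) / sqrt (real n)"
        by (rule divide_right_mono) simp
      then show ?case using elim by (simp add: add_divide_distrib)
    qed
    show "(\<lambda>n. x * b + 1 / sqrt (real n)) \<longlonglongrightarrow> x * b" using tendsto_add[OF tendsto_const z, of "x * b"] by simp
  qed simp
  have r_lim: "(\<lambda>n. real (r n) / sqrt (real n)) \<longlonglongrightarrow> 0"
  proof (rule tendsto_sandwich[OF _ _ tendsto_const])
    show "eventually (\<lambda>n. real (r n) / sqrt (real n) \<le> sqrt (sqrt (real n)) / sqrt (real n)) sequentially"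
      by (intro always_eventually allI divide_right_mono r_bounds) auto
    show "(\<lambda>n. sqrt (sqrt (real n)) / sqrt (real n)) \<longlonglongrightarrow> 0" by real_asymp
  qed auto
  have mr_lim: "(\<lambda>n. (real (m n + r n) - real n / \<tau>) / sqrt (real n)) \<longlonglongrightarrow> x * b"
    using tendsto_add[OF m_lim r_lim] by (simp add: add_divide_distrib diff_divide_distrib algebra_simps)
  have r_inf: "filterlim r at_top sequentially"
  proof -
    have "filterlim (\<lambda>n. sqrt (sqrt (real n)) - 1) at_top sequentially" by real_asymp
    then have "filterlim (\<lambda>n. real (r n)) at_top sequentially"
      by (rule filterlim_at_top_mono) (intro always_eventually allI r_bounds)
    then show ?thesis by (simp add: filterlim_sequentially_iff_filterlim_real)
  qed
  have Xev: "{w. (real_of_int (X n w) - real n * (1 / \<tau>)) / (b * sqrt (real n)) \<le> x} = {w. X n w < l n}" if "0 < n" for n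
  proof -
    have "(real_of_int (X n w) - real n * (1 / \<tau>)) / (b * sqrt (real n)) \<le> x \<longleftrightarrow> real_of_int (X n w) \<le> real n / \<tau> + x * b * sqrt (real n)" for w
      using that b by (simp add: divide_le_eq algebra_simps)
    also have "\<dots> w \<longleftrightarrow> X n w < l n" for w unfolding l_def by (simp add: le_floor_iff less_le) linarith
    finally show ?thesis by auto
  qed
  have sets: "{w. X n w < c} \<in> sets P" "{w. n < T k w} \<in> sets P" "{w. 1 \<le> bk k y w} \<in> sets P" for n c k y
  proof -
    have "{w \<in> space P. X n w < c} \<in> sets P" "{w \<in> space P. n < T k w} \<in> sets P" "{w \<in> space P. 1 \<le> bk k y w} \<in> sets P"
      by measurable
    then show "{w. X n w < c} \<in> sets P" "{w. n < T k w} \<in> sets P" "{w. 1 \<le> bk k y w} \<in> sets P"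
      by (simp_all add: space_P)
  qed
  have bk_le: "measure P {w. 1 \<le> bk k y w} \<le> sqrt CV * q ^ (k - y)" if "y \<le> k" for k y
  proof -
    have "emeasure P {w. 1 \<le> bk k y w} = (\<integral>\<^sup>+w. indicator {w. 1 \<le> bk k y w} w \<partial>P)"
      using sets by simp
    also have "\<dots> \<le> (\<integral>\<^sup>+w. bk k y w \<partial>P)" by (intro nn_integral_mono) (auto simp: indicator_def)
    also have "\<dots> \<le> ennreal (sqrt CV * q ^ (k - y))" by (rule nn_integral_bk[OF that])
    finally show ?thesis using q CV_nonneg by (simp add: P.emeasure_eq_measure ennreal_le_iff)
  qed
  have lower: "measure P {w. n < T (m n) w} \<le> measure P {w. X n w < l n}" if "0 < l n" for n
  proof (rule P.finite_measure_mono_AE, use AE_regular in eventually_elim)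
    fix w assume "regular w"
    then show "w \<in> {w. n < T (m n) w} \<longrightarrow> w \<in> {w. X n w < l n}"
      using before_T[of w n "m n"] that by (simp add: m_def)
  qed (rule sets)
  have upper: "measure P {w. X n w < l n} \<le> measure P {w. n < T (m n + r n) w} + sqrt CV * q ^ r n" if "0 < l n" for n
  proof -
    have "measure P {w. X n w < l n} \<le> measure P ({w. n < T (m n + r n) w} \<union> {w. 1 \<le> bk (m n + r n) (m n) w})"
    proof (rule P.finite_measure_mono_AE, use AE_regular in eventually_elim)
      fix w assume "regular w"
      then show "w \<in> {w. X n w < l n} \<longrightarrow> w \<in> {w. n < T (m n + r n) w} \<union> {w. 1 \<le> bk (m n + r n) (m n) w}"
        using backtrack[of w "m n" "m n + r n" n] that by (cases "n < T (m n + r n) w") (simp_all add: m_def)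
    qed (intro sets.Un sets)
    also have "\<dots> \<le> measure P {w. n < T (m n + r n) w} + measure P {w. 1 \<le> bk (m n + r n) (m n) w}"
      by (intro measure_Un_le sets)
    also have "measure P {w. 1 \<le> bk (m n + r n) (m n) w} \<le> sqrt CV * q ^ r n"
      using bk_le[of "m n" "m n + r n"] by simp
    finally show ?thesis by simp
  qed
  have qr: "(\<lambda>n. sqrt CV * q ^ r n) \<longlonglongrightarrow> sqrt CV * 0"
    using q by (intro tendsto_mult tendsto_const filterlim_compose[OF LIMSEQ_power_zero r_inf]) auto
  have "(\<lambda>n. measure P {w. X n w < l n}) \<longlonglongrightarrow> Phi x"
  proof (rule tendsto_sandwich)
    show "eventually (\<lambda>n. measure P {w. n < T (m n) w} \<le> measure P {w. X n w < l n}) sequentially"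
      using lpos by eventually_elim (rule lower)
    show "eventually (\<lambda>n. measure P {w. X n w < l n} \<le> measure P {w. n < T (m n + r n) w} + sqrt CV * q ^ r n) sequentially"
      using lpos by eventually_elim (rule upper)
    show "(\<lambda>n. measure P {w. n < T (m n) w}) \<longlonglongrightarrow> Phi x"
      using m_lim unfolding b_def by (rule T_gt_tendsto)
    have "(\<lambda>n. measure P {w. n < T (m n + r n) w}) \<longlonglongrightarrow> Phi x"
      using mr_lim unfolding b_def by (rule T_gt_tendsto)
    from tendsto_add[OF this qr] show "(\<lambda>n. measure P {w. n < T (m n + r n) w} + sqrt CV * q ^ r n) \<longlonglongrightarrow> Phi x"
      by simp
  qed
  moreover have "eventually (\<lambda>n. measure P {w. X n w < l n} = measure P {w. (real_of_int (X n w) - real n * (1 / \<tau>)) / (b * sqrt (real n)) \<le> x}) sequentially"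
    using eventually_gt_at_top[of 0] by eventually_elim (simp only: Xev)
  ultimately show ?thesis unfolding b_def[symmetric] using Lim_transform_eventually by force
qed

end

section \<open>Finite Markov chains with a unique closed irreducible class\<close>

text \<open>Take a nonempty closed subset of least cardinality: the states reachable from any of its
  elements form a nonempty closed subset of it, hence all of it.\<close>

lemma closed_set_contains_irreducible:
  assumes "closed_set N K S" "S \<noteq> {}"
  shows "\<exists>C\<subseteq>S. closed_irreducible N K C"
proof -
  define c where "c = (LEAST n. \<exists>C\<subseteq>S. closed_set N K C \<and> C \<noteq> {} \<and> card C = n)"
  have "\<exists>n. \<exists>C\<subseteq>S. closed_set N K C \<and> C \<noteq> {} \<and> card C = n" using assms by blast
  then have "\<exists>C\<subseteq>S. closed_set N K C \<and> C \<noteq> {} \<and> card C = c" unfolding c_def by (rule LeastI_ex)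
  then obtain C where C: "C \<subseteq> S" "closed_set N K C" "C \<noteq> {}" "card C = c" by blast
  have min: "c \<le> card C'" if "C' \<subseteq> S" "closed_set N K C'" "C' \<noteq> {}" for C'
    unfolding c_def using that by (intro Least_le) blast
  have CN: "C \<subseteq> {1..N}" using C by (simp add: closed_set_def)
  then have fin: "finite C" using finite_subset by blast
  have "(i, j) \<in> (trans_edges N K)\<^sup>*" if ij: "i \<in> C" "j \<in> C" for i j
  proof -
    define Rch where "Rch = {l. (i, l) \<in> (trans_edges N K)\<^sup>*}"
    have sub: "Rch \<subseteq> C"
    proof
      fix l assume "l \<in> Rch"
      then have "(i, l) \<in> (trans_edges N K)\<^sup>*" by (simp add: Rch_def)
      then show "l \<in> C"
      proof (induction rule: rtrancl_induct)
        case base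
        then show ?case using ij by simp
      next
        case (step y z)
        then show ?case using C(2) by (auto simp: trans_edges_def closed_set_def)
      qed
    qed
    have "closed_set N K Rch"
      unfolding closed_set_def
    proof (intro conjI ballI impI)
      show "Rch \<subseteq> {1..N}" using sub CN by blast
      fix l m assume l: "l \<in> Rch" "m \<in> {1..N}" "0 < K l m"
      then have "(l, m) \<in> trans_edges N K" using sub CN by (auto simp: trans_edges_def)
      then show "m \<in> Rch" using l unfolding Rch_def by (auto intro: rtrancl_into_rtrancl)
    qed
    moreover have "i \<in> Rch" by (simp add: Rch_def)
    ultimately have "card C \<le> card Rch" using min[of Rch] sub C by auto
    then have "Rch = C" using sub fin by (simp add: card_seteq)
    then show ?thesis using ij unfolding Rch_def by blast
  qed
  then have "closed_irreducible N K C" using C unfolding closed_irreducible_def by blast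
  then show ?thesis using C by blast
qed

text \<open>The positive part of an invariant vector is at most its image under the chain, and total
  mass is preserved, so it is itself invariant. Mass cannot leave the support of an invariant
  nonnegative vector.\<close>

lemma invariant_positive_part_closed:
  fixes \<delta> :: "nat \<Rightarrow> real"
  assumes K: "stochastic N K" and inv: "\<forall>j\<in>{1..N}. (\<Sum>i=1..N. \<delta> i * K i j) = \<delta> j"
  shows "closed_set N K {i\<in>{1..N}. 0 < \<delta> i}"
proof -
  let ?d = "\<lambda>i. max 0 (\<delta> i)"
  have K0: "0 \<le> K i j" if "i \<in> {1..N}" "j \<in> {1..N}" for i j using K that by (auto simp: stochastic_def)
  have K1: "(\<Sum>j=1..N. K i j) = 1" if "i \<in> {1..N}" for i using K that by (auto simp: stochastic_def)
  have le: "?d j \<le> (\<Sum>i=1..N. ?d i * K i j)" if j: "j \<in> {1..N}" for j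
  proof -
    have "(\<Sum>i=1..N. \<delta> i * K i j) \<le> (\<Sum>i=1..N. ?d i * K i j)"
      using K0 j by (intro sum_mono mult_right_mono) auto
    moreover have "0 \<le> (\<Sum>i=1..N. ?d i * K i j)" using K0 j by (intro sum_nonneg mult_nonneg_nonneg) auto
    ultimately show ?thesis using inv j by auto
  qed
  have "(\<Sum>j=1..N. \<Sum>i=1..N. ?d i * K i j) = (\<Sum>i=1..N. \<Sum>j=1..N. ?d i * K i j)" by (rule sum.swap)
  also have "\<dots> = (\<Sum>i=1..N. ?d i)" using K1 by (intro sum.cong) (auto simp: sum_distrib_left[symmetric])
  finally have "(\<Sum>j=1..N. (\<Sum>i=1..N. ?d i * K i j) - ?d j) = 0" by (simp add: sum_subtractf)
  then have "\<forall>j\<in>{1..N}. (\<Sum>i=1..N. ?d i * K i j) - ?d j = 0"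
    using le by (subst (asm) sum_nonneg_eq_0_iff) auto
  then have eq: "(\<Sum>i=1..N. ?d i * K i j) = ?d j" if "j \<in> {1..N}" for j using that by auto
  show ?thesis
    unfolding closed_set_def
  proof (intro conjI ballI impI)
    fix i j assume i: "i \<in> {i \<in> {1..N}. 0 < \<delta> i}" and j: "j \<in> {1..N}" and "0 < K i j"
    then have "0 < ?d i * K i j" by auto
    also have "\<dots> \<le> (\<Sum>i=1..N. ?d i * K i j)"
      using i j K0 by (intro member_le_sum mult_nonneg_nonneg) auto
    also have "\<dots> = ?d j" by (rule eq[OF j])
    finally show "j \<in> {i \<in> {1..N}. 0 < \<delta> i}" using j by auto
  qed auto
qed

text \<open>If two stationary vectors differed, their difference, of total mass zero, would be
  positive somewhere and negative somewhere. Both sets are closed and disjoint, and each would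
  contain a closed irreducible class.\<close>

lemma stationary_unique:
  assumes K: "stochastic N K" and ex1: "\<exists>!R0. closed_irreducible N K R0"
    and \<mu>: "stationary N K \<mu>" and \<nu>: "stationary N K \<nu>" and i: "i \<in> {1..N}"
  shows "\<mu> i = \<nu> i"
proof -
  let ?S = "\<lambda>a b. {i\<in>{1..N}. 0 < a i - (b i :: real)}"
  have closed: "closed_set N K (?S a b)" if "stationary N K a" "stationary N K b" for a b
    using that K by (intro invariant_positive_part_closed) (auto simp: stationary_def left_diff_distrib sum_subtractf)
  have nonempty: "?S b a \<noteq> {}" if ab: "stationary N K a" "stationary N K b" and ne: "?S a b \<noteq> {}" for a b
  proof
    assume emp: "?S b a = {}"
    have "(\<Sum>i=1..N. a i - b i) = 0" using ab by (simp add: stationary_def prob_vector_def sum_subtractf)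
    moreover have "0 \<le> a i - b i" if "i \<in> {1..N}" for i using emp that by fastforce
    ultimately have "\<forall>i\<in>{1..N}. a i - b i = 0" by (subst (asm) sum_nonneg_eq_0_iff) auto
    then show False using ne by auto
  qed
  have empty: "?S a b = {}" if ab: "stationary N K a" "stationary N K b" for a b
  proof (rule ccontr)
    assume ne: "?S a b \<noteq> {}"
    obtain C where C: "C \<subseteq> ?S a b" "closed_irreducible N K C"
      using closed_set_contains_irreducible[OF closed[OF ab] ne] by blast
    obtain C' where C': "C' \<subseteq> ?S b a" "closed_irreducible N K C'"
      using closed_set_contains_irreducible[OF closed[OF ab(2,1)] nonempty[OF ab ne]] by blast
    have "C = C'" using ex1 C(2) C'(2) by blast
    moreover have "C \<noteq> {}" using C(2) by (simp add: closed_irreducible_def)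
    ultimately show False using C(1) C'(1) by fastforce
  qed
  show ?thesis using empty[OF \<mu> \<nu>] empty[OF \<nu> \<mu>] i by fastforce
qed

lemma convergent_subseq_finite:
  fixes f :: "nat \<Rightarrow> 'a \<Rightarrow> real"
  assumes "finite J" and "\<And>n j. j \<in> J \<Longrightarrow> \<bar>f n j\<bar> \<le> B"
  shows "\<exists>r::nat\<Rightarrow>nat. strict_mono r \<and> (\<forall>j\<in>J. convergent (\<lambda>n. f (r n) j))"
  using assms
proof (induction J rule: finite_induct)
  case empty
  then show ?case by (auto intro!: exI[of _ id] simp: strict_mono_def)
next
  case (insert x J)
  obtain r :: "nat \<Rightarrow> nat" where r: "strict_mono r" "\<forall>j\<in>J. convergent (\<lambda>n. f (r n) j)" using insert by auto
  have "bounded (range (\<lambda>n. f (r n) x))"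
    using insert.prems[of x] by (intro boundedI[of _ B]) auto
  then obtain l r' where r': "strict_mono r'" "((\<lambda>n. f (r n) x) \<circ> r') \<longlonglongrightarrow> l"
    using bounded_imp_convergent_subsequence by blast
  have "strict_mono (r \<circ> r')" using r(1) r'(1) by (rule strict_mono_o)
  moreover have "convergent (\<lambda>n. f ((r \<circ> r') n) j)" if j: "j \<in> insert x J" for j
  proof (cases "j = x")
    case True
    then show ?thesis using r'(2) by (auto simp: convergent_def comp_def)
  next
    case False
    then obtain l where "(\<lambda>n. f (r n) j) \<longlonglongrightarrow> l" using r(2) j by (auto simp: convergent_def)
    from LIMSEQ_subseq_LIMSEQ[OF this r'(1)] show ?thesis by (auto simp: convergent_def comp_def)
  qed
  ultimately show ?case by blast
qed

section \<open>Cesaro averages and the drift corrector\<close>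

definition Kop :: "nat \<Rightarrow> (nat \<Rightarrow> nat \<Rightarrow> real) \<Rightarrow> (nat \<Rightarrow> real) \<Rightarrow> nat \<Rightarrow> real" where
  "Kop N K f r = (\<Sum>j=1..N. K r j * f j)"

primrec step_law :: "nat \<Rightarrow> (nat \<Rightarrow> nat \<Rightarrow> real) \<Rightarrow> nat \<Rightarrow> nat \<Rightarrow> nat \<Rightarrow> real" where
  "step_law N K r 0 j = (if j = r then 1 else 0)"
| "step_law N K r (Suc n) j = (\<Sum>i=1..N. step_law N K r n i * K i j)"

lemma step_law_Kop: "r \<in> {1..N} \<Longrightarrow> (\<Sum>j=1..N. step_law N K r n j * f j) = (Kop N K ^^ n) f r"
proof (induction n arbitrary: f)
  case 0
  have "(\<Sum>j=1..N. step_law N K r 0 j * f j) = (\<Sum>j=1..N. if j = r then f j else 0)" by (intro sum.cong) auto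
  then show ?case using 0 by simp
next
  case (Suc n)
  have "(\<Sum>j=1..N. step_law N K r (Suc n) j * f j) = (\<Sum>j=1..N. \<Sum>i=1..N. step_law N K r n i * (K i j * f j))"
    by (simp add: sum_distrib_right mult.assoc)
  also have "\<dots> = (\<Sum>i=1..N. \<Sum>j=1..N. step_law N K r n i * (K i j * f j))" by (rule sum.swap)
  also have "\<dots> = (\<Sum>i=1..N. step_law N K r n i * Kop N K f i)" by (simp add: Kop_def sum_distrib_left)
  also have "\<dots> = (Kop N K ^^ n) (Kop N K f) r" using Suc by blast
  finally show ?case by (simp add: funpow_swap1)
qed

lemma step_law_prob:
  assumes K: "stochastic N K" and r: "r \<in> {1..N}"
  shows "prob_vector N (step_law N K r n)"
proof (induction n)
  case 0
  then show ?case using r by (simp add: prob_vector_def)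
next
  case (Suc n)
  have K0: "0 \<le> K i j" if "i \<in> {1..N}" "j \<in> {1..N}" for i j using K that by (auto simp: stochastic_def)
  have "(\<Sum>j=1..N. \<Sum>i=1..N. step_law N K r n i * K i j) = (\<Sum>i=1..N. \<Sum>j=1..N. step_law N K r n i * K i j)" by (rule sum.swap)
  also have "\<dots> = (\<Sum>i=1..N. step_law N K r n i)"
    using K by (intro sum.cong) (auto simp: sum_distrib_left[symmetric] stochastic_def)
  finally show ?case using Suc K0 by (auto simp: prob_vector_def intro!: sum_nonneg mult_nonneg_nonneg)
qed

text \<open>If the Cesaro averages failed to exceed \<open>c\<close>, a limit point of the occupation measures would be
  a second stationary distribution.\<close>

lemma cesaro_average_gt:
  assumes K: "stochastic N K" and ex1: "\<exists>!R0. closed_irreducible N K R0"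
    and \<mu>: "stationary N K \<mu>" and c: "c < (\<Sum>i=1..N. \<mu> i * g i)"
  shows "\<exists>n>0. \<forall>r\<in>{1..N}. c < (\<Sum>i<n. (Kop N K ^^ i) g r) / real n"
proof (rule ccontr)
  assume "\<not> ?thesis"
  then have "\<forall>n. \<exists>r\<in>{1..N}. (\<Sum>i<Suc n. (Kop N K ^^ i) g r) / real (Suc n) \<le> c"
    by (meson not_less zero_less_Suc)
  then obtain r where r: "\<And>n. r n \<in> {1..N}" "\<And>n. (\<Sum>i<Suc n. (Kop N K ^^ i) g (r n)) / real (Suc n) \<le> c"
    by metis
  define \<nu> where "\<nu> n j = (\<Sum>i<Suc n. step_law N K (r n) i j) / real (Suc n)" for n j
  have pv: "prob_vector N (step_law N K (r n) i)" for n i using step_law_prob[OF K r(1)] .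
  have row0: "0 \<le> step_law N K (r n) i j" if "j \<in> {1..N}" for n i j using pv[of n i] that by (auto simp: prob_vector_def)
  have row1: "step_law N K (r n) i j \<le> 1" if "j \<in> {1..N}" for n i j
  proof -
    have "step_law N K (r n) i j \<le> (\<Sum>j=1..N. step_law N K (r n) i j)" using that row0 by (intro member_le_sum) auto
    then show ?thesis using pv[of n i] by (simp add: prob_vector_def)
  qed
  have \<nu>0: "0 \<le> \<nu> n j" if "j \<in> {1..N}" for n j
    unfolding \<nu>_def using row0 that by (intro divide_nonneg_nonneg sum_nonneg) auto
  have \<nu>1: "(\<Sum>j=1..N. \<nu> n j) = 1" for n
  proof -
    have "(\<Sum>j=1..N. \<nu> n j) = (\<Sum>j=1..N. \<Sum>i<Suc n. step_law N K (r n) i j) / real (Suc n)"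
      by (simp only: \<nu>_def sum_divide_distrib)
    also have "(\<Sum>j=1..N. \<Sum>i<Suc n. step_law N K (r n) i j) = (\<Sum>i<Suc n. \<Sum>j=1..N. step_law N K (r n) i j)" by (rule sum.swap)
    also have "\<dots> = real (Suc n)" using pv by (simp add: prob_vector_def)
    finally show ?thesis by simp
  qed
  have \<nu>g: "(\<Sum>j=1..N. \<nu> n j * g j) \<le> c" for n
  proof -
    have "\<nu> n j * g j = (\<Sum>i<Suc n. step_law N K (r n) i j * g j) / real (Suc n)" for j
      by (simp only: \<nu>_def sum_distrib_right times_divide_eq_left)
    then have "(\<Sum>j=1..N. \<nu> n j * g j) = (\<Sum>j=1..N. \<Sum>i<Suc n. step_law N K (r n) i j * g j) / real (Suc n)"
      by (simp only: sum_divide_distrib)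
    also have "(\<Sum>j=1..N. \<Sum>i<Suc n. step_law N K (r n) i j * g j) = (\<Sum>i<Suc n. \<Sum>j=1..N. step_law N K (r n) i j * g j)" by (rule sum.swap)
    also have "\<dots> = (\<Sum>i<Suc n. (Kop N K ^^ i) g (r n))" using step_law_Kop[OF r(1)] by simp
    finally show ?thesis using r(2)[of n] by simp
  qed
  \<comment> \<open>Moving an occupation measure one step along the chain telescopes: only the first
    and the last law survive, and their entries lie between 0 and 1. Every limit point is therefore
    invariant.\<close>
  have \<nu>K: "\<bar>(\<Sum>i=1..N. \<nu> n i * K i j) - \<nu> n j\<bar> \<le> 1 / real (Suc n)" if j: "j \<in> {1..N}" for n j
  proof -
    have "\<nu> n i * K i j = (\<Sum>l<Suc n. step_law N K (r n) l i * K i j) / real (Suc n)" for i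
      by (simp only: \<nu>_def sum_distrib_right times_divide_eq_left)
    then have "(\<Sum>i=1..N. \<nu> n i * K i j) = (\<Sum>i=1..N. \<Sum>l<Suc n. step_law N K (r n) l i * K i j) / real (Suc n)"
      by (simp only: sum_divide_distrib)
    also have "(\<Sum>i=1..N. \<Sum>l<Suc n. step_law N K (r n) l i * K i j) = (\<Sum>l<Suc n. \<Sum>i=1..N. step_law N K (r n) l i * K i j)" by (rule sum.swap)
    also have "\<dots> = (\<Sum>l<Suc n. step_law N K (r n) (Suc l) j)" by simp
    finally have "(\<Sum>i=1..N. \<nu> n i * K i j) - \<nu> n j = ((\<Sum>l<Suc n. step_law N K (r n) (Suc l) j) - (\<Sum>l<Suc n. step_law N K (r n) l j)) / real (Suc n)"
      unfolding \<nu>_def by (simp only: diff_divide_distrib)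
    also have "(\<Sum>l<Suc n. step_law N K (r n) (Suc l) j) - (\<Sum>l<Suc n. step_law N K (r n) l j) = step_law N K (r n) (Suc n) j - step_law N K (r n) 0 j"
      unfolding sum_subtractf[symmetric] by (rule sum_lessThan_telescope)
    finally show ?thesis
      using row0[OF j, of n "Suc n"] row1[OF j, of n "Suc n"] row0[OF j, of n 0] row1[OF j, of n 0]
      by (simp only: abs_divide) (intro divide_mono, auto simp: abs_le_iff simp del: step_law.simps)
  qed
  have "\<bar>\<nu> n j\<bar> \<le> 1" if j: "j \<in> {1..N}" for n j
  proof -
    have "\<nu> n j \<le> (\<Sum>j=1..N. \<nu> n j)" using j \<nu>0 by (intro member_le_sum) auto
    then show ?thesis using \<nu>0[OF j, of n] \<nu>1[of n] by simp
  qed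
  then obtain t :: "nat \<Rightarrow> nat" where t: "strict_mono t" "\<And>j. j \<in> {1..N} \<Longrightarrow> convergent (\<lambda>n. \<nu> (t n) j)"
    using convergent_subseq_finite[of "{1..N}" \<nu> 1] by auto
  define \<nu>' where "\<nu>' j = lim (\<lambda>n. \<nu> (t n) j)" for j
  have lim: "(\<lambda>n. \<nu> (t n) j) \<longlonglongrightarrow> \<nu>' j" if "j \<in> {1..N}" for j
    using t(2)[OF that] by (simp add: \<nu>'_def convergent_LIMSEQ_iff)
  have "stationary N K \<nu>'"
    unfolding stationary_def prob_vector_def
  proof (intro conjI ballI)
    show "0 \<le> \<nu>' i" if "i \<in> {1..N}" for i
      using LIMSEQ_le_const[OF lim[OF that]] \<nu>0[OF that] by blast
    have "(\<lambda>n. \<Sum>i=1..N. \<nu> (t n) i) \<longlonglongrightarrow> (\<Sum>i=1..N. \<nu>' i)" by (intro tendsto_sum lim)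
    then show "(\<Sum>i=1..N. \<nu>' i) = 1" using LIMSEQ_unique[OF _ tendsto_const[of 1]] by (simp only: \<nu>1)
    fix j assume j: "j \<in> {1..N}"
    have "(\<lambda>n. (\<Sum>i=1..N. \<nu> (t n) i * K i j) - \<nu> (t n) j) \<longlonglongrightarrow> (\<Sum>i=1..N. \<nu>' i * K i j) - \<nu>' j"
      by (intro tendsto_intros lim j)
    moreover have "(\<lambda>n. (\<Sum>i=1..N. \<nu> (t n) i * K i j) - \<nu> (t n) j) \<longlonglongrightarrow> 0"
    proof (rule Lim_null_comparison)
      show "eventually (\<lambda>n. norm ((\<Sum>i=1..N. \<nu> (t n) i * K i j) - \<nu> (t n) j) \<le> 1 / real (Suc (t n))) sequentially"
        using \<nu>K[OF j] by (intro always_eventually) simp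
      have "(\<lambda>n. 1 / real (Suc n)) \<longlonglongrightarrow> 0" by real_asymp
      from LIMSEQ_subseq_LIMSEQ[OF this t(1)] show "(\<lambda>n. 1 / real (Suc (t n))) \<longlonglongrightarrow> 0" by (simp add: comp_def)
    qed
    ultimately show "(\<Sum>i=1..N. \<nu>' i * K i j) = \<nu>' j" using LIMSEQ_unique by force
  qed
  then have eq: "\<nu>' i = \<mu> i" if "i \<in> {1..N}" for i using stationary_unique[OF K ex1 _ \<mu> that] by blast
  have "(\<lambda>n. \<Sum>j=1..N. \<nu> (t n) j * g j) \<longlonglongrightarrow> (\<Sum>j=1..N. \<nu>' j * g j)"
    by (intro tendsto_intros lim)
  then have "(\<Sum>j=1..N. \<nu>' j * g j) \<le> c" using \<nu>g by (intro LIMSEQ_le_const2) auto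
  moreover have "(\<Sum>j=1..N. \<nu>' j * g j) = (\<Sum>j=1..N. \<mu> j * g j)" using eq by (intro sum.cong) auto
  ultimately show False using c by simp
qed

lemma Kop_sum: "Kop N K (\<lambda>r. \<Sum>i\<in>I. a i * f i r) r = (\<Sum>i\<in>I. a i * Kop N K (f i) r)"
proof -
  have "Kop N K (\<lambda>r. \<Sum>i\<in>I. a i * f i r) r = (\<Sum>j=1..N. \<Sum>i\<in>I. a i * (K r j * f i j))"
    unfolding Kop_def by (simp add: sum_distrib_left mult.left_commute)
  also have "\<dots> = (\<Sum>i\<in>I. \<Sum>j=1..N. a i * (K r j * f i j))" by (rule sum.swap)
  finally show ?thesis by (simp add: Kop_def sum_distrib_left)
qed

text \<open>An approximate Poisson equation. The linearly decreasing weights in \<open>h\<close> are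
  chosen by summation by parts so that \<open>g + Kop N K h - h\<close> becomes the Cesaro average
  of length \<open>n\<close>, which exceeds \<open>c\<close> from every state.\<close>

lemma drift_function:
  assumes K: "stochastic N K" and ex1: "\<exists>!R0. closed_irreducible N K R0"
    and \<mu>: "stationary N K \<mu>" and c: "c < (\<Sum>i=1..N. \<mu> i * g i)"
  shows "\<exists>h. \<forall>r\<in>{1..N}. c < g r + Kop N K h r - h r"
proof -
  obtain n where n: "0 < n" "\<And>r. r \<in> {1..N} \<Longrightarrow> c < (\<Sum>i<n. (Kop N K ^^ i) g r) / real n"
    using cesaro_average_gt[OF assms] by blast
  let ?u = "\<lambda>i. (Kop N K ^^ i) g"
  define h where "h r = (\<Sum>i<n. (1 - real (Suc i) / real n) * ?u i r)" for r
  have "g r + Kop N K h r - h r = (\<Sum>i<n. ?u i r) / real n" for r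
  proof -
    let ?f = "\<lambda>i. (1 - real i / real n) * ?u i r"
    have "Kop N K h r = (\<Sum>i<n. ?f (Suc i))"
      unfolding h_def[abs_def] Kop_sum by simp
    moreover have "(\<Sum>i<Suc n. ?f i) = ?f 0 + (\<Sum>i<n. ?f (Suc i))" by (rule sum.lessThan_Suc_shift)
    moreover have "?f n = 0" using n by simp
    moreover have "(\<Sum>i<Suc n. ?f i) = (\<Sum>i<n. ?f i) + ?f n" by simp
    moreover have "?f 0 = g r" by simp
    ultimately have "Kop N K h r + g r = (\<Sum>i<n. ?f i)" by linarith
    then have "g r + Kop N K h r - h r = (\<Sum>i<n. ?f i - (1 - real (Suc i) / real n) * ?u i r)"
      by (simp only: h_def sum_subtractf)
    also have "\<dots> = (\<Sum>i<n. ?u i r / real n)"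
      using n by (intro sum.cong refl) (simp add: field_simps)
    finally show ?thesis by (simp add: sum_divide_distrib)
  qed
  then show ?thesis using n(2) by (intro exI[of _ h]) auto
qed

section \<open>Uniform variables and sampling from a distribution\<close>

lemma space_unif: "space unif = UNIV" and sets_unif [measurable_cong]: "sets unif = sets borel"
  by (simp_all add: unif_def)

lemma prob_space_unif: "prob_space unif"
  unfolding unif_def by (rule prob_space_uniform_measure) auto

lemma nn_integral_unif:
  assumes [measurable]: "f \<in> borel_measurable borel"
  shows "(\<integral>\<^sup>+u. f u \<partial>unif) = (\<integral>\<^sup>+u. f u * indicator {0..<1} u \<partial>lborel)"
proof -
  have "(\<integral>\<^sup>+u. f u \<partial>unif) = (\<integral>\<^sup>+u. f u * indicator {0..1} u \<partial>lborel)"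
    unfolding unif_def by (subst nn_integral_uniform_measure) (auto simp: divide_ennreal_def)
  also have "\<dots> = (\<integral>\<^sup>+u. f u * indicator {0..<1} u \<partial>lborel)"
    using AE_lborel_singleton[of "1::real"]
    by (intro nn_integral_cong_AE) (auto elim!: eventually_mono simp: indicator_def)
  finally show ?thesis .
qed

lemma emeasure_unif_Ico:
  assumes "0 \<le> a" "a \<le> b" "b \<le> 1" shows "emeasure unif {a..<b} = ennreal (b - a)"
proof -
  have "emeasure unif {a..<b} = (\<integral>\<^sup>+u. indicator {a..<b} u \<partial>unif)"
    by (subst nn_integral_indicator) (auto simp: sets_unif)
  also have "\<dots> = (\<integral>\<^sup>+u. indicator {a..<b} u * indicator {0..<1} u \<partial>lborel)"
    by (rule nn_integral_unif) simp
  also have "\<dots> = (\<integral>\<^sup>+u. indicator {a..<b} u \<partial>lborel)"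
    using assms by (intro nn_integral_cong) (auto simp: indicator_def)
  also have "\<dots> = ennreal (b - a)" using assms by simp
  finally show ?thesis .
qed

lemma AE_unif: "AE u in unif. 0 \<le> u \<and> u < 1"
proof -
  interpret prob_space unif by (rule prob_space_unif)
  have "emeasure unif {0..<1} = 1" using emeasure_unif_Ico[of 0 1] by simp
  then have "AE u in unif. u \<in> {0..<1::real}"
    by (intro AE_prob_1) (simp add: emeasure_eq_measure)
  then show ?thesis by auto
qed

lemma sample_range: "1 \<le> N \<Longrightarrow> sample N q u \<in> {1..N}"
proof (cases "\<exists>r\<in>{1..N}. u < (\<Sum>s=1..r. q s)")
  case True
  then obtain r where "1 \<le> r \<and> r \<le> N \<and> u < (\<Sum>s=1..r. q s)" by auto
  from LeastI[of "\<lambda>r. 1 \<le> r \<and> r \<le> N \<and> u < (\<Sum>s=1..r. q s)", OF this]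
  show ?thesis unfolding sample_def using True by simp
qed (auto simp: sample_def)

lemma sample_measurable [measurable]: "sample N q \<in> measurable borel (count_space UNIV)"
  unfolding sample_def[abs_def] by measurable

lemma sample_eq_iff:
  assumes q: "prob_vector N q" and i: "i \<in> {1..N}" and u: "0 \<le> u" "u < 1"
  shows "sample N q u = i \<longleftrightarrow> (\<Sum>s=1..i-1. q s) \<le> u \<and> u < (\<Sum>s=1..i. q s)"
proof -
  let ?c = "\<lambda>r. \<Sum>s=1..r. q s"
  have mono: "?c a \<le> ?c b" if "a \<le> b" "b \<le> N" for a b
    using q that by (intro sum_mono2) (auto simp: prob_vector_def)
  have ex: "\<exists>r\<in>{1..N}. u < ?c r" using q u i by (intro bexI[of _ N]) (auto simp: prob_vector_def)
  then have s: "sample N q u = (LEAST r. 1 \<le> r \<and> r \<le> N \<and> u < ?c r)" by (simp add: sample_def)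
  have "\<exists>r. 1 \<le> r \<and> r \<le> N \<and> u < ?c r" using ex by auto
  from LeastI_ex[OF this] have L: "1 \<le> sample N q u \<and> sample N q u \<le> N \<and> u < ?c (sample N q u)"
    by (simp only: s)
  moreover have "?c (sample N q u - 1) \<le> u"
  proof (cases "sample N q u = 1")
    case True
    then show ?thesis using u by simp
  next
    case False
    then have "sample N q u - 1 < (LEAST r. 1 \<le> r \<and> r \<le> N \<and> u < ?c r)" using L unfolding s[symmetric] by linarith
    from not_less_Least[OF this] show ?thesis using False L by auto
  qed
  ultimately have S: "1 \<le> sample N q u" "sample N q u \<le> N" "?c (sample N q u - 1) \<le> u" "u < ?c (sample N q u)" by auto
  show ?thesis
  proof
    assume "sample N q u = i"
    then show "?c (i - 1) \<le> u \<and> u < ?c i" using S by auto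
  next
    assume a: "?c (i - 1) \<le> u \<and> u < ?c i"
    have "\<not> sample N q u < i"
    proof
      assume "sample N q u < i"
      then have "?c (sample N q u) \<le> ?c (i - 1)" using i by (intro mono) auto
      then show False using a S by linarith
    qed
    moreover have "\<not> i < sample N q u"
    proof
      assume "i < sample N q u"
      then have "?c i \<le> ?c (sample N q u - 1)" using S by (intro mono) auto
      then show False using a S by linarith
    qed
    ultimately show "sample N q u = i" by simp
  qed
qed

lemma emeasure_sample:
  assumes q: "prob_vector N q" and i: "i \<in> {1..N}"
  shows "emeasure unif {u. sample N q u = i} = ennreal (q i)"
proof -
  let ?c = "\<lambda>r. \<Sum>s=1..r. q s"
  have mono: "?c a \<le> ?c b" if "a \<le> b" "b \<le> N" for a b
    using q that by (intro sum_mono2) (auto simp: prob_vector_def)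
  have "emeasure unif {u. sample N q u = i} = emeasure unif {?c (i - 1)..<?c i}"
  proof (rule emeasure_eq_AE)
    show "AE u in unif. u \<in> {u. sample N q u = i} \<longleftrightarrow> u \<in> {?c (i - 1)..<?c i}"
      using AE_unif by eventually_elim (simp add: sample_eq_iff[OF q i])
    have "{u \<in> space borel. sample N q u = i} \<in> sets borel" by measurable
    then show "{u. sample N q u = i} \<in> sets unif" by (simp add: sets_unif)
  qed (simp add: sets_unif)
  also have "\<dots> = ennreal (?c i - ?c (i - 1))"
  proof (rule emeasure_unif_Ico)
    show "0 \<le> ?c (i - 1)" using q i by (intro sum_nonneg) (auto simp: prob_vector_def)
    show "?c (i - 1) \<le> ?c i" using mono i by simp
    show "?c i \<le> 1" using mono[of i N] i q by (simp add: prob_vector_def)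
  qed
  also have "?c i - ?c (i - 1) = q i" using i by (cases i) auto
  finally show ?thesis .
qed

lemma nn_integral_sample:
  fixes f :: "nat \<Rightarrow> ennreal"
  assumes N: "1 \<le> N" and q: "prob_vector N q"
  shows "(\<integral>\<^sup>+u. f (sample N q u) \<partial>unif) = (\<Sum>i=1..N. ennreal (q i) * f i)"
proof -
  have sets: "{u. sample N q u = i} \<in> sets unif" for i
  proof -
    have "{u \<in> space borel. sample N q u = i} \<in> sets borel" by measurable
    then show ?thesis by (simp add: sets_unif)
  qed
  have "(\<integral>\<^sup>+u. f (sample N q u) \<partial>unif) = (\<integral>\<^sup>+u. (\<Sum>i=1..N. f i * indicator {u. sample N q u = i} u) \<partial>unif)"
  proof (rule nn_integral_cong)
    fix u
    have "(\<Sum>i=1..N. f i * indicator {u. sample N q u = i} u) = (\<Sum>i=1..N. if i = sample N q u then f i else 0)"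
      by (intro sum.cong) (auto simp: indicator_def)
    also have "\<dots> = f (sample N q u)" using sample_range[OF N, of q u] by simp
    finally show "f (sample N q u) = (\<Sum>i=1..N. f i * indicator {u. sample N q u = i} u)" ..
  qed
  also have "\<dots> = (\<Sum>i=1..N. f i * emeasure unif {u. sample N q u = i})"
    using sets by (subst nn_integral_sum) (auto simp: nn_integral_cmult_indicator)
  also have "\<dots> = (\<Sum>i=1..N. ennreal (q i) * f i)"
    by (intro sum.cong refl) (simp add: emeasure_sample[OF q] mult.commute)
  finally show ?thesis .
qed

text \<open>An affine image of a uniform variable realises its conditioning to an interval; clamping makes the
  image lie in that interval everywhere and not only almost surely.\<close>

definition unit_clamp :: "real \<Rightarrow> real" where "unit_clamp u = (if 0 \<le> u \<and> u < 1 then u else 0)"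

lemma unit_clamp: "0 \<le> unit_clamp u" "unit_clamp u < 1" by (auto simp: unit_clamp_def)

lemma unit_clamp_measurable [measurable]: "unit_clamp \<in> borel_measurable borel"
  unfolding unit_clamp_def[abs_def] by measurable

lemma nn_integral_affine_unit_clamp:
  fixes f :: "real \<Rightarrow> ennreal"
  assumes [measurable]: "f \<in> borel_measurable borel" and "0 \<le> a" "0 < c" "a + c \<le> 1"
  shows "(\<integral>\<^sup>+u. f (a + c * unit_clamp u) \<partial>unif) = ennreal (1 / c) * (\<integral>\<^sup>+u. indicator {a..<a + c} u * f u \<partial>unif)"
proof -
  have "(\<integral>\<^sup>+u. indicator {a..<a + c} u * f u \<partial>unif) = (\<integral>\<^sup>+u. indicator {a..<a + c} u * f u * indicator {0..<1} u \<partial>lborel)"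
    by (rule nn_integral_unif) measurable
  also have "\<dots> = (\<integral>\<^sup>+u. indicator {a..<a + c} u * f u \<partial>lborel)"
    using assms by (intro nn_integral_cong) (auto simp: indicator_def)
  also have "\<dots> = ennreal \<bar>c\<bar> * (\<integral>\<^sup>+x. indicator {a..<a + c} (a + c * x) * f (a + c * x) \<partial>lborel)"
    using assms by (intro nn_integral_real_affine) auto
  also have "(\<integral>\<^sup>+x. indicator {a..<a + c} (a + c * x) * f (a + c * x) \<partial>lborel)
     = (\<integral>\<^sup>+x. f (a + c * unit_clamp x) * indicator {0..<1} x \<partial>lborel)"
    using assms by (intro nn_integral_cong) (auto simp: indicator_def unit_clamp_def zero_le_mult_iff mult_less_cancel_left1)
  also have "\<dots> = (\<integral>\<^sup>+u. f (a + c * unit_clamp u) \<partial>unif)"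
    by (rule nn_integral_unif[symmetric]) measurable
  finally have "ennreal (1 / c) * (\<integral>\<^sup>+u. indicator {a..<a + c} u * f u \<partial>unif) = ennreal (1 / c) * (ennreal \<bar>c\<bar> * (\<integral>\<^sup>+u. f (a + c * unit_clamp u) \<partial>unif))"
    by simp
  also have "\<dots> = (\<integral>\<^sup>+u. f (a + c * unit_clamp u) \<partial>unif)"
    using assms by (simp add: mult.assoc[symmetric] ennreal_mult[symmetric])
  finally show ?thesis ..
qed

section \<open>Markovian stacks\<close>

lemma exp_le_quadratic: "exp (- y) \<le> 1 - y + y\<^sup>2" if "\<bar>y\<bar> \<le> 1" for y :: real
proof (cases "y \<le> 0")
  case True
  then show ?thesis using exp_bound[of "- y"] that by simp
next
  case False
  \<comment> \<open>For positive \<open>y\<close> the claim is multiplied by \<open>exp y\<close>,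
    of which the quadratic Taylor polynomial is a lower bound.\<close>
  have "1 \<le> (1 - y + y\<^sup>2) * (1 + y + y\<^sup>2 / 2)"
  proof -
    have "(1 - y + y\<^sup>2) * (1 + y + y\<^sup>2 / 2) = 1 + y\<^sup>2 / 2 + y ^ 3 / 2 + y ^ 4 / 2"
      by (simp add: field_simps power2_eq_square power3_eq_cube power4_eq_xxxx)
    then show ?thesis using False by simp
  qed
  also have "\<dots> \<le> (1 - y + y\<^sup>2) * exp y"
    using False exp_lower_Taylor_quadratic[of y] that by (intro mult_left_mono) auto
  finally show ?thesis by (simp add: exp_minus field_simps)
qed

text \<open>\<open>right\<close> selects the favoured direction, so that both signs of the drift are
  treated together. \<open>h\<close> is the corrector of the approximate Poisson equation, and the
  surplus \<open>\<delta>\<close> over \<open>c\<close> pays for the second-order term of the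
  exponential.\<close>

locale markov_stack =
  fixes N :: nat and K :: "nat \<Rightarrow> nat \<Rightarrow> real" and \<eta> p h :: "nat \<Rightarrow> real" and right :: bool and c \<delta> :: real
  assumes N: "1 \<le> N" and K: "stochastic N K" and \<eta>: "prob_vector N \<eta>"
    and p: "\<And>i. i \<in> {1..N} \<Longrightarrow> 0 < p i \<and> p i < 1"
    and c: "1 / 2 < c" "c < 1" and \<delta>: "0 < \<delta>"
    and drift: "\<And>r. r \<in> {1..N} \<Longrightarrow> c + \<delta> \<le> (if right then p r else 1 - p r) + Kop N K h r - h r"
begin

definition Q :: "(nat + nat \<Rightarrow> real) measure" where "Q = PiM UNIV (\<lambda>_. unif)"

definition R :: "nat \<Rightarrow> (nat + nat \<Rightarrow> real) \<Rightarrow> nat" where "R j s = chain N K \<eta> (\<lambda>i. s (Inl i)) j"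

text \<open>If \<open>right\<close> is false the arrows are reversed, so \<open>True\<close> marks
  the favoured direction in both cases; the reflected walk is the one analysed.\<close>

definition arr :: "(nat + nat \<Rightarrow> real) \<Rightarrow> nat \<Rightarrow> bool" where
  "arr s j \<longleftrightarrow> (s (Inr j) < p (R j s)) = right"

definition gp :: "bool \<Rightarrow> nat \<Rightarrow> real" where "gp b r = (if b = right then p r else 1 - p r)"

sublocale Q: prob_space Q
  unfolding Q_def by (rule prob_space_PiM_UNIV[OF prob_space_unif space_unif])

lemma space_Q: "space Q = UNIV"
  unfolding Q_def by (rule space_PiM_UNIV[OF prob_space_unif space_unif])

lemma coord_measurable [measurable]: "(\<lambda>s. s i) \<in> borel_measurable Q"
  using measurable_PiM_coord[of i unif] unfolding Q_def by (simp cong: measurable_cong_sets add: sets_unif)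

lemma resample: "f \<in> borel_measurable Q \<Longrightarrow> (\<integral>\<^sup>+s. f s \<partial>Q) = (\<integral>\<^sup>+s. \<integral>\<^sup>+u. f (s(i := u)) \<partial>unif \<partial>Q)"
  unfolding Q_def by (rule nn_integral_PiM_resample[OF prob_space_unif space_unif])

lemma update_measurable:
  assumes [measurable]: "f \<in> borel_measurable Q" shows "(\<lambda>s. s(i := f s)) \<in> measurable Q Q"
proof -
  have "(\<lambda>s. (s(i := f s)) k) \<in> measurable Q unif" for k
    using assms coord_measurable[of k] by (cases "k = i") (simp_all cong: measurable_cong_sets add: sets_unif)
  then show ?thesis unfolding Q_def by (intro measurable_into_PiM space_unif)
qed

lemma R_0: "R 0 s = sample N \<eta> (s (Inl 0))" and R_Suc: "R (Suc j) s = sample N (K (R j s)) (s (Inl (Suc j)))"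
  by (simp_all add: R_def)

lemma R_range: "R j s \<in> {1..N}"
  using sample_range[OF N] by (cases j) (simp_all only: R_0 R_Suc)

lemma R_measurable [measurable]: "R j \<in> measurable Q (count_space UNIV)"
proof (induction j)
  case 0
  show ?case unfolding R_0[abs_def] by measurable
next
  case (Suc j)
  show ?case unfolding R_Suc[abs_def]
    by (rule measurable_compose_countable[where f = "\<lambda>r s. sample N (K r) (s (Inl (Suc j)))", OF _ Suc]) measurable
qed

lemma p_R_measurable [measurable]: "(\<lambda>s. p (R j s)) \<in> borel_measurable Q"
  and h_R_measurable [measurable]: "(\<lambda>s. h (R j s)) \<in> borel_measurable Q"
  and gp_R_measurable [measurable]: "(\<lambda>s. gp b (R j s)) \<in> borel_measurable Q"
  and K_R_measurable [measurable]: "(\<lambda>s. K (R j s) i) \<in> borel_measurable Q"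
  by (rule measurable_compose[OF R_measurable], simp)+

lemma R_upd_Inr [simp]: "R j (s(Inr i := u)) = R j s"
  by (induction j) (simp_all add: R_0 R_Suc)

lemma R_upd_Inl: "j < i \<Longrightarrow> R j (s(Inl i := u)) = R j s"
  by (induction j) (simp_all add: R_0 R_Suc)

lemma arr_measurable [measurable]: "Measurable.pred Q (\<lambda>s. arr s j)"
  unfolding arr_def by measurable

lemma arr_upd_Inl: "j < i \<Longrightarrow> arr (s(Inl i := u)) j = arr s j"
  by (simp add: arr_def R_upd_Inl)

lemma arr_upd_Inr: "j \<noteq> i \<Longrightarrow> arr (s(Inr i := u)) j = arr s j"
  by (simp add: arr_def)

lemma ones_cong: "(\<And>j. j < n \<Longrightarrow> a j = b j) \<Longrightarrow> ones a n = ones b n"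
  unfolding ones_def by (metis (mono_tags, lifting) Collect_cong)

lemma ones_measurable [measurable]: "(\<lambda>s. ones (arr s) n) \<in> measurable Q (count_space UNIV)"
  by (induction n) (simp_all add: ones_Suc)

lemma real_ones_measurable [measurable]: "(\<lambda>s. real (ones (arr s) n)) \<in> borel_measurable Q"
  by (rule measurable_compose[OF ones_measurable]) simp

lemma K_row: "r \<in> {1..N} \<Longrightarrow> prob_vector N (K r)"
  using K by (simp add: stochastic_def prob_vector_def)

lemma gp_bounds: "r \<in> {1..N} \<Longrightarrow> 0 < gp b r \<and> gp b r < 1"
  using p[of r] by (auto simp: gp_def)

lemma gp_False: "gp False r = 1 - gp True r"
  by (auto simp: gp_def)

lemma nn_integral_arrow:
  assumes r: "r \<in> {1..N}"
  shows "(\<integral>\<^sup>+u. f ((u < p r) = right) \<partial>unif) = ennreal (gp True r) * f True + ennreal (gp False r) * f False"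
proof -
  have pr: "0 < p r" "p r < 1" using p[OF r] by auto
  have "(\<integral>\<^sup>+u. f ((u < p r) = right) \<partial>unif) = (\<integral>\<^sup>+u. f right * indicator {0..<p r} u + f (\<not> right) * indicator {p r..<1} u \<partial>unif)"
    by (rule nn_integral_cong_AE, rule AE_mp[OF AE_unif], rule AE_I2) (auto simp: indicator_def)
  also have "\<dots> = f right * emeasure unif {0..<p r} + f (\<not> right) * emeasure unif {p r..<1}"
  proof -
    have m: "(\<lambda>u. x * indicator {a..<b} u) \<in> borel_measurable unif" for x :: ennreal and a b :: real
      by (intro borel_measurable_times_ennreal borel_measurable_indicator borel_measurable_const) (simp add: sets_unif)
    show ?thesis by (subst nn_integral_add[OF m m]) (simp add: nn_integral_cmult_indicator sets_unif)
  qed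
  also have "\<dots> = ennreal (p r) * f right + ennreal (1 - p r) * f (\<not> right)"
    using pr by (simp add: emeasure_unif_Ico mult.commute)
  also have "\<dots> = ennreal (gp True r) * f True + ennreal (gp False r) * f False"
    unfolding gp_def by (cases right) (simp_all add: add.commute)
  finally show ?thesis .
qed

section \<open>Exponential supermartingale for the number of right arrows\<close>

definition H :: real where "H = (\<Sum>j=1..N. \<bar>h j\<bar>)"

lemma H: "j \<in> {1..N} \<Longrightarrow> \<bar>h j\<bar> \<le> H" "0 \<le> H"
  unfolding H_def by (auto intro!: member_le_sum sum_nonneg)

text \<open>\<open>1 + 2 * H\<close> bounds one increment of the corrected count. The choice keeps
  the exponent in the range of the quadratic bound and makes the second-order term at most
  \<open>l * \<delta>\<close>, the gain from the drift.\<close>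

definition l :: real where "l = min \<delta> 1 / (1 + 2 * H)\<^sup>2"

lemma l: "0 < l" "l * (1 + 2 * H) \<le> 1" "l * (1 + 2 * H)\<^sup>2 \<le> \<delta>"
proof -
  let ?M = "1 + 2 * H"
  have M: "1 \<le> ?M" using H(2) by simp
  then have M2: "0 < ?M\<^sup>2" by (simp add: zero_less_power)
  show "0 < l" using \<delta> M2 by (simp add: l_def)
  have lM: "l * ?M\<^sup>2 = min \<delta> 1" using M2 by (simp add: l_def)
  then show "l * ?M\<^sup>2 \<le> \<delta>" by simp
  have "l * ?M * 1 \<le> l * ?M * ?M" using M \<open>0 < l\<close> by (intro mult_left_mono) auto
  also have "\<dots> \<le> 1" using lM by (simp add: power2_eq_square mult.assoc)
  finally show "l * ?M \<le> 1" by simp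
qed

text \<open>Expanding to second order, the mean of the linear term is at least
  \<open>l * \<delta>\<close> by the drift condition, and this absorbs the quadratic error.\<close>

lemma one_step:
  assumes r: "r \<in> {1..N}"
  shows "(gp True r * exp (- l * (1 - c)) + gp False r * exp (l * c)) * ((\<Sum>j=1..N. K r j * exp (- l * h j)) * exp (l * h r)) \<le> 1"
proof -
  let ?M = "1 + 2 * H"
  have e: "exp (- (l * (b - c + h j - h r))) \<le> 1 - l * (b - c + h j - h r) + (l * ?M)\<^sup>2" if "b \<in> {0, 1}" "j \<in> {1..N}" for b j
  proof -
    have "\<bar>b - c + h j - h r\<bar> \<le> ?M" using that H(1)[OF r] H(1)[of j] c by (auto simp: abs_le_iff)
    then have *: "\<bar>l * (b - c + h j - h r)\<bar> \<le> l * ?M" using l by (simp add: abs_mult)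
    then have "exp (- (l * (b - c + h j - h r))) \<le> 1 - l * (b - c + h j - h r) + (l * (b - c + h j - h r))\<^sup>2"
      using l by (intro exp_le_quadratic) linarith
    also have "(l * (b - c + h j - h r))\<^sup>2 \<le> (l * ?M)\<^sup>2"
      using * by (simp add: abs_le_square_iff[symmetric])
    finally show ?thesis by simp
  qed
  have K0: "0 \<le> K r j" if "j \<in> {1..N}" for j using K_row[OF r] that by (auto simp: prob_vector_def)
  have K1: "(\<Sum>j=1..N. K r j) = 1" using K_row[OF r] by (simp add: prob_vector_def)
  have S: "(\<Sum>j=1..N. K r j * exp (- l * h j)) * exp (l * h r) * exp (- l * (b - c)) \<le> 1 - l * (b - c + Kop N K h r - h r) + (l * ?M)\<^sup>2" if b: "b \<in> {0, 1}" for b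
  proof -
    have "(\<Sum>j=1..N. K r j * exp (- l * h j)) * exp (l * h r) * exp (- l * (b - c)) = (\<Sum>j=1..N. K r j * exp (- (l * (b - c + h j - h r))))"
      unfolding sum_distrib_right by (intro sum.cong refl) (simp add: algebra_simps flip: exp_add)
    also have "\<dots> \<le> (\<Sum>j=1..N. K r j * (1 - l * (b - c + h j - h r) + (l * ?M)\<^sup>2))"
      using K0 by (intro sum_mono mult_left_mono e b) auto
    also have "\<dots> = (\<Sum>j=1..N. (1 - l * (b - c - h r) + (l * ?M)\<^sup>2) * K r j - l * (K r j * h j))"
      by (intro sum.cong refl) (simp add: algebra_simps)
    also have "\<dots> = (1 - l * (b - c - h r) + (l * ?M)\<^sup>2) * (\<Sum>j=1..N. K r j) - l * Kop N K h r"
      by (simp only: sum_subtractf sum_distrib_left Kop_def)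
    also have "\<dots> = 1 - l * (b - c + Kop N K h r - h r) + (l * ?M)\<^sup>2"
      unfolding K1 by (simp add: algebra_simps)
    finally show ?thesis .
  qed
  let ?E = "(\<Sum>j=1..N. K r j * exp (- l * h j)) * exp (l * h r)"
  have "(gp True r * exp (- l * (1 - c)) + gp False r * exp (l * c)) * ?E
     = gp True r * (?E * exp (- l * (1 - c))) + gp False r * (?E * exp (- l * (0 - c)))"
    by (simp add: algebra_simps)
  also have "\<dots> \<le> gp True r * (1 - l * (1 - c + Kop N K h r - h r) + (l * ?M)\<^sup>2) + gp False r * (1 - l * (0 - c + Kop N K h r - h r) + (l * ?M)\<^sup>2)"
    using gp_bounds[OF r] by (intro add_mono mult_left_mono S) (auto simp: less_imp_le)
  also have "\<dots> = 1 - l * (gp True r + Kop N K h r - h r - c) + l * (l * ?M\<^sup>2)"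
    unfolding gp_False by (simp add: algebra_simps power2_eq_square)
  also have "\<dots> \<le> 1 - l * \<delta> + l * \<delta>"
  proof (intro add_mono diff_mono order_refl mult_left_mono)
    show "\<delta> \<le> gp True r + Kop N K h r - h r - c" using drift[OF r] by (auto simp: gp_def)
  qed (use l in auto)
  finally show ?thesis by simp
qed

text \<open>The raw count has a drift that depends on the cookie state; adding
  \<open>h (R n s)\<close> makes the drift above \<open>c\<close> uniform.\<close>

definition W :: "nat \<Rightarrow> (nat + nat \<Rightarrow> real) \<Rightarrow> real" where
  "W n s = exp (- l * (real (ones (arr s) n) - c * real n + h (R n s)))"

lemma W_measurable [measurable]: "W n \<in> borel_measurable Q"
  unfolding W_def[abs_def] by measurable

lemma W_Suc: "W (Suc n) s = W n s * exp (l * h (R n s)) * exp (- l * ((if arr s n then 1 else 0) - c)) * exp (- l * h (R (Suc n) s))"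
  unfolding W_def exp_add[symmetric] by (auto simp: ones_Suc algebra_simps)

lemma W_upd_Inl: "W n (s(Inl (Suc n) := u)) = W n s"
proof -
  have "ones (arr (s(Inl (Suc n) := u))) n = ones (arr s) n" by (intro ones_cong arr_upd_Inl) simp
  then show ?thesis by (simp add: W_def R_upd_Inl)
qed

lemma W_upd_Inr: "W n (s(Inr n := u)) = W n s"
proof -
  have "ones (arr (s(Inr n := u))) n = ones (arr s) n" by (intro ones_cong arr_upd_Inr) simp
  then show ?thesis by (simp add: W_def)
qed

text \<open>The coordinates are integrated in reverse order of use: first the uniform that chooses
  the next state, given the coin, and then the coin itself. The two factors that appear are those of
  \<open>one_step\<close>.\<close>

lemma nn_integral_W_Suc: "(\<integral>\<^sup>+s. ennreal (W (Suc n) s) \<partial>Q) \<le> (\<integral>\<^sup>+s. ennreal (W n s) \<partial>Q)"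
proof -
  let ?a = "\<lambda>b. exp (- l * ((if b then 1 else 0) - c))"
  let ?E = "\<lambda>r. (\<Sum>j=1..N. K r j * exp (- l * h j))"
  let ?w = "\<lambda>s. W n s * exp (l * h (R n s))"
  have K0: "0 \<le> K r j" if "r \<in> {1..N}" "j \<in> {1..N}" for r j using K_row[OF that(1)] that by (auto simp: prob_vector_def)
  have E0: "0 \<le> ?E (R n s)" for s using K0[OF R_range] by (intro sum_nonneg mult_nonneg_nonneg) auto
  have w0: "0 \<le> ?w s" for s by (simp add: W_def)
  have "(\<integral>\<^sup>+s. ennreal (W (Suc n) s) \<partial>Q) = (\<integral>\<^sup>+s. \<integral>\<^sup>+u. ennreal (W (Suc n) (s(Inl (Suc n) := u))) \<partial>unif \<partial>Q)"
    by (rule resample) measurable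
  also have "\<dots> = (\<integral>\<^sup>+s. \<integral>\<^sup>+u. ennreal (?w s * ?a (arr s n)) * ennreal (exp (- l * h (sample N (K (R n s)) u))) \<partial>unif \<partial>Q)"
    using w0 by (intro nn_integral_cong)
      (simp add: W_Suc W_upd_Inl R_upd_Inl arr_upd_Inl R_Suc flip: ennreal_mult del: mult_minus_left)
  also have "\<dots> = (\<integral>\<^sup>+s. ennreal (?w s * ?a (arr s n)) * ennreal (?E (R n s)) \<partial>Q)"
  proof (intro nn_integral_cong)
    fix s
    have [measurable]: "(\<lambda>u. exp (- l * h (sample N (K (R n s)) u))) \<in> borel_measurable unif"
    proof -
      have [measurable]: "(\<lambda>u. h (sample N (K (R n s)) u)) \<in> borel_measurable borel"
        by (rule measurable_compose[OF sample_measurable]) simp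
      have "(\<lambda>u. exp (- l * h (sample N (K (R n s)) u))) \<in> borel_measurable borel" by measurable
      then show ?thesis by (simp cong: measurable_cong_sets add: sets_unif)
    qed
    have "(\<integral>\<^sup>+u. ennreal (exp (- l * h (sample N (K (R n s)) u))) \<partial>unif) = (\<Sum>j=1..N. ennreal (K (R n s) j) * ennreal (exp (- l * h j)))"
      by (rule nn_integral_sample[OF N K_row[OF R_range]])
    also have "\<dots> = ennreal (?E (R n s))"
      using K0[OF R_range] by (subst sum_ennreal[symmetric]) (auto intro!: sum.cong simp: ennreal_mult)
    finally have E: "(\<integral>\<^sup>+u. ennreal (exp (- l * h (sample N (K (R n s)) u))) \<partial>unif) = ennreal (?E (R n s))" .
    show "(\<integral>\<^sup>+u. ennreal (?w s * ?a (arr s n)) * ennreal (exp (- l * h (sample N (K (R n s)) u))) \<partial>unif) = ennreal (?w s * ?a (arr s n)) * ennreal (?E (R n s))"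
      by (subst nn_integral_cmult) (measurable, simp only: E)
  qed
  also have "\<dots> = (\<integral>\<^sup>+s. \<integral>\<^sup>+u. ennreal (?w (s(Inr n := u)) * ?a (arr (s(Inr n := u)) n)) * ennreal (?E (R n (s(Inr n := u)))) \<partial>unif \<partial>Q)"
    by (rule resample) measurable
  also have "\<dots> = (\<integral>\<^sup>+s. \<integral>\<^sup>+u. ennreal (?w s * ?a ((u < p (R n s)) = right)) * ennreal (?E (R n s)) \<partial>unif \<partial>Q)"
    by (intro nn_integral_cong) (simp add: W_upd_Inr arr_def)
  also have "\<dots> \<le> (\<integral>\<^sup>+s. ennreal (W n s) \<partial>Q)"
  proof (intro nn_integral_mono)
    fix s
    have r: "R n s \<in> {1..N}" by (rule R_range)
    have g0: "0 \<le> gp True (R n s)" "0 \<le> gp False (R n s)" using gp_bounds[OF r] by (auto simp: less_imp_le)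
    have "(\<integral>\<^sup>+u. ennreal (?w s * ?a ((u < p (R n s)) = right)) * ennreal (?E (R n s)) \<partial>unif)
      = ennreal (gp True (R n s)) * (ennreal (?w s * ?a True) * ennreal (?E (R n s))) + ennreal (gp False (R n s)) * (ennreal (?w s * ?a False) * ennreal (?E (R n s)))"
      by (rule nn_integral_arrow[OF r, of "\<lambda>b. ennreal (?w s * ?a b) * ennreal (?E (R n s))"])
    also have "\<dots> = ennreal (gp True (R n s) * (?w s * ?a True * ?E (R n s)) + gp False (R n s) * (?w s * ?a False * ?E (R n s)))"
      using g0 E0[of s] w0[of s] by (subst ennreal_plus) (auto simp: ennreal_mult intro!: mult_nonneg_nonneg)
    also have "\<dots> \<le> ennreal (W n s)"
    proof (rule ennreal_leI)
      have "gp True (R n s) * (?w s * ?a True * ?E (R n s)) + gp False (R n s) * (?w s * ?a False * ?E (R n s))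
         = W n s * ((gp True (R n s) * exp (- l * (1 - c)) + gp False (R n s) * exp (l * c)) * (?E (R n s) * exp (l * h (R n s))))"
        by (simp add: algebra_simps)
      also have "\<dots> \<le> W n s * 1"
        by (intro mult_left_mono one_step r) (simp add: W_def)
      finally show "gp True (R n s) * (?w s * ?a True * ?E (R n s)) + gp False (R n s) * (?w s * ?a False * ?E (R n s)) \<le> W n s"
        by (simp only: mult_1_right)
    qed
    finally show "(\<integral>\<^sup>+u. ennreal (?w s * ?a ((u < p (R n s)) = right)) * ennreal (?E (R n s)) \<partial>unif) \<le> ennreal (W n s)" .
  qed
  finally show ?thesis .
qed

lemma nn_integral_W: "(\<integral>\<^sup>+s. ennreal (W n s) \<partial>Q) \<le> ennreal (exp (l * H))"
proof (induction n)
  case 0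
  have "(\<integral>\<^sup>+s. ennreal (W 0 s) \<partial>Q) \<le> (\<integral>\<^sup>+s. ennreal (exp (l * H)) \<partial>Q)"
  proof (intro nn_integral_mono ennreal_leI)
    fix s
    have "l * (- h (R 0 s)) \<le> l * H" using H(1)[OF R_range[of 0 s]] l by (intro mult_left_mono) auto
    then show "W 0 s \<le> exp (l * H)" by (simp add: W_def)
  qed
  then show ?case by (simp add: Q.emeasure_space_1)
next
  case (Suc n)
  then show ?case using nn_integral_W_Suc[of n] by (rule order_trans[rotated])
qed

text \<open>One factor \<open>exp (l * H)\<close> bounds the initial value of the supermartingale;
  the other is lost when the corrector is dropped at the end.\<close>

definition C0 :: real where "C0 = exp (2 * l * H)"

lemma ones_set: "{s. ones (arr s) n < k} \<in> sets Q"
proof -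
  have "{s \<in> space Q. ones (arr s) n < k} \<in> sets Q" by measurable
  then show ?thesis by (simp add: space_Q)
qed

lemma ones_tail: "measure Q {s. ones (arr s) n < k} \<le> C0 * exp (l * (real k - c * real n))"
proof -
  let ?x = "exp (- l * (real k - c * real n + H))"
  have "ennreal ?x * emeasure Q {s. ones (arr s) n < k} = (\<integral>\<^sup>+s. ennreal ?x * indicator {s. ones (arr s) n < k} s \<partial>Q)"
    using ones_set by (simp add: nn_integral_cmult_indicator)
  also have "\<dots> \<le> (\<integral>\<^sup>+s. ennreal (W n s) \<partial>Q)"
  proof (intro nn_integral_mono)
    fix s
    show "ennreal ?x * indicator {s. ones (arr s) n < k} s \<le> ennreal (W n s)"
    proof (cases "ones (arr s) n < k")
      case True
      then have "real (ones (arr s) n) - c * real n + h (R n s) \<le> real k - c * real n + H"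
        using H(1)[OF R_range[of n s]] by linarith
      then have "l * (real (ones (arr s) n) - c * real n + h (R n s)) \<le> l * (real k - c * real n + H)"
        using l by (intro mult_left_mono) auto
      then show ?thesis using True by (simp add: W_def ennreal_leI)
    qed simp
  qed
  also have "\<dots> \<le> ennreal (exp (l * H))" by (rule nn_integral_W)
  finally have "ennreal (?x * measure Q {s. ones (arr s) n < k}) \<le> ennreal (exp (l * H))"
    by (simp add: Q.emeasure_eq_measure ennreal_mult)
  then have "?x * measure Q {s. ones (arr s) n < k} \<le> exp (l * H)" by (simp add: ennreal_le_iff)
  then have 1: "exp (l * (real k - c * real n + H)) * (?x * measure Q {s. ones (arr s) n < k}) \<le> exp (l * (real k - c * real n + H)) * exp (l * H)"
    by (intro mult_left_mono) auto
  have 2: "exp (l * (real k - c * real n + H)) * (?x * measure Q {s. ones (arr s) n < k}) = measure Q {s. ones (arr s) n < k}"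
    by (simp add: mult.assoc[symmetric] flip: exp_add)
  have 3: "exp (l * (real k - c * real n + H)) * exp (l * H) = C0 * exp (l * (real k - c * real n))"
    unfolding C0_def by (simp add: algebra_simps flip: exp_add)
  show ?thesis using 1 unfolding 2 3 .
qed

lemma AE_good: "AE s in Q. good (arr s)"
proof -
  have "AE s in Q. \<exists>n. k \<le> ones (arr s) n" for k
  proof -
    let ?B = "{s. \<forall>n. ones (arr s) n < k}"
    have "{s \<in> space Q. \<forall>n. ones (arr s) n < k} \<in> sets Q" by measurable
    then have B: "?B \<in> sets Q" by (simp add: space_Q)
    have le: "measure Q ?B \<le> C0 * exp (l * (real k - c * real n))" for n
      using Q.finite_measure_mono[of ?B "{s. ones (arr s) n < k}"] ones_set ones_tail[of n k] by force
    have "(\<lambda>n. exp (- ((l * c) * real n))) \<longlonglongrightarrow> 0"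
    proof -
      have "(\<lambda>n. exp (- (l * c)) ^ n) \<longlonglongrightarrow> 0" using l c by (intro LIMSEQ_power_zero) auto
      then show ?thesis by (simp add: exp_of_nat_mult[symmetric] mult.commute)
    qed
    then have "(\<lambda>n. C0 * exp (l * real k) * exp (- ((l * c) * real n))) \<longlonglongrightarrow> C0 * exp (l * real k) * 0"
      by (intro tendsto_intros)
    moreover have "C0 * exp (l * real k) * exp (- ((l * c) * real n)) = C0 * exp (l * (real k - c * real n))" for n
      by (simp add: algebra_simps flip: exp_add)
    ultimately have "(\<lambda>n. C0 * exp (l * (real k - c * real n))) \<longlonglongrightarrow> 0" by simp
    then have "measure Q ?B \<le> 0" using le by (intro LIMSEQ_le_const) auto
    then have "emeasure Q ?B = 0" by (simp add: Q.emeasure_eq_measure measure_le_0_iff)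
    then have "?B \<in> null_sets Q" using B by auto
    then show ?thesis by (rule AE_I'[of ?B]) (auto simp: not_le)
  qed
  then have "AE s in Q. \<forall>k. \<exists>n. k \<le> ones (arr s) n" by (simp add: AE_all_countable)
  then show ?thesis by (simp add: good_def)
qed

section \<open>Tails and second moment of the number of left arrows\<close>

lemma zeros_tail:
  assumes "0 < k"
  shows "measure Q {s. m < zeros_before (arr s) k} \<le> C0 * exp (l * (real k - c * (real k + real m)))"
proof -
  have "measure Q {s. m < zeros_before (arr s) k} \<le> measure Q {s. ones (arr s) (k + m) < k}"
  proof (intro Q.finite_measure_mono subsetI ones_set)
    fix s assume "s \<in> {s. m < zeros_before (arr s) k}"
    then show "s \<in> {s. ones (arr s) (k + m) < k}"
      using zeros_before_gt_iff[of "arr s" k m] assms by (cases "good (arr s)") (auto simp: zeros_before_def)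
  qed
  also have "\<dots> \<le> C0 * exp (l * (real k - c * (real k + real m)))" using ones_tail[of "k + m" k] by simp
  finally show ?thesis .
qed

text \<open>If \<open>k \<le> 2 * c * m\<close>, the exponent satisfies
  \<open>k - c * (k + m) \<le> - c * (2 * c - 1) * m\<close>, so this is the decay rate beyond
  \<open>m = k / (2 * c)\<close>. It is positive because \<open>c > 1/2\<close>.\<close>

definition \<kappa> :: real where "\<kappa> = l * c * (2 * c - 1)"

lemma \<kappa>: "0 < \<kappa>" using l c by (simp add: \<kappa>_def)

definition C1 :: real where "C1 = (\<Sum>m. real (2 * m + 1) * (C0 * exp (- \<kappa> * real m)))"

lemma C1_summable: "summable (\<lambda>m. real (2 * m + 1) * (C0 * exp (- \<kappa> * real m)))"
proof -
  have "summable (\<lambda>m. of_nat (Suc m) * exp (- \<kappa>) ^ m :: real)"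
    using geometric_deriv_sums[of "exp (- \<kappa>)"] \<kappa> by (auto simp: sums_iff)
  then have "summable (\<lambda>m. 2 * C0 * (of_nat (Suc m) * exp (- \<kappa>) ^ m))" by (rule summable_mult)
  then show ?thesis
  proof (rule summable_comparison_test'[where N = 0])
    fix m
    have e: "exp (- \<kappa> * real m) = exp (- \<kappa>) ^ m" by (simp add: exp_of_nat_mult[symmetric] mult.commute)
    have "real (2 * m + 1) * (C0 * exp (- \<kappa>) ^ m) \<le> (2 * real (Suc m)) * (C0 * exp (- \<kappa>) ^ m)"
      by (intro mult_right_mono) (auto simp: C0_def)
    then show "norm (real (2 * m + 1) * (C0 * exp (- \<kappa> * real m))) \<le> 2 * C0 * (of_nat (Suc m) * exp (- \<kappa>) ^ m)"
      unfolding e by (simp add: C0_def abs_mult algebra_simps)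
  qed
qed

lemma C1_nonneg: "0 \<le> C1"
  unfolding C1_def using C1_summable by (intro suminf_nonneg) (auto simp: C0_def)

lemma square_eq_sum_odd: "(n::nat)\<^sup>2 = (\<Sum>m<n. 2 * m + 1)"
  by (induction n) (auto simp: power2_eq_square)

lemma zeros_measurable [measurable]: "(\<lambda>s. zeros_before (arr s) k) \<in> measurable Q (count_space UNIV)"
  unfolding zeros_before_def good_def by measurable

text \<open>The square is written as a sum of odd numbers over the values \<open>m\<close> that are
  exceeded. Those below \<open>L\<close> contribute at most \<open>L\<^sup>2\<close> pointwise;
  those above contribute exponentially small tails, whose total \<open>C1\<close> does not depend on
  \<open>k\<close>.\<close>

lemma nn_integral_zeros_sq:
  assumes k: "0 < k" and L: "real k \<le> 2 * c * real L"
  shows "(\<integral>\<^sup>+s. ennreal ((real (zeros_before (arr s) k))\<^sup>2) \<partial>Q) \<le> ennreal ((real L)\<^sup>2 + C1)"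
proof -
  let ?F = "\<lambda>s. zeros_before (arr s) k"
  let ?A = "\<lambda>m. {s. m < ?F s}"
  have A [measurable]: "?A m \<in> sets Q" for m
  proof -
    have "{s \<in> space Q. m < ?F s} \<in> sets Q" by measurable
    then show ?thesis by (simp add: space_Q)
  qed
  let ?t = "\<lambda>m. if L \<le> m then real (2 * m + 1) else 0"
  have pw: "ennreal ((real (?F s))\<^sup>2) \<le> ennreal ((real L)\<^sup>2) + (\<Sum>m. ennreal (?t m) * indicator (?A m) s)" for s
  proof -
    have "(real (?F s))\<^sup>2 = (\<Sum>m<?F s. real (2 * m + 1))"
      unfolding of_nat_power[symmetric] square_eq_sum_odd by simp
    also have "\<dots> \<le> (\<Sum>m<?F s. (if m < L then real (2 * m + 1) else 0) + ?t m)"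
      by (intro sum_mono) auto
    also have "\<dots> = (\<Sum>m<?F s. (if m < L then real (2 * m + 1) else 0)) + (\<Sum>m<?F s. ?t m)"
      by (simp add: sum.distrib)
    also have "(\<Sum>m<?F s. (if m < L then real (2 * m + 1) else 0)) = (\<Sum>m\<in>{..<?F s} \<inter> {..<L}. real (2 * m + 1))"
      by (intro sum.mono_neutral_cong_right) auto
    also have "\<dots> \<le> (\<Sum>m<L. real (2 * m + 1))" by (intro sum_mono2) auto
    also have "\<dots> = (real L)\<^sup>2" unfolding of_nat_power[symmetric] square_eq_sum_odd by simp
    finally have "ennreal ((real (?F s))\<^sup>2) \<le> ennreal ((real L)\<^sup>2 + (\<Sum>m<?F s. ?t m))"
      by (intro ennreal_leI) simp
    also have "\<dots> = ennreal ((real L)\<^sup>2) + ennreal (\<Sum>m<?F s. ?t m)"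
      by (rule ennreal_plus) (auto intro: sum_nonneg)
    also have "ennreal (\<Sum>m<?F s. ?t m) = (\<Sum>m<?F s. ennreal (?t m) * indicator (?A m) s)"
      by (subst sum_ennreal[symmetric]) (auto intro!: sum.cong simp: indicator_def)
    also have "\<dots> \<le> (\<Sum>m. ennreal (?t m) * indicator (?A m) s)"
      by (intro sum_le_suminf summableI) auto
    finally show ?thesis by (simp add: add_left_mono)
  qed
  have "(\<integral>\<^sup>+s. ennreal ((real (?F s))\<^sup>2) \<partial>Q) \<le> (\<integral>\<^sup>+s. ennreal ((real L)\<^sup>2) + (\<Sum>m. ennreal (?t m) * indicator (?A m) s) \<partial>Q)"
    by (intro nn_integral_mono pw)
  also have "\<dots> = ennreal ((real L)\<^sup>2) + (\<integral>\<^sup>+s. (\<Sum>m. ennreal (?t m) * indicator (?A m) s) \<partial>Q)"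
    by (subst nn_integral_add) (auto simp: Q.emeasure_space_1)
  also have "(\<integral>\<^sup>+s. (\<Sum>m. ennreal (?t m) * indicator (?A m) s) \<partial>Q) = (\<Sum>m. ennreal (?t m) * emeasure Q (?A m))"
    by (subst nn_integral_suminf) (auto simp: nn_integral_cmult_indicator A)
  also have "\<dots> \<le> (\<Sum>m. ennreal (real (2 * m + 1) * (C0 * exp (- \<kappa> * real m))))"
  proof (intro suminf_le summableI)
    fix m
    show "ennreal (?t m) * emeasure Q (?A m) \<le> ennreal (real (2 * m + 1) * (C0 * exp (- \<kappa> * real m)))"
    proof (cases "L \<le> m")
      case True
      have "real k \<le> 2 * c * real m" using L True c by (meson mult_left_mono of_nat_le_iff order_trans zero_le_mult_iff less_eq_real_def zero_less_numeral divide_pos_pos less_trans zero_less_one)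
      then have "(1 - c) * real k \<le> (1 - c) * (2 * c * real m)" using c by (intro mult_left_mono) auto
      then have "real k - c * (real k + real m) \<le> - (c * (2 * c - 1)) * real m"
        by (simp add: algebra_simps power2_eq_square)
      then have "l * (real k - c * (real k + real m)) \<le> l * (- (c * (2 * c - 1)) * real m)" using l by (intro mult_left_mono) auto
      then have "l * (real k - c * (real k + real m)) \<le> - \<kappa> * real m" by (simp add: \<kappa>_def algebra_simps)
      then have "C0 * exp (l * (real k - c * (real k + real m))) \<le> C0 * exp (- \<kappa> * real m)" by (simp add: C0_def)
      then have "measure Q (?A m) \<le> C0 * exp (- \<kappa> * real m)" using zeros_tail[OF k, of m] by linarith
      then have "ennreal (real (2 * m + 1) * measure Q (?A m)) \<le> ennreal (real (2 * m + 1) * (C0 * exp (- \<kappa> * real m)))"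
        by (intro ennreal_leI mult_left_mono) auto
      then show ?thesis using True by (simp add: Q.emeasure_eq_measure ennreal_mult)
    qed simp
  qed
  also have "\<dots> = ennreal C1"
    unfolding C1_def using C1_summable by (intro suminf_ennreal2) (auto simp: C0_def)
  also have "ennreal ((real L)\<^sup>2) + ennreal C1 = ennreal ((real L)\<^sup>2 + C1)" using C1_nonneg by simp
  finally show ?thesis by (simp add: add_left_mono)
qed

text \<open>At density \<open>c\<close> of right arrows there are \<open>(1 - c) / c\<close> left
  arrows per right arrow; \<open>\<theta>\<close> lies strictly between this ratio and 1, which
  leaves room for exponential tails.\<close>

definition \<theta> :: real where "\<theta> = 1 / (2 * c)"

lemma \<theta>: "0 < \<theta>" "\<theta> < 1" using c by (auto simp: \<theta>_def field_simps)

definition \<rho> :: real where "\<rho> = (1 + \<theta>\<^sup>2) / 2"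

lemma \<rho>: "0 < \<rho>" "\<rho> < 1" "\<theta>\<^sup>2 < 1"
proof -
  show "\<theta>\<^sup>2 < 1" using \<theta> by (simp add: power_less_one_iff abs_square_less_1)
  then show "\<rho> < 1" by (simp add: \<rho>_def)
  show "0 < \<rho>" by (simp add: \<rho>_def add_pos_nonneg)
qed

text \<open>The summand 4 is the square of the shift by 2 due to rounding and to
  \<open>Suc k\<close>, the quotient comes from absorbing the cross term into the gap between
  \<open>\<theta>\<^sup>2\<close> and \<open>\<rho>\<close>, and \<open>C1\<close> collects the
  tails.\<close>

definition C2 :: real where "C2 = 4 + 4 / (\<rho> - \<theta>\<^sup>2) + C1"

lemma \<rho>\<theta>: "0 < \<rho> - \<theta>\<^sup>2" using \<rho>(3) by (simp add: \<rho>_def)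

lemma C2_nonneg: "0 \<le> C2"
  using C1_nonneg \<rho>\<theta> by (simp add: C2_def)

lemma second_moment:
  "(\<integral>\<^sup>+s. ennreal ((real (zeros_before (arr s) (Suc k)))\<^sup>2) \<partial>Q) \<le> ennreal (\<rho> * (real k)\<^sup>2 + C2)"
proof -
  define L where "L = nat \<lceil>\<theta> * real (Suc k)\<rceil>"
  have L: "\<theta> * real (Suc k) \<le> real L" "real L \<le> \<theta> * real (Suc k) + 1"
  proof -
    have "0 \<le> \<theta> * real (Suc k)" using \<theta> by simp
    then show "\<theta> * real (Suc k) \<le> real L" "real L \<le> \<theta> * real (Suc k) + 1"
      unfolding L_def by linarith+
  qed
  have "real (Suc k) \<le> 2 * c * real L" using L(1) c by (simp add: \<theta>_def field_simps)
  then have "(\<integral>\<^sup>+s. ennreal ((real (zeros_before (arr s) (Suc k)))\<^sup>2) \<partial>Q) \<le> ennreal ((real L)\<^sup>2 + C1)"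
    by (intro nn_integral_zeros_sq) auto
  also have "\<dots> \<le> ennreal (\<rho> * (real k)\<^sup>2 + C2)"
  proof (rule ennreal_leI)
    let ?e = "\<rho> - \<theta>\<^sup>2"
    have "real L \<le> \<theta> * real k + 2" using L(2) \<theta> by (simp add: algebra_simps)
    then have "(real L)\<^sup>2 \<le> (\<theta> * real k + 2)\<^sup>2" by (intro power_mono) auto
    also have "\<dots> = \<theta>\<^sup>2 * (real k)\<^sup>2 + 4 * (\<theta> * real k) + 4" by (simp add: power2_sum power_mult_distrib)
    also have "\<dots> \<le> \<theta>\<^sup>2 * (real k)\<^sup>2 + 4 * real k + 4" using \<theta> by (simp add: mult_left_le_one_le)
    also have "4 * real k \<le> ?e * (real k)\<^sup>2 + 4 / ?e"
    proof -
      have "4 * x \<le> e * x\<^sup>2 + 4 / e" if "0 < e" for e x :: real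
      proof -
        have "0 \<le> (e * x - 2)\<^sup>2 / e" using that by simp
        also have "\<dots> = e * x\<^sup>2 - 4 * x + 4 / e"
          using that by (simp add: field_simps power2_eq_square)
        finally show ?thesis by simp
      qed
      from this[OF \<rho>\<theta>] show ?thesis .
    qed
    finally show "(real L)\<^sup>2 + C1 \<le> \<rho> * (real k)\<^sup>2 + C2" by (simp add: C2_def algebra_simps)
  qed
  finally show ?thesis .
qed

section \<open>Chance of an initial run of right arrows\<close>

definition pmin :: real where "pmin = Min ((\<lambda>r. min (p r) (1 - p r)) ` {1..N})"

lemma pmin: "0 < pmin" "r \<in> {1..N} \<Longrightarrow> pmin \<le> gp b r"
proof -
  show "0 < pmin" unfolding pmin_def using N p by (subst Min_gr_iff) auto
  assume r: "r \<in> {1..N}"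
  have "pmin \<le> min (p r) (1 - p r)" unfolding pmin_def using r by (intro Min_le) auto
  then show "pmin \<le> gp b r" by (auto simp: gp_def)
qed

text \<open>Whatever the cookie state, the coin of visit \<open>k\<close> gives the favoured arrow
  with probability at least \<open>pmin\<close>. Redrawing that coin affects neither the state nor
  the earlier arrows, so the factors multiply.\<close>

lemma all_ones_pos: "ennreal (pmin ^ k) \<le> emeasure Q {s. \<forall>j<k. arr s j}"
proof (induction k)
  case 0
  show ?case using Q.emeasure_space_1 by (simp add: space_Q)
next
  case (Suc k)
  have sets: "{s. \<forall>j<k. arr s j} \<in> sets Q" for k
  proof -
    have "{s \<in> space Q. \<forall>j<k. arr s j} \<in> sets Q" by measurable
    then show ?thesis by (simp add: space_Q)
  qed
  let ?I = "indicator {s. \<forall>j<k. arr s j} :: _ \<Rightarrow> ennreal"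
  have [measurable]: "?I \<in> borel_measurable Q" using sets by simp
  have I: "?I (s(Inr k := u)) = ?I s" for s u by (auto simp: indicator_def arr_upd_Inr)
  have "ennreal (pmin ^ Suc k) = ennreal pmin * ennreal (pmin ^ k)" using pmin(1) by (simp add: ennreal_mult)
  also have "\<dots> \<le> ennreal pmin * emeasure Q {s. \<forall>j<k. arr s j}" using Suc by (intro mult_left_mono) auto
  also have "\<dots> = (\<integral>\<^sup>+s. ennreal pmin * ?I s \<partial>Q)" using sets by (simp add: nn_integral_cmult_indicator)
  also have "\<dots> \<le> (\<integral>\<^sup>+s. ennreal (gp True (R k s)) * ?I s \<partial>Q)"
    by (intro nn_integral_mono mult_right_mono ennreal_leI pmin R_range) auto
  also have "\<dots> = (\<integral>\<^sup>+s. \<integral>\<^sup>+u. ?I s * (if (u < p (R k s)) = right then 1 else 0) \<partial>unif \<partial>Q)"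
  proof (intro nn_integral_cong)
    fix s
    show "ennreal (gp True (R k s)) * ?I s = (\<integral>\<^sup>+u. ?I s * (if (u < p (R k s)) = right then 1 else 0) \<partial>unif)"
      using nn_integral_arrow[OF R_range, of "\<lambda>b. ?I s * (if b then 1 else 0)" k s] by simp
  qed
  also have "\<dots> = (\<integral>\<^sup>+s. \<integral>\<^sup>+u. ?I (s(Inr k := u)) * (if arr (s(Inr k := u)) k then 1 else 0) \<partial>unif \<partial>Q)"
    by (simp only: I) (simp add: arr_def)
  also have "\<dots> = (\<integral>\<^sup>+s. ?I s * (if arr s k then 1 else 0) \<partial>Q)"
    by (rule resample[symmetric]) measurable
  also have "\<dots> = (\<integral>\<^sup>+s. indicator {s. \<forall>j<Suc k. arr s j} s \<partial>Q)"
    by (intro nn_integral_cong) (auto simp: indicator_def less_Suc_eq)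
  also have "\<dots> = emeasure Q {s. \<forall>j<Suc k. arr s j}" using sets by simp
  finally show ?case .
qed

lemma zero_pos: "0 < measure Q {s. zeros_before (arr s) k = 0}"
proof -
  have sets: "{s. zeros_before (arr s) k = 0} \<in> sets Q"
  proof -
    have "{s \<in> space Q. zeros_before (arr s) k = 0} \<in> sets Q" by measurable
    then show ?thesis by (simp add: space_Q)
  qed
  have "0 < ennreal (pmin ^ k)" using pmin(1) by simp
  also have "\<dots> \<le> emeasure Q {s. \<forall>j<k. arr s j}" by (rule all_ones_pos)
  also have "\<dots> \<le> emeasure Q {s. zeros_before (arr s) k = 0}"
    using sets by (intro emeasure_mono) (auto intro: zeros_before_all_ones)
  finally show ?thesis by (simp add: Q.emeasure_eq_measure)
qed

section \<open>Forcing the first arrow by moving its coin\<close>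

definition fl :: "bool \<Rightarrow> nat \<Rightarrow> real \<Rightarrow> real" where
  "fl b r u = (if b = right then 0 + p r * unit_clamp u else p r + (1 - p r) * unit_clamp u)"

definition flip :: "bool \<Rightarrow> (nat + nat \<Rightarrow> real) \<Rightarrow> (nat + nat \<Rightarrow> real)" where
  "flip b s = s(Inr 0 := fl b (R 0 s) (s (Inr 0)))"

text \<open>Forcing the first arrow to be \<open>b\<close> amounts to conditioning the first coin,
  given the initial cookie state, so the density is the reciprocal probability on the event;
  \<open>1 / pmin\<close> bounds it.\<close>

definition \<phi> :: "bool \<Rightarrow> (nat + nat \<Rightarrow> real) \<Rightarrow> real" where
  "\<phi> b s = (if arr s 0 = b then 1 / gp b (R 0 s) else 0)"

lemma fl_less: "r \<in> {1..N} \<Longrightarrow> fl b r u < p r \<longleftrightarrow> b = right"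
  using p[of r] unit_clamp[of u] by (auto simp: fl_def mult_less_cancel_left2 not_less)

lemma arr_flip: "arr (flip b s) = case_nat b (\<lambda>j. arr s (Suc j))"
proof
  fix j show "arr (flip b s) j = (case j of 0 \<Rightarrow> b | Suc j \<Rightarrow> arr s (Suc j))"
    using fl_less[OF R_range, of b 0 s] by (cases j) (auto simp: flip_def arr_def)
qed

lemma fl_comp_measurable [measurable]: "(\<lambda>s. fl b (R 0 s) (s (Inr 0))) \<in> borel_measurable Q"
  by (cases "b = right") (simp_all add: fl_def)

lemma flip_measurable: "flip b \<in> measurable Q Q"
  unfolding flip_def[abs_def] by (rule update_measurable) measurable

lemma \<phi>_measurable: "\<phi> b \<in> borel_measurable Q"
proof -
  have [measurable]: "{s \<in> space Q. arr s 0 = b} \<in> sets Q" by (cases b) simp_all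
  show ?thesis unfolding \<phi>_def[abs_def] by measurable
qed

lemma nn_integral_fl:
  assumes r: "r \<in> {1..N}" and [measurable]: "f \<in> borel_measurable borel"
  shows "(\<integral>\<^sup>+u. f (fl b r u) \<partial>unif) = (\<integral>\<^sup>+u. ennreal (if ((u < p r) = right) = b then 1 / gp b r else 0) * f u \<partial>unif)"
proof -
  have pr: "0 < p r" "p r < 1" using p[OF r] by auto
  have fu: "f \<in> borel_measurable unif" by (simp cong: measurable_cong_sets add: sets_unif assms)
  show ?thesis
  proof (cases "b = right")
    case True
    have "(\<integral>\<^sup>+u. f (fl b r u) \<partial>unif) = ennreal (1 / p r) * (\<integral>\<^sup>+u. indicator {0..<0 + p r} u * f u \<partial>unif)"
    proof -
      have "fl b r = (\<lambda>u. 0 + p r * unit_clamp u)" using True by (simp add: fl_def fun_eq_iff)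
      then show ?thesis using nn_integral_affine_unit_clamp[of f 0 "p r"] assms pr by simp
    qed
    also have "\<dots> = (\<integral>\<^sup>+u. ennreal (1 / p r) * (indicator {0..<0 + p r} u * f u) \<partial>unif)"
      using fu by (intro nn_integral_cmult[symmetric] borel_measurable_times_ennreal borel_measurable_indicator) (auto simp: sets_unif)
    also have "\<dots> = (\<integral>\<^sup>+u. ennreal (if ((u < p r) = right) = b then 1 / gp b r else 0) * f u \<partial>unif)"
      by (rule nn_integral_cong_AE, rule AE_mp[OF AE_unif], rule AE_I2) (use True in \<open>auto simp: indicator_def gp_def\<close>)
    finally show ?thesis .
  next
    case False
    have "(\<integral>\<^sup>+u. f (fl b r u) \<partial>unif) = ennreal (1 / (1 - p r)) * (\<integral>\<^sup>+u. indicator {p r..<p r + (1 - p r)} u * f u \<partial>unif)"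
    proof -
      have "fl b r = (\<lambda>u. p r + (1 - p r) * unit_clamp u)" using False by (simp add: fl_def fun_eq_iff)
      then show ?thesis using nn_integral_affine_unit_clamp[of f "p r" "1 - p r"] assms pr by simp
    qed
    also have "\<dots> = (\<integral>\<^sup>+u. ennreal (1 / (1 - p r)) * (indicator {p r..<p r + (1 - p r)} u * f u) \<partial>unif)"
      using fu by (intro nn_integral_cmult[symmetric] borel_measurable_times_ennreal borel_measurable_indicator) (auto simp: sets_unif)
    also have "\<dots> = (\<integral>\<^sup>+u. ennreal (if ((u < p r) = right) = b then 1 / gp b r else 0) * f u \<partial>unif)"
      by (rule nn_integral_cong_AE, rule AE_mp[OF AE_unif], rule AE_I2) (use False in \<open>auto simp: indicator_def gp_def\<close>)
    finally show ?thesis .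
  qed
qed

lemma flip_density:
  assumes g [measurable]: "g \<in> borel_measurable Q"
  shows "(\<integral>\<^sup>+s. g (flip b s) \<partial>Q) = (\<integral>\<^sup>+s. ennreal (\<phi> b s) * g s \<partial>Q)"
proof -
  note [measurable] = \<phi>_measurable
  have gu: "(\<lambda>u. g (s(Inr 0 := u))) \<in> borel_measurable borel" for s
  proof -
    have "(\<lambda>u. (s(Inr 0 := u)) k) \<in> measurable borel unif" for k
      by (cases "k = Inr 0") (simp_all cong: measurable_cong_sets add: sets_unif)
    then have "(\<lambda>u. s(Inr 0 := u)) \<in> measurable borel Q"
      unfolding Q_def by (intro measurable_into_PiM space_unif)
    then show ?thesis by (rule measurable_compose) (rule g)
  qed
  have "(\<integral>\<^sup>+s. g (flip b s) \<partial>Q) = (\<integral>\<^sup>+s. \<integral>\<^sup>+u. g (flip b (s(Inr 0 := u))) \<partial>unif \<partial>Q)"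
    by (rule resample) (rule measurable_compose[OF flip_measurable g])
  also have "\<dots> = (\<integral>\<^sup>+s. \<integral>\<^sup>+u. g (s(Inr 0 := fl b (R 0 s) u)) \<partial>unif \<partial>Q)"
    by (simp add: flip_def)
  also have "\<dots> = (\<integral>\<^sup>+s. \<integral>\<^sup>+u. ennreal (if ((u < p (R 0 s)) = right) = b then 1 / gp b (R 0 s) else 0) * g (s(Inr 0 := u)) \<partial>unif \<partial>Q)"
    by (intro nn_integral_cong nn_integral_fl[OF R_range gu])
  also have "\<dots> = (\<integral>\<^sup>+s. \<integral>\<^sup>+u. ennreal (\<phi> b (s(Inr 0 := u))) * g (s(Inr 0 := u)) \<partial>unif \<partial>Q)"
    by (simp add: \<phi>_def arr_def cong: if_cong)
  also have "\<dots> = (\<integral>\<^sup>+s. ennreal (\<phi> b s) * g s \<partial>Q)"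
    by (rule resample[symmetric]) measurable
  finally show ?thesis .
qed

sublocale S: stack_law Q arr \<rho> C2 "1 / pmin" flip \<phi>
proof
  show "\<phi> b s \<le> 1 / pmin" for b s
    using pmin(1) pmin(2)[OF R_range, of b 0 s] by (auto simp: \<phi>_def intro!: divide_left_mono mult_pos_pos)
  show "0 \<le> \<phi> b s" for b s
    using gp_bounds[OF R_range, of b 0 s] by (auto simp: \<phi>_def less_imp_le)
qed (use space_Q AE_good \<rho> C2_nonneg second_moment zero_pos arr_flip flip_measurable \<phi>_measurable flip_density arr_measurable in auto)

end

section \<open>Coupling the walk with independent stacks\<close>

text \<open>A finite path is determined by its decisions \<open>dec k x c\<close>: step right at time \<open>k\<close> from \<open>x\<close> at the
  \<open>c\<close>-th visit.\<close>

definition path_spec :: "(nat \<Rightarrow> int \<Rightarrow> nat \<Rightarrow> bool) \<Rightarrow> nat \<Rightarrow> int list \<Rightarrow> bool" where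
  "path_spec dec n s \<longleftrightarrow> length s = Suc n \<and> s ! 0 = 0 \<and>
     (\<forall>k<n. s ! Suc k = (if dec k (s ! k) (count_list (take (Suc k) s) (s ! k)) then s ! k + 1 else s ! k - 1))"

lemma path_spec_unique:
  assumes "path_spec dec n s" "path_spec dec n t" shows "s = t"
proof -
  have len: "length s = Suc n" "length t = Suc n" using assms by (auto simp: path_spec_def)
  have "k \<le> n \<Longrightarrow> take (Suc k) s = take (Suc k) t" for k
  proof (induction k)
    case 0
    then show ?case using assms len by (cases s; cases t) (auto simp: path_spec_def)
  next
    case (Suc k)
    then have IH: "take (Suc k) s = take (Suc k) t" by simp
    have "s ! k = t ! k" using arg_cong[OF IH, of "\<lambda>l. l ! k"] by simp
    then have "s ! Suc k = t ! Suc k" using assms IH Suc.prems by (simp add: path_spec_def)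
    then show ?case using IH len Suc.prems by (simp add: take_Suc_conv_app_nth[of "Suc k"])
  qed
  from this[of n] show ?thesis using len by simp
qed

lemma path_spec_iff:
  assumes "path_spec dec n t" shows "t = s \<longleftrightarrow> path_spec dec n s"
  using assms path_spec_unique by blast

lemma length_erw_path: "length (erw_path \<omega> V n) = Suc n"
  by (induction n) (auto simp: Let_def)

lemma erw_path_nth: "k \<le> n \<Longrightarrow> erw_path \<omega> V n ! k = last (erw_path \<omega> V k)"
proof (induction n)
  case (Suc n)
  show ?case
  proof (cases "k = Suc n")
    case True
    then show ?thesis using length_erw_path[of \<omega> V "Suc n"] by (subst last_conv_nth) auto
  next
    case False
    then show ?thesis using Suc length_erw_path[of \<omega> V n] by (simp add: Let_def nth_append)
  qed
qed simp

lemma erw_path_spec: "path_spec (\<lambda>k x c. V k < \<omega> x c) n (erw_path \<omega> V n)"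
proof (induction n)
  case (Suc n)
  let ?s = "erw_path \<omega> V n"
  have len: "length ?s = Suc n" by (rule length_erw_path)
  then have last: "last ?s = ?s ! n" by (subst last_conv_nth) auto
  define y where "y = (if V n < \<omega> (?s ! n) (count_list ?s (?s ! n)) then ?s ! n + 1 else ?s ! n - 1)"
  have s: "erw_path \<omega> V (Suc n) = ?s @ [y]" by (simp add: Let_def last y_def)
  show ?case
    unfolding path_spec_def s
  proof (intro conjI allI impI)
    show "length (?s @ [y]) = Suc (Suc n)" using len by simp
    show "(?s @ [y]) ! 0 = 0" using Suc len by (simp add: nth_append path_spec_def)
    fix k assume k: "k < Suc n"
    show "(?s @ [y]) ! Suc k = (if V k < \<omega> ((?s @ [y]) ! k) (count_list (take (Suc k) (?s @ [y])) ((?s @ [y]) ! k))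
        then (?s @ [y]) ! k + 1 else (?s @ [y]) ! k - 1)"
      using Suc len k by (cases "k = n") (auto simp: nth_append path_spec_def y_def)
  qed
qed (simp add: path_spec_def)

lemma used_eq_count:
  assumes "c \<noteq> 0" shows "used a n x = count_list (map (\<lambda>k. c * pos a k) [0..<n]) (c * x)"
  using assms by (induction n) (auto simp: used_Suc)

text \<open>The factor \<open>c\<close> reflects the walk when it is \<open>-1\<close>. The visit
  number in a path includes the present visit, whereas the state of the walk counts only earlier
  ones, hence \<open>m - 1\<close>.\<close>

lemma pos_path_spec:
  fixes c :: int assumes c: "c = 1 \<or> c = -1"
  shows "path_spec (\<lambda>k x m. (c = 1) = a (c * x) (m - 1)) n (map (\<lambda>k. c * pos a k) [0..<Suc n])"
  unfolding path_spec_def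
proof (intro conjI allI impI)
  let ?s = "map (\<lambda>k. c * pos a k) [0..<Suc n]"
  show "?s ! 0 = 0" by (subst nth_map) (auto simp del: upt_Suc)
  fix k assume k: "k < n"
  have nth: "?s ! j = c * pos a j" if "j \<le> n" for j using that by (subst nth_map) (auto simp del: upt_Suc)
  have "take (Suc k) ?s = map (\<lambda>k. c * pos a k) [0..<Suc k]" using k by (simp add: take_map del: upt_Suc)
  then have count: "count_list (take (Suc k) ?s) (c * pos a k) = Suc (used a k (pos a k))"
    using c used_eq_count[of c a k "pos a k"] by auto
  have cc: "c * (c * pos a k) = pos a k" using c by auto
  show "?s ! Suc k = (if (c = 1) = a (c * (?s ! k)) (count_list (take (Suc k) ?s) (?s ! k) - 1) then ?s ! k + 1 else ?s ! k - 1)"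
    unfolding nth[OF less_imp_le[OF k]] nth[OF Suc_leI[OF k]] count cc using c by (auto simp: pos_Suc)
qed simp

text \<open>Different times at the same site have different visit numbers, so no coin is assigned
  twice when coins are indexed by site and visit.\<close>

lemma path_visits_inj:
  assumes "k < m" "m < length s" "s ! k = s ! m"
  shows "count_list (take (Suc k) s) (s ! k) < count_list (take (Suc m) s) (s ! m)"
proof -
  have "count_list (take m s) (s ! m) = count_list (take (Suc k) (take m s) @ drop (Suc k) (take m s)) (s ! m)"
    by (simp only: append_take_drop_id)
  also have "\<dots> = count_list (take (Suc k) s) (s ! m) + count_list (drop (Suc k) (take m s)) (s ! m)"
    using assms by (simp add: min_def)
  finally show ?thesis using assms by (simp add: take_Suc_conv_app_nth[of m])
qed

text \<open>A cylinder set constrains finitely many times, so it is determined by a finite initial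
  path, and finite paths are countable in number.\<close>

lemma distr_sequence_eqI:
  fixes f :: "nat \<Rightarrow> 'a \<Rightarrow> int" and g :: "nat \<Rightarrow> 'b \<Rightarrow> int"
  assumes f [measurable]: "\<And>k. f k \<in> measurable M1 (count_space UNIV)"
    and g [measurable]: "\<And>k. g k \<in> measurable M2 (count_space UNIV)" and M1: "finite_measure M1"
    and eq: "\<And>n s. emeasure M1 {w \<in> space M1. map (\<lambda>k. f k w) [0..<Suc n] = s} = emeasure M2 {w \<in> space M2. map (\<lambda>k. g k w) [0..<Suc n] = s}"
  shows "distr M1 (PiM UNIV (\<lambda>_. count_space UNIV)) (\<lambda>w k. f k w) = distr M2 (PiM UNIV (\<lambda>_. count_space UNIV)) (\<lambda>w k. g k w)"
proof (rule measure_eqI_PiM_infinite)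
  let ?S = "PiM (UNIV :: nat set) (\<lambda>_. count_space (UNIV :: int set))"
  have map_eq: "{w \<in> space M. map (\<lambda>k. h k w) [0..<Suc n] = s} = (if length s = Suc n then {w \<in> space M. \<forall>k<Suc n. h k w = s ! k} else {})"
    for M and h :: "nat \<Rightarrow> 'c \<Rightarrow> int" and n s
    by (auto simp: list_eq_iff_nth_eq simp del: upt_Suc)
  have path: "(\<lambda>w. map (\<lambda>k. h k w) [0..<Suc n]) \<in> measurable M (count_space UNIV)"
    if [measurable]: "\<And>k. h k \<in> measurable M (count_space UNIV)" for M and h :: "nat \<Rightarrow> 'c \<Rightarrow> int" and n
  proof (subst measurable_count_space_eq_countable)
    show "(\<lambda>w. map (\<lambda>k. h k w) [0..<Suc n]) \<in> space M \<rightarrow> UNIV \<and> (\<forall>s\<in>UNIV. (\<lambda>w. map (\<lambda>k. h k w) [0..<Suc n]) -` {s} \<inter> space M \<in> sets M)"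
    proof (intro conjI ballI)
      fix s
      have "(\<lambda>w. map (\<lambda>k. h k w) [0..<Suc n]) -` {s} \<inter> space M = {w \<in> space M. map (\<lambda>k. h k w) [0..<Suc n] = s}" by auto
      also have "\<dots> \<in> sets M" unfolding map_eq by simp
      finally show "(\<lambda>w. map (\<lambda>k. h k w) [0..<Suc n]) -` {s} \<inter> space M \<in> sets M" .
    qed simp
  qed simp
  have dist: "distr M1 (count_space UNIV) (\<lambda>w. map (\<lambda>k. f k w) [0..<Suc n]) = distr M2 (count_space UNIV) (\<lambda>w. map (\<lambda>k. g k w) [0..<Suc n])" for n
  proof (rule measure_eqI_countable[where A = UNIV])
    fix s :: "int list"
    show "emeasure (distr M1 (count_space UNIV) (\<lambda>w. map (\<lambda>k. f k w) [0..<Suc n])) {s} = emeasure (distr M2 (count_space UNIV) (\<lambda>w. map (\<lambda>k. g k w) [0..<Suc n])) {s}"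
      using eq[of n s] by (simp add: emeasure_distr path f g vimage_def Int_def conj_commute del: upt_Suc)
  qed auto
  have seq: "(\<lambda>w k. h k w) \<in> measurable M ?S" if "\<And>k. h k \<in> measurable M (count_space UNIV)" for M and h :: "nat \<Rightarrow> 'c \<Rightarrow> int"
    using that by (intro measurable_into_PiM) auto
  show "finite_measure (distr M1 ?S (\<lambda>w k. f k w))"
    using M1 seq[of f M1] f by (simp add: finite_measure.finite_measure_distr)
  fix A :: "nat \<Rightarrow> int set" and J :: "nat set" assume J: "finite J"
  obtain n where n: "\<And>j. j \<in> J \<Longrightarrow> j \<le> n" using finite_nat_set_iff_bounded_le[THEN iffD1, OF J] by blast
  let ?B = "{s :: int list. \<forall>j\<in>J. s ! j \<in> A j}"
  have E: "emeasure (distr M ?S (\<lambda>w k. h k w)) (prod_emb UNIV (\<lambda>_. count_space UNIV) J (Pi\<^sub>E J A)) = emeasure (distr M (count_space UNIV) (\<lambda>w. map (\<lambda>k. h k w) [0..<Suc n])) ?B"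
    if h: "\<And>k. h k \<in> measurable M (count_space UNIV)" for M and h :: "nat \<Rightarrow> 'c \<Rightarrow> int"
  proof -
    have "(\<lambda>w k. h k w) -` prod_emb UNIV (\<lambda>_. count_space UNIV) J (Pi\<^sub>E J A) \<inter> space M = (\<lambda>w. map (\<lambda>k. h k w) [0..<Suc n]) -` ?B \<inter> space M"
    proof -
      have "map (\<lambda>k. h k w) [0..<Suc n] ! j = h j w" if "j \<in> J" for j w
        using n[OF that] by (subst nth_map) (auto simp del: upt_Suc)
      then show ?thesis by (auto simp: prod_emb_def PiE_iff extensional_def simp del: upt_Suc)
    qed
    then show ?thesis using J seq[OF h] path[OF h] by (subst (1 2) emeasure_distr) (auto intro!: sets_PiM_I)
  qed
  show "emeasure (distr M1 ?S (\<lambda>w k. f k w)) (prod_emb UNIV (\<lambda>_. count_space UNIV) J (Pi\<^sub>E J A)) = emeasure (distr M2 ?S (\<lambda>w k. g k w)) (prod_emb UNIV (\<lambda>_. count_space UNIV) J (Pi\<^sub>E J A))"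
    unfolding E[OF f] E[OF g] dist ..
qed auto

lemma filterlim_uminus_int_at_bot:
  fixes f :: "'a \<Rightarrow> int" assumes "filterlim f at_top F" shows "filterlim (\<lambda>x. - f x) at_bot F"
  unfolding filterlim_at_bot
proof
  fix Z
  have "eventually (\<lambda>x. - Z \<le> f x) F" using assms unfolding filterlim_at_top by blast
  then show "eventually (\<lambda>x. - f x \<le> Z) F" by eventually_elim simp
qed

lemma space_erw_space: "space erw_space = UNIV"
  unfolding erw_space_def by (rule space_PiM_UNIV[OF prob_space_unif space_unif])

lemma prob_space_erw_space: "prob_space erw_space"
  unfolding erw_space_def by (rule prob_space_PiM_UNIV[OF prob_space_unif space_unif])

context markov_stack
begin

definition sg :: int where "sg = (if right then 1 else -1)"

lemma sg: "sg = 1 \<or> sg = -1" and sg_if: "right \<Longrightarrow> sg = 1" "\<not> right \<Longrightarrow> sg = -1"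
  unfolding sg_def by auto

abbreviation flat :: "(int \<times> (nat + nat) \<Rightarrow> real) measure" where "flat \<equiv> PiM UNIV (\<lambda>_. unif)"

definition dec0 :: "((int \<times> nat) + nat \<Rightarrow> real) \<Rightarrow> nat \<Rightarrow> int \<Rightarrow> nat \<Rightarrow> bool" where
  "dec0 w k x m \<longleftrightarrow> w (Inr k) < cookie_env N K p \<eta> w x m"

definition dec1 :: "(int \<times> (nat + nat) \<Rightarrow> real) \<Rightarrow> nat \<Rightarrow> int \<Rightarrow> nat \<Rightarrow> bool" where
  "dec1 v k x m \<longleftrightarrow> v (sg * x, Inr (m - 1)) < p (R (m - 1) (\<lambda>i. v (sg * x, i)))"

text \<open>The coin used at time \<open>k\<close> along the path \<open>s\<close> is identified with the coin of the visited site;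
  the coins after time \<open>n\<close> are sent to unused ones.\<close>

definition reindex :: "int list \<Rightarrow> nat \<Rightarrow> (int \<times> nat) + nat \<Rightarrow> int \<times> (nat + nat)" where
  "reindex s n i = (case i of Inl (x, j) \<Rightarrow> (sg * x, Inl j)
     | Inr k \<Rightarrow> if k < n then (sg * (s ! k), Inr (count_list (take (Suc k) s) (s ! k) - 1)) else (0, Inr (n + k)))"

lemma count_take_bounds:
  assumes "length s = Suc n" "k < n"
  shows "0 < count_list (take (Suc k) s) (s ! k)" "count_list (take (Suc k) s) (s ! k) \<le> n"
proof -
  have "s ! k \<in> set (take (Suc k) s)" using assms by (auto simp: take_Suc_conv_app_nth)
  then show "0 < count_list (take (Suc k) s) (s ! k)" by (metis count_list_0_iff gr0I)
  have "count_list (take (Suc k) s) (s ! k) \<le> length (take (Suc k) s)" by (rule count_le_length)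
  then show "count_list (take (Suc k) s) (s ! k) \<le> n" using assms by simp
qed

lemma inj_reindex:
  assumes len: "length s = Suc n" shows "inj (reindex s n)"
proof -
  let ?c = "\<lambda>k. count_list (take (Suc k) s) (s ! k)"
  have sgc: "sg * x = sg * y \<longleftrightarrow> x = y" for x y using sg by auto
  have kk: "k = m" if "k < n" "m < n" "s ! k = s ! m" "?c k - 1 = ?c m - 1" for k m
  proof (rule ccontr)
    assume "k \<noteq> m"
    have "?c k = ?c m" using that count_take_bounds(1)[OF len that(1)] count_take_bounds(1)[OF len that(2)] by linarith
    then show False
      using \<open>k \<noteq> m\<close> path_visits_inj[of k m s] path_visits_inj[of m k s] that len by (cases "k < m") auto
  qed
  have kn: "?c k - 1 \<noteq> n + m" if "k < n" for k m
    using count_take_bounds[OF len that] by linarith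
  show ?thesis
  proof (rule injI)
    fix i j assume e: "reindex s n i = reindex s n j"
    show "i = j"
    proof (cases i; cases j)
      fix k m assume i: "i = Inr k" and j: "j = Inr m"
      show ?thesis
        using e kk[of k m] kn[of k m] kn[of m k] sgc unfolding i j reindex_def by (auto split: if_splits)
    qed (use e sgc in \<open>auto simp: reindex_def split: if_splits prod.splits\<close>)
  qed
qed

text \<open>The reindexing depends on the path \<open>s\<close> and agrees with the walk only while
  the walk follows \<open>s\<close>. The coupling is therefore made separately for each event that
  the path equals \<open>s\<close>, and yields equality of laws rather than of walks.\<close>

lemma path_spec_reindex:
  "path_spec (dec0 (\<lambda>i. v (reindex s n i))) n s \<longleftrightarrow> path_spec (dec1 v) n s"
proof -
  have "dec0 (\<lambda>i. v (reindex s n i)) k (s ! k) (count_list (take (Suc k) s) (s ! k)) = dec1 v k (s ! k) (count_list (take (Suc k) s) (s ! k))" if "k < n" for k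
    using that by (simp add: dec0_def dec1_def reindex_def cookie_env_def cookie_state_def R_def)
  then show ?thesis unfolding path_spec_def by auto
qed

lemma erw_coord_measurable [measurable]: "(\<lambda>w. w i) \<in> borel_measurable erw_space"
  using measurable_PiM_coord[of i unif] unfolding erw_space_def by (simp cong: measurable_cong_sets add: sets_unif)

lemma cookie_env_measurable [measurable]: "(\<lambda>w. cookie_env N K p \<eta> w x m) \<in> borel_measurable erw_space"
proof -
  have "(\<lambda>w. chain N K \<eta> (\<lambda>i. w (Inl (x, i))) j) \<in> measurable erw_space (count_space UNIV)" for j
  proof (induction j)
    case 0
    show ?case by simp
  next
    case (Suc j)
    show ?case unfolding chain.simps
      by (rule measurable_compose_countable[where f = "\<lambda>r w. sample N (K r) (w (Inl (x, Suc j)))", OF _ Suc]) measurable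
  qed
  from measurable_compose[OF this[of "m - 1"], of p borel] show ?thesis
    unfolding cookie_env_def cookie_state_def by simp
qed

lemma dec0_measurable [measurable]: "Measurable.pred erw_space (\<lambda>w. dec0 w k x m)"
  unfolding dec0_def by measurable

lemma spec0_measurable: "{w. path_spec (dec0 w) n s} \<in> sets erw_space"
proof -
  have "{w \<in> space erw_space. path_spec (dec0 w) n s} \<in> sets erw_space"
    unfolding path_spec_def by measurable
  then show ?thesis by (simp add: space_erw_space)
qed

lemma erw_path_iff: "map (\<lambda>k. erw N K p \<eta> w k) [0..<Suc n] = s \<longleftrightarrow> path_spec (dec0 w) n s"
proof -
  have "map (\<lambda>k. erw N K p \<eta> w k) [0..<Suc n] = erw_path (cookie_env N K p \<eta> w) (\<lambda>m. w (Inr m)) n"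
    by (rule nth_equalityI) (auto simp: length_erw_path erw_path_nth erw_def simp del: upt_Suc)
  then show ?thesis
    using path_spec_iff[OF erw_path_spec] unfolding dec0_def by metis
qed

lemma X_path_iff: "map (\<lambda>k. sg * S.X k w) [0..<Suc n] = s \<longleftrightarrow> path_spec (dec1 (\<lambda>(x, i). w x i)) n s"
proof -
  have "(\<lambda>k x m. (sg = 1) = arr (w (sg * x)) (m - 1)) = dec1 (\<lambda>(x, i). w x i)"
    by (auto simp: fun_eq_iff dec1_def arr_def sg_def)
  then have "path_spec (dec1 (\<lambda>(x, i). w x i)) n (map (\<lambda>k. sg * S.X k w) [0..<Suc n])"
    using pos_path_spec[OF sg, of "\<lambda>x. arr (w x)" n] unfolding S.X_def by simp
  then show ?thesis by (rule path_spec_iff)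
qed

text \<open>Injective reindexing preserves a product of identical laws. For each fixed path this
  carries the time-indexed coins to visit-indexed ones, and flattening identifies the result with
  independent stacks.\<close>

lemma emeasure_path:
  "emeasure erw_space {w \<in> space erw_space. map (\<lambda>k. erw N K p \<eta> w k) [0..<Suc n] = s}
    = emeasure S.P {w \<in> space S.P. map (\<lambda>k. sg * S.X k w) [0..<Suc n] = s}"
proof (cases "length s = Suc n")
  case False
  then have "{w \<in> space erw_space. map (\<lambda>k. erw N K p \<eta> w k) [0..<Suc n] = s} = {}"
    "{w \<in> space S.P. map (\<lambda>k. sg * S.X k w) [0..<Suc n] = s} = {}" by auto
  then show ?thesis by (simp only: emeasure_empty)
next
  case True
  let ?r = "\<lambda>v i. v (reindex s n i)" and ?f = "\<lambda>w (x, i). w x i"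
  have r: "?r \<in> measurable flat erw_space"
    unfolding erw_space_def by (rule measurable_PiM_reindex[OF prob_space_unif space_unif])
  have dr: "distr flat erw_space ?r = erw_space"
    unfolding erw_space_def by (rule distr_PiM_UNIV_reindex[OF prob_space_unif space_unif inj_reindex[OF True]])
  have f: "?f \<in> measurable S.P flat"
  proof (rule measurable_into_PiM[OF space_unif])
    fix i show "(\<lambda>w. (?f w) i) \<in> measurable S.P unif"
      using measurable_compose[OF S.coord_measurable[of "fst i"], of "\<lambda>s. s (snd i)" unif] measurable_PiM_coord[of "snd i" unif]
      by (simp add: split_beta' Q_def)
  qed
  have df: "distr S.P flat ?f = flat"
    unfolding S.P_def unfolding Q_def by (rule distr_PiM_flatten[OF prob_space_unif space_unif])
  have spec1: "{v. path_spec (dec1 v) n s} = ?r -` {w. path_spec (dec0 w) n s} \<inter> space flat"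
    by (auto simp: path_spec_reindex space_PiM_UNIV[OF prob_space_unif space_unif])
  have spec1_sets: "{v. path_spec (dec1 v) n s} \<in> sets flat"
    unfolding spec1 by (rule measurable_sets[OF r spec0_measurable])
  have "emeasure erw_space {w \<in> space erw_space. map (\<lambda>k. erw N K p \<eta> w k) [0..<Suc n] = s} = emeasure (distr flat erw_space ?r) {w. path_spec (dec0 w) n s}"
    unfolding dr by (simp only: erw_path_iff space_erw_space) simp
  also have "\<dots> = emeasure flat {v. path_spec (dec1 v) n s}"
    unfolding spec1 by (rule emeasure_distr[OF r spec0_measurable])
  also have "\<dots> = emeasure (distr S.P flat ?f) {v. path_spec (dec1 v) n s}"
    unfolding df ..
  also have "\<dots> = emeasure S.P (?f -` {v. path_spec (dec1 v) n s} \<inter> space S.P)"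
    by (rule emeasure_distr[OF f spec1_sets])
  also have "?f -` {v. path_spec (dec1 v) n s} \<inter> space S.P = {w \<in> space S.P. map (\<lambda>k. sg * S.X k w) [0..<Suc n] = s}"
    by (auto simp: X_path_iff simp del: upt_Suc)
  finally show ?thesis .
qed

section \<open>Transfer of the limit theorems to the given walk\<close>

abbreviation seqs :: "(nat \<Rightarrow> int) measure" where "seqs \<equiv> PiM UNIV (\<lambda>_. count_space UNIV)"

lemma erw_measurable [measurable]: "(\<lambda>w. erw N K p \<eta> w k) \<in> measurable erw_space (count_space UNIV)"
proof (subst measurable_count_space_eq_countable)
  have sets: "{w. erw N K p \<eta> w k = y} \<in> sets erw_space" for y
  proof -
    have "{w. erw N K p \<eta> w k = y} = (\<Union>s\<in>{s. s ! k = y}. {w. path_spec (dec0 w) k s})"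
    proof (intro set_eqI iffI)
      fix w assume "w \<in> {w. erw N K p \<eta> w k = y}"
      then have "map (\<lambda>k. erw N K p \<eta> w k) [0..<Suc k] ! k = y" by (subst nth_map) (auto simp del: upt_Suc)
      moreover have "path_spec (dec0 w) k (map (\<lambda>k. erw N K p \<eta> w k) [0..<Suc k])" using erw_path_iff by blast
      ultimately show "w \<in> (\<Union>s\<in>{s. s ! k = y}. {w. path_spec (dec0 w) k s})" by blast
    next
      fix w assume "w \<in> (\<Union>s\<in>{s. s ! k = y}. {w. path_spec (dec0 w) k s})"
      then obtain s where "s ! k = y" "path_spec (dec0 w) k s" by blast
      then have "s ! k = y" "map (\<lambda>k. erw N K p \<eta> w k) [0..<Suc k] = s" using erw_path_iff by blast+
      then have "map (\<lambda>k. erw N K p \<eta> w k) [0..<Suc k] ! k = y" by simp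
      then show "w \<in> {w. erw N K p \<eta> w k = y}" by (subst (asm) nth_map) (auto simp del: upt_Suc)
    qed
    then show ?thesis using spec0_measurable by (auto intro!: sets.countable_UN')
  qed
  show "(\<lambda>w. erw N K p \<eta> w k) \<in> space erw_space \<rightarrow> UNIV \<and> (\<forall>y\<in>UNIV. (\<lambda>w. erw N K p \<eta> w k) -` {y} \<inter> space erw_space \<in> sets erw_space)"
    using sets by (simp add: space_erw_space vimage_def)
qed simp

lemma distr_erw: "distr erw_space seqs (\<lambda>w k. erw N K p \<eta> w k) = distr S.P seqs (\<lambda>w k. sg * S.X k w)"
  using prob_space_erw_space by (intro distr_sequence_eqI emeasure_path) (auto intro: prob_space.finite_measure)

lemma erw_seq_measurable: "(\<lambda>w k. erw N K p \<eta> w k) \<in> measurable erw_space seqs"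
  by (intro measurable_into_PiM erw_measurable) simp

lemma X_seq_measurable: "(\<lambda>w k. sg * S.X k w) \<in> measurable S.P seqs"
  by (intro measurable_into_PiM) simp_all

lemma measure_erw_eq:
  assumes "{x. \<Psi> x} \<in> sets seqs"
  shows "measure erw_space {w \<in> space erw_space. \<Psi> (\<lambda>k. erw N K p \<eta> w k)} = measure S.P {w \<in> space S.P. \<Psi> (\<lambda>k. sg * S.X k w)}"
proof -
  have "measure erw_space {w \<in> space erw_space. \<Psi> (\<lambda>k. erw N K p \<eta> w k)} = measure (distr erw_space seqs (\<lambda>w k. erw N K p \<eta> w k)) {x. \<Psi> x}"
    by (subst measure_distr[OF erw_seq_measurable assms]) (auto intro!: arg_cong[where f = "measure erw_space"])
  also have "\<dots> = measure S.P {w \<in> space S.P. \<Psi> (\<lambda>k. sg * S.X k w)}"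
    unfolding distr_erw by (subst measure_distr[OF X_seq_measurable assms]) (auto intro!: arg_cong[where f = "measure S.P"])
  finally show ?thesis .
qed

lemma coord_seqs [measurable]: "(\<lambda>x. x k) \<in> measurable seqs (count_space UNIV)"
  by (rule measurable_PiM_coord)

lemma space_seqs: "space seqs = UNIV"
  by (simp add: space_PiM PiE_UNIV_domain)

lemma measure_erw_AE:
  assumes sets: "{x. \<Psi> x} \<in> sets seqs" and ae: "AE w in S.P. \<Psi> (\<lambda>k. sg * S.X k w)"
  shows "measure erw_space {w \<in> space erw_space. \<Psi> (\<lambda>k. erw N K p \<eta> w k)} = 1"
    "AE w in erw_space. \<Psi> (\<lambda>k. erw N K p \<eta> w k)"
proof -
  interpret E: prob_space erw_space by (rule prob_space_erw_space)
  have "{w \<in> space S.P. \<Psi> (\<lambda>k. sg * S.X k w)} = (\<lambda>w k. sg * S.X k w) -` {x. \<Psi> x} \<inter> space S.P" by auto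
  then have "{w \<in> space S.P. \<Psi> (\<lambda>k. sg * S.X k w)} \<in> sets S.P" using measurable_sets[OF X_seq_measurable sets] by simp
  with ae have "measure S.P {w \<in> space S.P. \<Psi> (\<lambda>k. sg * S.X k w)} = 1" by (simp add: S.P.prob_Collect_eq_1)
  then show 1: "measure erw_space {w \<in> space erw_space. \<Psi> (\<lambda>k. erw N K p \<eta> w k)} = 1"
    by (simp add: measure_erw_eq[OF sets])
  have "{w \<in> space erw_space. \<Psi> (\<lambda>k. erw N K p \<eta> w k)} = (\<lambda>w k. erw N K p \<eta> w k) -` {x. \<Psi> x} \<inter> space erw_space" by auto
  then have "{w \<in> space erw_space. \<Psi> (\<lambda>k. erw N K p \<eta> w k)} \<in> sets erw_space" using measurable_sets[OF erw_seq_measurable sets] by simp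
  with 1 show "AE w in erw_space. \<Psi> (\<lambda>k. erw N K p \<eta> w k)" by (simp add: E.prob_Collect_eq_1)
qed

lemma seqs_at_top: "{x. filterlim x at_top sequentially} \<in> sets seqs" "{x. filterlim x at_bot sequentially} \<in> sets seqs"
proof -
  have "{x \<in> space seqs. \<forall>Z. \<exists>m. \<forall>n\<ge>m. Z \<le> x n} \<in> sets seqs" by measurable
  then show "{x. filterlim x at_top sequentially} \<in> sets seqs"
    by (simp add: filterlim_at_top eventually_sequentially space_seqs)
  have "{x \<in> space seqs. \<forall>Z. \<exists>m. \<forall>n\<ge>m. x n \<le> Z} \<in> sets seqs" by measurable
  then show "{x. filterlim x at_bot sequentially} \<in> sets seqs"
    by (simp add: filterlim_at_bot eventually_sequentially space_seqs)
qed

lemma seqs_speed: "{x. (\<lambda>n. real_of_int (x n) / real n) \<longlonglongrightarrow> v} \<in> sets seqs"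
proof -
  have iff: "y \<longlonglongrightarrow> v \<longleftrightarrow> (\<forall>k::nat. \<exists>m. \<forall>n\<ge>m. \<bar>y n - v\<bar> < 1 / real (Suc k))" for y :: "nat \<Rightarrow> real"
  proof
    assume "y \<longlonglongrightarrow> v"
    then show "\<forall>k::nat. \<exists>m. \<forall>n\<ge>m. \<bar>y n - v\<bar> < 1 / real (Suc k)" by (auto simp: LIMSEQ_iff)
  next
    assume a: "\<forall>k::nat. \<exists>m. \<forall>n\<ge>m. \<bar>y n - v\<bar> < 1 / real (Suc k)"
    show "y \<longlonglongrightarrow> v"
      unfolding LIMSEQ_iff
    proof (intro allI impI)
      fix e :: real assume "0 < e"
      then obtain k where k: "1 / real (Suc k) < e" using nat_approx_posE by blast
      from a obtain m where "\<forall>n\<ge>m. \<bar>y n - v\<bar> < 1 / real (Suc k)" by blast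
      then show "\<exists>m. \<forall>n\<ge>m. norm (y n - v) < e" using k by (intro exI[of _ m]) (auto intro: less_trans)
    qed
  qed
  have "{x \<in> space seqs. \<forall>k::nat. \<exists>m. \<forall>n\<ge>m. \<bar>real_of_int (x n) / real n - v\<bar> < 1 / real (Suc k)} \<in> sets seqs" by measurable
  then show ?thesis by (simp add: iff space_seqs)
qed

lemma seqs_level: "{x. (real_of_int (x n) - a) / b \<le> z} \<in> sets seqs"
proof -
  have "{x \<in> space seqs. (real_of_int (x n) - a) / b \<le> z} \<in> sets seqs" by measurable
  then show ?thesis by (simp add: space_seqs)
qed

theorem erw_transient:
  "right \<Longrightarrow> measure erw_space {w \<in> space erw_space. filterlim (erw N K p \<eta> w) at_top sequentially} = 1"
  "\<not> right \<Longrightarrow> measure erw_space {w \<in> space erw_space. filterlim (erw N K p \<eta> w) at_bot sequentially} = 1"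
proof -
  assume r: right
  have "AE w in S.P. filterlim (\<lambda>n. sg * S.X n w) at_top sequentially"
    using S.AE_transient by (simp add: sg_if(1)[OF r])
  then show "measure erw_space {w \<in> space erw_space. filterlim (erw N K p \<eta> w) at_top sequentially} = 1"
    using measure_erw_AE(1)[OF seqs_at_top(1)] by simp
next
  assume r: "\<not> right"
  have "AE w in S.P. filterlim (\<lambda>n. sg * S.X n w) at_bot sequentially"
    using S.AE_transient by eventually_elim (simp add: sg_if(2)[OF r] filterlim_uminus_int_at_bot)
  then show "measure erw_space {w \<in> space erw_space. filterlim (erw N K p \<eta> w) at_bot sequentially} = 1"
    using measure_erw_AE(1)[OF seqs_at_top(2)] by simp
qed

theorem erw_speed_clt:
  "\<exists>v0. (AE w in erw_space. (\<lambda>n. real_of_int (erw N K p \<eta> w n) / real n) \<longlonglongrightarrow> v0)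
      \<and> (if right then 0 < v0 else v0 < 0)
      \<and> (\<exists>b>0. \<forall>x. (\<lambda>n. measure erw_space {w \<in> space erw_space.
               (real_of_int (erw N K p \<eta> w n) - real n * v0) / (b * sqrt (real n)) \<le> x}) \<longlonglongrightarrow> Phi x)"
proof -
  let ?v = "real_of_int sg * (1 / S.\<tau>)" and ?b = "S.s / (S.\<tau> * sqrt S.\<tau>)"
  let ?Y = "\<lambda>n w. (real_of_int (S.X n w) - real n * (1 / S.\<tau>)) / (?b * sqrt (real n))"
  have "AE w in S.P. (\<lambda>n. real_of_int (sg * S.X n w) / real n) \<longlonglongrightarrow> ?v"
    using S.AE_speed
  proof eventually_elim
    case (elim w)
    from tendsto_mult_left[OF this, of "real_of_int sg"] show ?case by simp
  qed
  then have speed: "AE w in erw_space. (\<lambda>n. real_of_int (erw N K p \<eta> w n) / real n) \<longlonglongrightarrow> ?v"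
    using measure_erw_AE(2)[OF seqs_speed] by simp
  have sign: "if right then 0 < ?v else ?v < 0"   proof (cases right)
    case True
    show ?thesis unfolding if_P[OF True] sg_if(1)[OF True] using S.\<tau>_pos by simp
  next
    case False
    show ?thesis unfolding if_not_P[OF False] sg_if(2)[OF False] using S.\<tau>_pos by simp
  qed
  have b: "0 < ?b" using S.\<tau>_pos S.s_pos by simp
  have lim: "(\<lambda>n. measure S.P {w \<in> space S.P. ?Y n w \<le> x}) \<longlonglongrightarrow> Phi x" for x
    using S.position_clt[of x] by (simp add: S.space_P)
  \<comment> \<open>In the reflected case the normalised position changes sign; symmetry of the
    normal law leaves the limit unchanged.\<close>
  have l: "(\<lambda>n. measure S.P {w \<in> space S.P. real_of_int sg * ?Y n w \<le> x}) \<longlonglongrightarrow> Phi x" for x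
  proof (cases right)
    case True
    show ?thesis using lim[of x] by (simp add: sg_if(1)[OF True])
  next
    case False
    have "(\<lambda>n. measure S.P {w \<in> space S.P. - ?Y n w \<le> x}) \<longlonglongrightarrow> Phi x"
      by (rule S.P.tendsto_Phi_uminus[OF _ lim])
         (intro borel_measurable_divide borel_measurable_diff borel_measurable_const measurable_compose[OF S.X_measurable], simp)
    then show ?thesis by (simp add: sg_if(2)[OF False])
  qed
  have eq: "real_of_int sg * ?Y n w = (real_of_int (sg * S.X n w) - real n * ?v) / (?b * sqrt (real n))" for n w
    by (simp add: right_diff_distrib mult.left_commute)
  have lim': "(\<lambda>n. measure S.P {w \<in> space S.P. (real_of_int (sg * S.X n w) - real n * ?v) / (?b * sqrt (real n)) \<le> x}) \<longlonglongrightarrow> Phi x" for x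
    using l[of x] unfolding eq .
  have meq: "measure erw_space {w \<in> space erw_space. (real_of_int (erw N K p \<eta> w n) - real n * ?v) / (?b * sqrt (real n)) \<le> x}
      = measure S.P {w \<in> space S.P. (real_of_int (sg * S.X n w) - real n * ?v) / (?b * sqrt (real n)) \<le> x}" for n x
    by (rule measure_erw_eq[OF seqs_level])
  have "\<forall>x. (\<lambda>n. measure erw_space {w \<in> space erw_space.
               (real_of_int (erw N K p \<eta> w n) - real n * ?v) / (?b * sqrt (real n)) \<le> x}) \<longlonglongrightarrow> Phi x"
    unfolding meq using lim' by blast
  with speed sign b show ?thesis by blast
qed

end

section \<open>Choice of the drift constants and conclusion\<close>

lemma markov_stack_exists:
  assumes N: "1 \<le> N" and K: "stochastic N K" and ex1: "\<exists>!R0. closed_irreducible N K R0"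
    and \<mu>: "stationary N K \<mu>" and p: "\<forall>i\<in>{1..N}. 0 < p i \<and> p i < 1" and \<eta>: "prob_vector N \<eta>"
    and gt: "1 / 2 < (\<Sum>i=1..N. \<mu> i * (if right then p i else 1 - p i))"
  shows "\<exists>h c \<delta>. markov_stack N K \<eta> p h right c \<delta>"
proof -
  let ?g = "\<lambda>i. if right then p i else 1 - p i"
  let ?m = "\<Sum>i=1..N. \<mu> i * ?g i"
  have "?m \<le> (\<Sum>i=1..N. \<mu> i)"
    using p \<mu> by (intro sum_mono mult_left_le) (auto simp: stationary_def prob_vector_def less_imp_le)
  then have m1: "?m \<le> 1" using \<mu> by (simp add: stationary_def prob_vector_def)
  obtain t where t: "1 / 2 < t" "t < ?m" using dense[OF gt] by blast
  obtain h where h: "\<forall>r\<in>{1..N}. t < ?g r + Kop N K h r - h r"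
    using drift_function[OF K ex1 \<mu> t(2)] by blast
  \<comment> \<open>The level \<open>t\<close> lies strictly between \<open>1/2\<close> and the
    stationary mean. Its midpoint with \<open>1/2\<close> serves as \<open>c\<close>, and the other
    half of the gap is the surplus \<open>\<delta>\<close>.\<close>
  have "markov_stack N K \<eta> p h right ((1/2 + t) / 2) (t - (1/2 + t) / 2)"
  proof
    show "(1/2 + t) / 2 + (t - (1/2 + t) / 2) \<le> ?g r + Kop N K h r - h r" if "r \<in> {1..N}" for r
      using h that by (simp add: less_imp_le)
  qed (use assms t m1 in auto)
  then show ?thesis by blast
qed

theorem theorem1p2:
  fixes N :: nat and K :: "nat \<Rightarrow> nat \<Rightarrow> real" and p \<mu> :: "nat \<Rightarrow> real"
  assumes "N \<ge> 1"
    and "stochastic N K"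
    and "\<exists>!R0. closed_irreducible N K R0"
    and "stationary N K \<mu>"
    and "\<forall>i\<in>{1..N}. 0 < p i \<and> p i < 1"
    and "(\<Sum>i=1..N. \<mu> i * p i) \<noteq> 1/2"
  shows
    "((\<Sum>i=1..N. \<mu> i * p i) > 1/2 \<longrightarrow> (\<forall>\<eta>. prob_vector N \<eta> \<longrightarrow>
        measure erw_space {w \<in> space erw_space. filterlim (erw N K p \<eta> w) at_top sequentially} = 1))
   \<and> ((\<Sum>i=1..N. \<mu> i * p i) < 1/2 \<longrightarrow> (\<forall>\<eta>. prob_vector N \<eta> \<longrightarrow>
        measure erw_space {w \<in> space erw_space. filterlim (erw N K p \<eta> w) at_bot sequentially} = 1))
   \<and> (\<forall>\<eta>. prob_vector N \<eta> \<longrightarrow> (\<exists>v0::real.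
        (AE w in erw_space. (\<lambda>n. real_of_int (erw N K p \<eta> w n) / real n) \<longlonglongrightarrow> v0)
      \<and> ((\<Sum>i=1..N. \<mu> i * p i) > 1/2 \<longrightarrow> v0 > 0)
      \<and> ((\<Sum>i=1..N. \<mu> i * p i) < 1/2 \<longrightarrow> v0 < 0)
      \<and> (\<exists>b>0. \<forall>x::real.
           (\<lambda>n. measure erw_space {w \<in> space erw_space.
               (real_of_int (erw N K p \<eta> w n) - real n * v0) / (b * sqrt (real n)) \<le> x})
           \<longlonglongrightarrow> Phi x)))"
proof -
  let ?m = "\<Sum>i=1..N. \<mu> i * p i"
  \<comment> \<open>The direction is fixed by the sign of \<open>?m - 1/2\<close>; below
    \<open>1/2\<close> it is the average of \<open>1 - p\<close> that exceeds one half. The choice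
    is the same for every \<open>\<eta>\<close>, while \<open>h\<close>, \<open>c\<close> and
    \<open>\<delta>\<close> are obtained for each.\<close>
  have stack: "\<exists>h c \<delta>. markov_stack N K \<eta> p h (1/2 < ?m) c \<delta>" if \<eta>: "prob_vector N \<eta>" for \<eta>
  proof -
    have "(\<Sum>i=1..N. \<mu> i * (1 - p i)) = 1 - ?m"
      using assms(4) by (simp add: right_diff_distrib sum_subtractf stationary_def prob_vector_def)
    then have "1 / 2 < (\<Sum>i=1..N. \<mu> i * (1 - p i))" if "\<not> 1/2 < ?m"
      using assms(6) that by linarith
    then have "1 / 2 < (\<Sum>i=1..N. \<mu> i * (if 1/2 < ?m then p i else 1 - p i))"
      by (cases "1/2 < ?m") (simp_all only: if_True if_False not_False_eq_True)
    then show ?thesis by (intro markov_stack_exists[OF assms(1-5) \<eta>])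
  qed
  have right: "measure erw_space {w \<in> space erw_space. filterlim (erw N K p \<eta> w) at_top sequentially} = 1"
    if "prob_vector N \<eta>" "1/2 < ?m" for \<eta>
    using stack[OF that(1)] markov_stack.erw_transient(1) that(2) by blast
  have left: "measure erw_space {w \<in> space erw_space. filterlim (erw N K p \<eta> w) at_bot sequentially} = 1"
    if "prob_vector N \<eta>" "?m < 1/2" for \<eta>
  proof -
    have "\<not> 1/2 < ?m" using that(2) by simp
    then show ?thesis using stack[OF that(1)] markov_stack.erw_transient(2) by blast
  qed
  have base: "\<exists>v0. (AE w in erw_space. (\<lambda>n. real_of_int (erw N K p \<eta> w n) / real n) \<longlonglongrightarrow> v0)
      \<and> (if 1/2 < ?m then 0 < v0 else v0 < 0)
      \<and> (\<exists>b>0. \<forall>x. (\<lambda>n. measure erw_space {w \<in> space erw_space.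
               (real_of_int (erw N K p \<eta> w n) - real n * v0) / (b * sqrt (real n)) \<le> x}) \<longlonglongrightarrow> Phi x)"
    if "prob_vector N \<eta>" for \<eta>
    using stack[OF that] markov_stack.erw_speed_clt by blast
  have speed: "\<exists>v0. (AE w in erw_space. (\<lambda>n. real_of_int (erw N K p \<eta> w n) / real n) \<longlonglongrightarrow> v0)
      \<and> (1/2 < ?m \<longrightarrow> 0 < v0) \<and> (?m < 1/2 \<longrightarrow> v0 < 0)
      \<and> (\<exists>b>0. \<forall>x. (\<lambda>n. measure erw_space {w \<in> space erw_space.
               (real_of_int (erw N K p \<eta> w n) - real n * v0) / (b * sqrt (real n)) \<le> x}) \<longlonglongrightarrow> Phi x)"
    if "prob_vector N \<eta>" for \<eta>
  proof -
    from base[OF that] obtain v0 where v0: "AE w in erw_space. (\<lambda>n. real_of_int (erw N K p \<eta> w n) / real n) \<longlonglongrightarrow> v0"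
      "if 1/2 < ?m then 0 < v0 else v0 < 0"
      "\<exists>b>0. \<forall>x. (\<lambda>n. measure erw_space {w \<in> space erw_space.
               (real_of_int (erw N K p \<eta> w n) - real n * v0) / (b * sqrt (real n)) \<le> x}) \<longlonglongrightarrow> Phi x"
      by (elim exE) (elim conjE, rule that)
    have s1: "1/2 < ?m \<longrightarrow> 0 < v0" and s2: "?m < 1/2 \<longrightarrow> v0 < 0"
      using v0(2) by (cases "1/2 < ?m", auto)+
    show ?thesis
      by (rule exI[of _ v0], rule conjI[OF v0(1)], rule conjI[OF s1], rule conjI[OF s2 v0(3)])
  qed
  show ?thesis
    by (intro conjI allI impI right left speed)
qed

end
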